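(* For every integer $n\geq 1$ there exists an $n$-dimensional Banach space $E$ such that $\Pi(E)=\Pi_n$ and $\Pi(E)$ is the infimum of $\lVert T_2\rVert\,\lVert T_1\rVert$ taken over all integers $d\geq 1$ and all factorizations $\mathrm{id}_E=T_2T_1$, where $T_1\colon E\to \ell_\infty^d$ and $T_2\colon \ell_\infty^d\to E$ are linear maps such that $T_1T_2$ is the orthogonal projection of $\ell_\infty^d$ onto $T_1(E)$.
   Context: All Banach spaces are real. For a finite-dimensional linear subspace $E$ of a Banach space $F$, $\Pi(E,F)$ denotes the minimal operator norm of a linear projection of $F$ onto $E$. The (absolute) projection constant of a finite-dimensional Banach space $E$ is $\Pi(E):=\Pi(E,\ell_\infty)$, where $E$ is regarded as a subspace of $\ell_\infty$ via a linear isometric embedding (the value does not depend on the embedding). The maximal projection constant of order $n$ is $\Pi_n:=\max\{\Pi(E): E \text{ a real Banach space},\ \dim(E)=n\}$. The space $\ell_\infty^d$ is $\mathbb{R}^d$ with the sup-norm, $\lVert T_1\rVert$ and $\lVert T_2\rVert$ are operator norms, and the orthogonal projection onto a linear subspace of $\mathbb{R}^d$ is taken with respect to the standard inner product of $\mathbb{R}^d$. *)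

theory Defs
  imports "HOL-Analysis.Analysis"
begin

text \<open>
  An \<open>n\<close>-dimensional real Banach space is given by an arbitrary norm on \<open>real ^ 'n\<close>
  with \<open>CARD('n) = n\<close>: every real normed space of dimension \<open>n\<close> is linearly isometric to one
  of this kind, and completeness is automatic. The built-in Euclidean norm of \<open>real ^ 'n\<close>
  plays no role.
\<close>

definition is_norm :: "('a::real_vector \<Rightarrow> real) \<Rightarrow> bool" where
  "is_norm N \<longleftrightarrow>
     (\<forall>x. 0 \<le> N x) \<and> (\<forall>x. N x = 0 \<longleftrightarrow> x = 0) \<and>
     (\<forall>x y. N (x + y) \<le> N x + N y) \<and> (\<forall>c x. N (c *\<^sub>R x) = \<bar>c\<bar> * N x)"

text \<open>
  Since \<open>nat\<close> is discrete, bounded continuous functions on it are exactly the bounded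
  real sequences, and their library norm is the supremum norm.
\<close>

type_synonym linf = "nat \<Rightarrow>\<^sub>C real"

text \<open>
  The ambient Banach space is the whole type. Projections are required to be
  bounded because \<open>onorm\<close> is meaningless for an unbounded operator. For finite-dimensional
  \<open>E\<close> inside \<open>linf\<close> the infimum is a minimum, by weak-* compactness.
\<close>

definition rel_proj_const :: "'a::real_normed_vector set \<Rightarrow> real" where
  "rel_proj_const E =
     Inf {onorm P | P. bounded_linear P \<and> range P = E \<and> (\<forall>x\<in>E. P x = x)}"

definition isometric_embedding :: "('a::real_vector \<Rightarrow> real) \<Rightarrow> ('a \<Rightarrow> linf) \<Rightarrow> bool" where
  "isometric_embedding N j \<longleftrightarrow> linear j \<and> (\<forall>x. norm (j x) = N x)"

text \<open>
  The choice of the embedding is immaterial, since the relative projection constant of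
  the image does not depend on it.
\<close>

definition proj_const :: "('a::real_vector \<Rightarrow> real) \<Rightarrow> real" where
  "proj_const N = rel_proj_const (range (SOME j. isometric_embedding N j))"

definition max_proj_const :: "'n::finite itself \<Rightarrow> real" where
  "max_proj_const _ = (GREATEST c. \<exists>N :: real ^ 'n \<Rightarrow> real. is_norm N \<and> c = proj_const N)"

text \<open>
  The space of \<open>d\<close>-tuples with the sup-norm, for a dimension \<open>d\<close> that varies inside
  formulas, is realised as the subspace of \<open>linf\<close> of all sequences that vanish from
  index \<open>d\<close> on; the inherited norm is the maximum of the absolute values of the first \<open>d\<close>
  entries.
\<close>

definition linf_d :: "nat \<Rightarrow> linf set" where
  "linf_d d = {x. \<forall>i\<ge>d. apply_bcontfun x i = 0}"

definition inner_d :: "nat \<Rightarrow> linf \<Rightarrow> linf \<Rightarrow> real" where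
  "inner_d d x y = (\<Sum>i<d. apply_bcontfun x i * apply_bcontfun y i)"

definition linear_on_subspace :: "'a::real_vector set \<Rightarrow> ('a \<Rightarrow> 'b::real_vector) \<Rightarrow> bool" where
  "linear_on_subspace V f \<longleftrightarrow>
     (\<forall>x\<in>V. \<forall>y\<in>V. f (x + y) = f x + f y) \<and> (\<forall>c. \<forall>x\<in>V. f (c *\<^sub>R x) = c *\<^sub>R f x)"

text \<open>Operator norm of \<open>f\<close> from the subspace \<open>V\<close> with norm \<open>N\<close> to a space with norm \<open>M\<close>.\<close>

definition op_norm ::
    "'a::real_vector set \<Rightarrow> ('a \<Rightarrow> real) \<Rightarrow> ('b::real_vector \<Rightarrow> real) \<Rightarrow> ('a \<Rightarrow> 'b) \<Rightarrow> real" where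
  "op_norm V N M f = (SUP x\<in>{x\<in>V. N x \<le> 1}. M (f x))"

definition orthogonal_projection_onto :: "nat \<Rightarrow> linf set \<Rightarrow> (linf \<Rightarrow> linf) \<Rightarrow> bool" where
  "orthogonal_projection_onto d W P \<longleftrightarrow>
     (\<forall>y\<in>linf_d d. P y \<in> W \<and> (\<forall>w\<in>W. inner_d d (y - P y) w = 0))"

text \<open>Values of \<open>T2\<close> outside \<open>linf_d d\<close> are irrelevant.\<close>

definition orthogonal_factorization ::
    "nat \<Rightarrow> ('a::real_vector \<Rightarrow> linf) \<Rightarrow> (linf \<Rightarrow> 'a) \<Rightarrow> bool" where
  "orthogonal_factorization d T1 T2 \<longleftrightarrow>
     linear T1 \<and> range T1 \<subseteq> linf_d d \<and> linear_on_subspace (linf_d d) T2 \<and>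
     (\<forall>x. T2 (T1 x) = x) \<and> orthogonal_projection_onto d (range T1) (T1 \<circ> T2)"

end

theory Submission
  imports Defs "HOL-Complex_Analysis.Great_Picard"
begin

text \<open>
  Everything is compared with one number \<open>\<phi>\<close>, called \<open>max_frame_value\<close> below: the supremum of
  \<open>\<Sum>i j. t i * t j * \<bar>u i \<bullet> u j\<bar>\<close> over all \<open>d\<close>, all unit vectors \<open>t\<close> of length \<open>d\<close> and all Parseval
  frames \<open>u\<close> with \<open>d\<close> members. For such a frame the Gram matrix \<open>P i j = u i \<bullet> u j\<close> is an orthogonal
  projection of rank \<open>n\<close> on \<open>d\<close>-tuples.

  No projection constant exceeds \<open>\<phi>\<close> (\<open>proj_const_le_max_frame_value\<close>). Finitely many coordinates
  \<open>y k \<bullet> x\<close> of an isometric embedding almost determine the norm, so a projection is essentially a left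
  inverse \<open>z\<close> of \<open>x \<mapsto> (y k \<bullet> x)\<close>, and its norm is the largest row sum \<open>\<Sum>k. \<bar>y i \<bullet> z k\<bar>\<close>. By a minimax
  argument the largest row sum may be replaced by a weighted average of row sums. For given weights
  \<open>w\<close>, the left inverse which is orthogonal with respect to \<open>w\<close> has the average
  \<open>\<Sum>i j. t i * t j * \<bar>u i \<bullet> u j\<bar>\<close> with \<open>t = sqrt w\<close> and a Parseval frame \<open>u\<close>, hence at most \<open>\<phi>\<close>.

  Conversely, let \<open>(t, u)\<close> be a maximiser for fixed \<open>d\<close>, with maximum \<open>\<mu>\<close>, and let \<open>y i = u i / t i\<close>.
  Stationarity in \<open>t\<close> says that \<open>\<bar>P\<bar>\<close> has the eigenvector \<open>t\<close>, so the projection with matrix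
  \<open>t i\<inverse> * P i j * t j\<close> has all row sums equal to \<open>\<mu>\<close>. Stationarity in \<open>u\<close> says that the matrix
  \<open>t i * t j * sgn (P i j)\<close> maps the range of \<open>P\<close> into itself, and trace duality with this matrix shows that
  no projection onto the space with norm \<open>max \<bar>y i \<bullet> x\<bar>\<close> has norm below \<open>\<mu>\<close>. Moreover the good
  projection is orthogonal for the weights \<open>(t i)\<^sup>2\<close>; repeating the coordinate \<open>i\<close> about
  \<open>K * (t i)\<^sup>2\<close> times makes it, up to a small error, orthogonal for the standard inner product.

  Two points need care. A maximiser may have vanishing \<open>t i\<close>; adding a small constant \<open>\<kappa>\<close> to all entries of
  \<open>\<bar>P\<bar>\<close> forces \<open>t\<close> to be positive and costs only \<open>\<kappa> * d\<close>. And \<open>\<phi>\<close> is only a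
  supremum over all \<open>d\<close>; so one takes spaces that are optimal up to \<open>1 / k\<close>, normalises their norms to be
  uniformly equivalent to the Euclidean one, and passes to a uniform limit as \<open>k\<close> grows, whose projection constant and whose infimum
  over orthogonal factorizations both equal \<open>\<phi>\<close>. That the infimum is never below the projection constant is
  general (\<open>proj_const_le_factorization\<close>).
\<close>

section \<open>Parseval frames and their values\<close>

definition parseval_frame :: "nat \<Rightarrow> (nat \<Rightarrow> 'a::euclidean_space) \<Rightarrow> bool" where
  "parseval_frame d u \<longleftrightarrow> (\<forall>x. (\<Sum>i<d. (u i \<bullet> x) *\<^sub>R u i) = x)"

definition frame_value :: "nat \<Rightarrow> (nat \<Rightarrow> real) \<Rightarrow> (nat \<Rightarrow> 'a::euclidean_space) \<Rightarrow> real" where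
  "frame_value d t u = (\<Sum>i<d. \<Sum>j<d. t i * t j * \<bar>u i \<bullet> u j\<bar>)"

definition max_frame_value :: "'a::euclidean_space itself \<Rightarrow> real" where
  "max_frame_value _ = Sup {frame_value d t u | d t u.
     parseval_frame d (u :: nat \<Rightarrow> 'a) \<and> (\<Sum>i<d. (t i)\<^sup>2) = 1}"

lemma parseval_frameD:
  assumes "parseval_frame d u"
  shows "(\<Sum>i<d. (u i \<bullet> x) *\<^sub>R u i) = x"
  using assms by (simp add: parseval_frame_def)

lemma parseval_frame_inner:
  assumes "parseval_frame d u"
  shows "(\<Sum>i<d. (u i \<bullet> x) * (u i \<bullet> y)) = x \<bullet> y"
proof -
  have "x \<bullet> y = (\<Sum>i<d. (u i \<bullet> x) *\<^sub>R u i) \<bullet> y"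
    using parseval_frameD[OF assms, of x] by simp
  then show ?thesis by (simp add: inner_sum_left)
qed

lemma parseval_frame_norm_sum:
  fixes u :: "nat \<Rightarrow> 'a::euclidean_space"
  assumes "parseval_frame d u"
  shows "(\<Sum>i<d. (norm (u i))\<^sup>2) = DIM('a)"
proof -
  have "(\<Sum>i<d. (norm (u i))\<^sup>2) = (\<Sum>i<d. \<Sum>b\<in>Basis. (u i \<bullet> b) * (u i \<bullet> b))"
    by (simp add: power2_norm_eq_inner euclidean_inner[symmetric])
  also have "\<dots> = (\<Sum>b\<in>Basis. \<Sum>i<d. (u i \<bullet> b) * (u i \<bullet> b))"
    by (rule sum.swap)
  also have "\<dots> = (\<Sum>b\<in>(Basis::'a set). b \<bullet> b)"
    by (simp add: parseval_frame_inner[OF assms])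
  also have "\<dots> = DIM('a)" by simp
  finally show ?thesis .
qed

text \<open>
  The crude bound keeps the frame vectors in a ball that does not depend on the frame, which is what the
  compactness argument for maximisers needs.
\<close>

lemma parseval_frame_norm_le:
  fixes u :: "nat \<Rightarrow> 'a::euclidean_space"
  assumes "parseval_frame d u" "i < d"
  shows "norm (u i) \<le> DIM('a)"
proof -
  have "(norm (u i))\<^sup>2 \<le> (\<Sum>i<d. (norm (u i))\<^sup>2)"
    using assms(2) by (intro member_le_sum) auto
  also have "\<dots> = DIM('a)" by (rule parseval_frame_norm_sum[OF assms(1)])
  also have "\<dots> \<le> (real DIM('a))\<^sup>2"
    using DIM_positive[where 'a='a] by (simp add: power2_eq_square)
  finally show ?thesis by (rule power2_le_imp_le) simp
qed

text \<open>
  By \<open>2 * a * b \<le> a\<^sup>2 + b\<^sup>2\<close> with \<open>a = t i * norm (u j)\<close> and \<open>b = t j * norm (u i)\<close>: the squared norms of the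
  members of a Parseval frame add up to the dimension, the trace of the projection.
\<close>

lemma frame_value_le:
  fixes u :: "nat \<Rightarrow> 'a::euclidean_space"
  assumes u: "parseval_frame d u" and t: "(\<Sum>i<d. (t i)\<^sup>2) = 1"
  shows "frame_value d t u \<le> DIM('a)"
proof -
  have "frame_value d t u
      \<le> (\<Sum>i<d. \<Sum>j<d. ((t i)\<^sup>2 * (norm (u j))\<^sup>2 + (t j)\<^sup>2 * (norm (u i))\<^sup>2) / 2)"
    unfolding frame_value_def
  proof (intro sum_mono)
    fix i j
    have "t i * t j * \<bar>u i \<bullet> u j\<bar> \<le> \<bar>t i\<bar> * \<bar>t j\<bar> * (norm (u i) * norm (u j))"
      using mult_mono[OF abs_ge_self[of "t i * t j"] Cauchy_Schwarz_ineq2[of "u i" "u j"]]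
      by (simp add: abs_mult)
    also have "\<dots> \<le> ((t i)\<^sup>2 * (norm (u j))\<^sup>2 + (t j)\<^sup>2 * (norm (u i))\<^sup>2) / 2"
      using sum_squares_bound[of "\<bar>t i\<bar> * norm (u j)" "\<bar>t j\<bar> * norm (u i)"]
      by (simp add: power_mult_distrib algebra_simps)
    finally show "t i * t j * \<bar>u i \<bullet> u j\<bar>
      \<le> ((t i)\<^sup>2 * (norm (u j))\<^sup>2 + (t j)\<^sup>2 * (norm (u i))\<^sup>2) / 2" .
  qed
  also have "\<dots> = DIM('a)"
    by (simp add: sum_divide_distrib[symmetric] sum.distrib sum_distrib_left[symmetric]
        sum_distrib_right[symmetric] t parseval_frame_norm_sum[OF u])
  finally show ?thesis .
qed

lemma exists_parseval_frame:
  shows "\<exists>d t (u :: nat \<Rightarrow> 'a::euclidean_space). parseval_frame d u \<and> (\<Sum>i<d. (t i)\<^sup>2) = (1::real)"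
proof -
  obtain e :: "nat \<Rightarrow> 'a" where e: "bij_betw e {..<DIM('a)} Basis"
    using ex_bij_betw_nat_finite[OF finite_Basis] by (metis atLeast0LessThan)
  have "(\<Sum>i<DIM('a). (e i \<bullet> x) *\<^sub>R e i) = x" for x :: 'a
    using sum.reindex_bij_betw[OF e, of "\<lambda>b. (b \<bullet> x) *\<^sub>R b"]
    euclidean_representation[of x]
    by (simp add: inner_commute[of x])
  moreover have "(\<Sum>i<DIM('a). (if i = 0 then 1 else 0 :: real)\<^sup>2) = 1"
    using DIM_positive[where 'a='a] by (subst sum.remove[of _ 0]) auto
  ultimately show ?thesis
    unfolding parseval_frame_def
    by (intro exI[of _ "DIM('a)"] exI[of _ "\<lambda>i. if i = 0 then 1 else 0"] exI[of _ e]) simp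
qed

lemma bdd_above_frame_values:
  "bdd_above {frame_value d t u | d t u.
     parseval_frame d (u :: nat \<Rightarrow> 'a::euclidean_space) \<and> (\<Sum>i<d. (t i)\<^sup>2) = 1}"
  by (rule bdd_aboveI[of _ "real DIM('a)"]) (auto intro: frame_value_le)

lemma frame_value_le_max:
  fixes u :: "nat \<Rightarrow> 'a::euclidean_space"
  assumes "parseval_frame d u" "(\<Sum>i<d. (t i)\<^sup>2) = 1"
  shows "frame_value d t u \<le> max_frame_value TYPE('a)"
  unfolding max_frame_value_def
  by (rule cSup_upper[OF _ bdd_above_frame_values]) (use assms in blast)

lemma max_frame_value_approx:
  assumes "\<epsilon> > 0"
  shows "\<exists>d t (u :: nat \<Rightarrow> 'a::euclidean_space). parseval_frame d u \<and> (\<Sum>i<d. (t i)\<^sup>2) = 1 \<and>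
           max_frame_value TYPE('a) - \<epsilon> < frame_value d t u"
proof -
  let ?S = "{frame_value d t u | d t u.
     parseval_frame d (u :: nat \<Rightarrow> 'a) \<and> (\<Sum>i<d. (t i)\<^sup>2) = 1}"
  have "?S \<noteq> {}" using exists_parseval_frame[where 'a='a] by blast
  moreover have "Sup ?S - \<epsilon> < Sup ?S" using assms by simp
  ultimately obtain v where "v \<in> ?S" "Sup ?S - \<epsilon> < v"
    using less_cSup_iff[OF _ bdd_above_frame_values] by blast
  then show ?thesis unfolding max_frame_value_def by blast
qed

text \<open>
  The constant \<open>\<kappa>\<close> makes the matrix \<open>\<bar>u i \<bullet> u j\<bar> + \<kappa>\<close> entrywise positive, so that an optimal \<open>t \<ge> 0\<close> has no zero
  entry. For the unregularised value an optimal \<open>t\<close> may vanish where \<open>u\<close> does not.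
\<close>

definition regularized_value ::
    "real \<Rightarrow> nat \<Rightarrow> (nat \<Rightarrow> real) \<Rightarrow> (nat \<Rightarrow> 'a::euclidean_space) \<Rightarrow> real" where
  "regularized_value \<kappa> d t u = (\<Sum>i<d. \<Sum>j<d. t i * t j * (\<bar>u i \<bullet> u j\<bar> + \<kappa>))"

lemma regularized_value_eq:
  "regularized_value \<kappa> d t u = frame_value d t u + \<kappa> * (\<Sum>i<d. t i)\<^sup>2"
proof -
  have "\<kappa> * (\<Sum>i<d. t i)\<^sup>2 = (\<Sum>i<d. \<Sum>j<d. \<kappa> * (t i * t j))"
    unfolding power2_eq_square sum_product by (simp add: sum_distrib_left)
  then show ?thesis
    by (simp add: regularized_value_def frame_value_def sum.distrib distrib_left mult_ac)
qed

lemma regularized_value_abs_le: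
  assumes "\<kappa> \<ge> 0"
  shows "regularized_value \<kappa> d t u \<le> regularized_value \<kappa> d (\<lambda>i. \<bar>t i\<bar>) u"
  unfolding regularized_value_def using assms
  by (intro sum_mono mult_right_mono) (use abs_ge_self in \<open>auto simp flip: abs_mult\<close>)

lemma regularized_value_cong:
  "(\<And>i. i < d \<Longrightarrow> t i = t' i) \<Longrightarrow> (\<And>i. i < d \<Longrightarrow> u i = u' i) \<Longrightarrow>
     regularized_value \<kappa> d t u = regularized_value \<kappa> d t' u'"
  unfolding regularized_value_def by (intro sum.cong refl) auto

text \<open>
  The pairs \<open>(t, u)\<close> are sequences of points of \<open>\<real> \<times> 'a\<close> in a product of balls, which is compact by Tychonoff's
  theorem. Passing to \<open>\<bar>t\<bar>\<close> does not decrease the value, so the maximiser can be taken nonnegative.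
\<close>

lemma regularized_maximizer:
  fixes u0 :: "nat \<Rightarrow> 'a::euclidean_space" and t0 :: "nat \<Rightarrow> real"
  assumes u0: "parseval_frame d u0" and t0: "(\<Sum>i<d. (t0 i)\<^sup>2) = 1" and \<kappa>: "\<kappa> \<ge> 0"
  obtains t and u :: "nat \<Rightarrow> 'a" where
    "parseval_frame d u" "(\<Sum>i<d. (t i)\<^sup>2) = 1" "\<And>i. 0 \<le> t i"
    "\<And>t' u'. parseval_frame d (u' :: nat \<Rightarrow> 'a) \<Longrightarrow> (\<Sum>i<d. (t' i)\<^sup>2) = 1 \<Longrightarrow>
        regularized_value \<kappa> d t' u' \<le> regularized_value \<kappa> d t u"
proof -
  let ?B = "{0..1::real} \<times> cball (0::'a) (DIM('a))"
  let ?T = "\<lambda>p i. fst (p i :: real \<times> 'a)" and ?U = "\<lambda>p i. snd (p i :: real \<times> 'a)"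
  define K :: "(nat \<Rightarrow> real \<times> 'a) set" where "K = (\<Pi>\<^sub>E i\<in>UNIV. ?B)"
  define S where "S = K \<inter> {p. parseval_frame d (?U p)} \<inter> {p. (\<Sum>i<d. (?T p i)\<^sup>2) = 1}"
  have "compactin (product_topology (\<lambda>i. euclidean) UNIV) K"
    unfolding K_def compactin_PiE by (auto intro!: compact_Times)
  then have "compact K" by (simp add: euclidean_product_topology)
  have cT: "continuous_on UNIV (\<lambda>p. ?T p i)" and cU: "continuous_on UNIV (\<lambda>p. ?U p i)" for i
    by (intro continuous_intros continuous_on_product_coordinates)+
  have "closed {p. (\<Sum>i<d. (?T p i)\<^sup>2) = 1}"
    by (intro closed_Collect_eq continuous_intros cT)
  moreover have "closed {p. parseval_frame d (?U p)}"
    unfolding parseval_frame_def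
    by (intro closed_Collect_all closed_Collect_eq continuous_intros cU)
  ultimately have "compact S"
    unfolding S_def using \<open>compact K\<close> by (intro compact_Int_closed)
  have cF: "continuous_on S (\<lambda>p. regularized_value \<kappa> d (?T p) (?U p))"
    unfolding regularized_value_def
    by (intro continuous_intros continuous_on_subset[OF cT] continuous_on_subset[OF cU]) auto
  \<comment> \<open>every admissible pair has a representative in \<open>S\<close> at least as good\<close>
  have rep: "\<exists>p\<in>S. regularized_value \<kappa> d t' u' \<le> regularized_value \<kappa> d (?T p) (?U p)"
    if u': "parseval_frame d (u' :: nat \<Rightarrow> 'a)" and t': "(\<Sum>i<d. (t' i)\<^sup>2) = 1" for t' u'
  proof
    define p where "p i = (if i < d then (\<bar>t' i\<bar>, u' i) else (0, 0))" for i
    have "\<bar>t' i\<bar> \<le> 1" if "i < d" for i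
    proof -
      have "(t' i)\<^sup>2 \<le> (\<Sum>i<d. (t' i)\<^sup>2)" using that by (intro member_le_sum) auto
      then show ?thesis using t' by (simp add: abs_le_square_iff[of _ 1, simplified])
    qed
    then have "p \<in> K"
      using parseval_frame_norm_le[OF u'] by (auto simp: K_def p_def)
    moreover have "parseval_frame d (?U p)"
      using u' by (simp add: parseval_frame_def p_def)
    moreover have "(\<Sum>i<d. (?T p i)\<^sup>2) = 1"
      using t' by (simp add: p_def)
    ultimately show "p \<in> S" by (simp add: S_def)
    have "regularized_value \<kappa> d (\<lambda>i. \<bar>t' i\<bar>) u' = regularized_value \<kappa> d (?T p) (?U p)"
      by (rule regularized_value_cong) (auto simp: p_def)
    then show "regularized_value \<kappa> d t' u' \<le> regularized_value \<kappa> d (?T p) (?U p)"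
      using regularized_value_abs_le[OF \<kappa>, of d t' u'] by simp
  qed
  have "S \<noteq> {}" using rep[OF u0 t0] by blast
  then obtain p where p: "p \<in> S" and
    pmax: "\<And>q. q \<in> S \<Longrightarrow> regularized_value \<kappa> d (?T q) (?U q) \<le> regularized_value \<kappa> d (?T p) (?U p)"
    using continuous_attains_sup[OF \<open>compact S\<close> _ cF] by blast
  show ?thesis
  proof (rule that[of "?U p" "?T p"])
    show "0 \<le> ?T p i" for i
    proof -
      have "p i \<in> ?B" using p by (auto simp: S_def K_def PiE_def Pi_def simp del: mem_Times_iff)
      then show ?thesis by auto
    qed
    fix t' :: "nat \<Rightarrow> real" and u'
    assume "parseval_frame d (u' :: nat \<Rightarrow> 'a)" "(\<Sum>i<d. (t' i)\<^sup>2) = 1"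
    then show "regularized_value \<kappa> d t' u' \<le> regularized_value \<kappa> d (?T p) (?U p)"
      using rep pmax by (meson order_trans)
  qed (use p in \<open>auto simp: S_def\<close>)
qed

section \<open>First-order conditions at a maximiser\<close>

lemma linear_coeff_zero_if_quadratic_nonpos:
  fixes b c :: real
  assumes "\<And>s. 2 * s * b + s\<^sup>2 * c \<le> 0"
  shows "b = 0"
proof (rule ccontr)
  assume b: "b \<noteq> 0"
  define s where "s = b / (\<bar>c\<bar> + 1)"
  have "s * (\<bar>c\<bar> + 1) = b" unfolding s_def by simp
  then have "2 * s * b + s\<^sup>2 * c = s\<^sup>2 * (2 * \<bar>c\<bar> + 2 + c)"
    by (auto simp: power2_eq_square algebra_simps)
  moreover have "s\<^sup>2 > 0" using b by (simp add: s_def)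
  moreover have "2 * \<bar>c\<bar> + 2 + c > 0" by simp
  ultimately show False using assms[of s] by (smt (verit) mult_pos_pos)
qed

definition bilinear_sum :: "nat \<Rightarrow> (nat \<Rightarrow> nat \<Rightarrow> real) \<Rightarrow> (nat \<Rightarrow> real) \<Rightarrow> (nat \<Rightarrow> real) \<Rightarrow> real" where
  "bilinear_sum d A v w = (\<Sum>i<d. \<Sum>j<d. A i j * v i * w j)"

lemma bilinear_sum_add_scaled:
  assumes sym: "\<And>i j. i < d \<Longrightarrow> j < d \<Longrightarrow> A i j = A j i"
  shows "bilinear_sum d A (\<lambda>i. v i + s * w i) (\<lambda>i. v i + s * w i)
    = bilinear_sum d A v v + 2 * s * bilinear_sum d A w v + s\<^sup>2 * bilinear_sum d A w w"
proof -
  have "(\<Sum>i<d. \<Sum>j<d. A i j * v i * w j) = (\<Sum>j<d. \<Sum>i<d. A i j * v i * w j)"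
    by (rule sum.swap)
  also have "\<dots> = (\<Sum>i<d. \<Sum>j<d. A i j * w i * v j)"
    by (intro sum.cong refl) (simp add: sym mult_ac)
  finally have *: "bilinear_sum d A v w = bilinear_sum d A w v"
    by (simp add: bilinear_sum_def)
  have "bilinear_sum d A (\<lambda>i. v i + s * w i) (\<lambda>i. v i + s * w i)
    = bilinear_sum d A v v + s * bilinear_sum d A v w + s * bilinear_sum d A w v
      + s\<^sup>2 * bilinear_sum d A w w"
    by (simp add: bilinear_sum_def sum_distrib_left sum.distrib[symmetric] power2_eq_square
        distrib_left distrib_right mult_ac add_ac)
  with * show ?thesis by simp
qed

text \<open>
  If \<open>v\<close> maximises the Rayleigh quotient of a symmetric matrix on the line \<open>v + s * w\<close>, the difference of the
  two sides is a quadratic polynomial in \<open>s\<close> which is nonpositive and vanishes at \<open>0\<close>; so its linear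
  coefficient vanishes. This one-line variation serves both for \<open>t\<close> and for \<open>u\<close>.
\<close>

lemma rayleigh_quotient_stationary:
  assumes sym: "\<And>i j. i < d \<Longrightarrow> j < d \<Longrightarrow> A i j = A j i"
    and max: "\<And>s. bilinear_sum d A (\<lambda>i. v i + s * w i) (\<lambda>i. v i + s * w i)
        \<le> bilinear_sum d A v v * (\<Sum>i<d. (v i + s * w i)\<^sup>2)"
    and v: "(\<Sum>i<d. (v i)\<^sup>2) = 1"
  shows "bilinear_sum d A w v = bilinear_sum d A v v * (\<Sum>i<d. v i * w i)"
proof -
  have "(\<Sum>i<d. (v i + s * w i)\<^sup>2) = 1 + 2 * s * (\<Sum>i<d. v i * w i) + s\<^sup>2 * (\<Sum>i<d. (w i)\<^sup>2)" for s
  proof -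
    have "(\<Sum>i<d. (v i + s * w i)\<^sup>2)
        = (\<Sum>i<d. (v i)\<^sup>2) + (\<Sum>i<d. 2 * s * (v i * w i)) + (\<Sum>i<d. s\<^sup>2 * (w i)\<^sup>2)"
      by (simp add: sum.distrib[symmetric] power2_sum power_mult_distrib mult_ac add_ac)
    then show ?thesis by (simp add: v sum_distrib_left)
  qed
  then have "2 * s * (bilinear_sum d A w v - bilinear_sum d A v v * (\<Sum>i<d. v i * w i))
      + s\<^sup>2 * (bilinear_sum d A w w - bilinear_sum d A v v * (\<Sum>i<d. (w i)\<^sup>2)) \<le> 0" for s
    using max[of s] by (simp add: bilinear_sum_add_scaled[OF sym] algebra_simps)
  from linear_coeff_zero_if_quadratic_nonpos[OF this] show ?thesis by simp
qed

lemma regularized_value_bilinear: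
  "regularized_value \<kappa> d t u = bilinear_sum d (\<lambda>i j. \<bar>u i \<bullet> u j\<bar> + \<kappa>) t t"
  by (simp add: regularized_value_def bilinear_sum_def mult_ac)

lemma regularized_value_scale:
  "regularized_value \<kappa> d (\<lambda>i. c * t i) u = c\<^sup>2 * regularized_value \<kappa> d t u"
  by (simp add: regularized_value_def sum_distrib_left power2_eq_square mult_ac)

text \<open>
  For a fixed frame, an optimal \<open>t\<close> maximises a quadratic form on the unit sphere. Testing stationarity in each
  coordinate direction gives the eigenvector equation.
\<close>

lemma optimal_weights_eigenvector:
  fixes u :: "nat \<Rightarrow> 'a::euclidean_space"
  assumes t: "(\<Sum>i<d. (t i)\<^sup>2) = 1"
    and max: "\<And>t'. (\<Sum>i<d. (t' i)\<^sup>2) = 1 \<Longrightarrow>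
        regularized_value \<kappa> d t' u \<le> regularized_value \<kappa> d t u"
    and i: "i < d"
  shows "(\<Sum>j<d. (\<bar>u i \<bullet> u j\<bar> + \<kappa>) * t j) = regularized_value \<kappa> d t u * t i"
proof -
  let ?A = "\<lambda>i j. \<bar>u i \<bullet> u j\<bar> + \<kappa>"
  define w where "w = (\<lambda>k. if k = i then 1 else 0 :: real)"
  \<comment> \<open>homogeneity removes the constraint on the norm of the competitor\<close>
  have homog: "regularized_value \<kappa> d t' u \<le> regularized_value \<kappa> d t u * (\<Sum>i<d. (t' i)\<^sup>2)" for t'
  proof (cases "(\<Sum>i<d. (t' i)\<^sup>2) = 0")
    case True
    then have "t' j = 0" if "j < d" for j
      using that by (subst (asm) sum_nonneg_eq_0_iff) auto
    then have "regularized_value \<kappa> d t' u = 0" by (simp add: regularized_value_def)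
    with True show ?thesis by simp
  next
    case False
    define r where "r = (\<Sum>i<d. (t' i)\<^sup>2)"
    have "r > 0" using False by (simp add: r_def sum_nonneg order.not_eq_order_implies_strict)
    then have r: "(1 / sqrt r)\<^sup>2 = 1 / r" by (simp add: power_divide)
    have "(\<Sum>i<d. (1 / sqrt r * t' i)\<^sup>2) = (1 / sqrt r)\<^sup>2 * r"
      unfolding r_def by (simp only: sum_distrib_left power_mult_distrib)
    also have "\<dots> = 1" using \<open>r > 0\<close> r by simp
    finally have "regularized_value \<kappa> d (\<lambda>i. 1 / sqrt r * t' i) u \<le> regularized_value \<kappa> d t u"
      by (rule max)
    then have "regularized_value \<kappa> d t' u / r \<le> regularized_value \<kappa> d t u"
      unfolding regularized_value_scale r by simp
    then show ?thesis using \<open>r > 0\<close> by (simp add: r_def[symmetric] divide_le_eq)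
  qed
  have "bilinear_sum d ?A w t = bilinear_sum d ?A t t * (\<Sum>i<d. t i * w i)"
  proof (rule rayleigh_quotient_stationary[OF _ _ t])
    show "bilinear_sum d ?A (\<lambda>i. t i + s * w i) (\<lambda>i. t i + s * w i)
        \<le> bilinear_sum d ?A t t * (\<Sum>i<d. (t i + s * w i)\<^sup>2)" for s
      using homog[of "\<lambda>i. t i + s * w i"] by (simp add: regularized_value_bilinear)
  qed (simp add: inner_commute)
  moreover have "bilinear_sum d ?A w t = (\<Sum>j<d. ?A i j * t j)"
  proof -
    have "bilinear_sum d ?A w t = (\<Sum>k<d. if k = i then \<Sum>j<d. ?A i j * t j else 0)"
      unfolding bilinear_sum_def w_def by (intro sum.cong refl) auto
    then show ?thesis using i by simp
  qed
  moreover have "(\<Sum>k<d. t k * w k) = t i"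
  proof -
    have "(\<Sum>k<d. t k * w k) = (\<Sum>k<d. if k = i then t k else 0)"
      unfolding w_def by (intro sum.cong refl) auto
    then show ?thesis using i by simp
  qed
  ultimately show ?thesis by (simp add: regularized_value_bilinear)
qed

text \<open>
  Replacing the unit vector \<open>v i = u i \<bullet> x\<close> in the range of the projection \<open>P\<close> by another unit vector \<open>v'\<close>, which is
  orthogonal to the rest of the range, gives the projection \<open>P - v v\<^sup>T + v' v'\<^sup>T\<close>. The orthogonality is the
  hypothesis on \<open>\<Sum>i. v' i *\<^sub>R u i\<close>. In terms of frames, only the components along \<open>x\<close> change.
\<close>

lemma rotate_parseval_frame:
  fixes u :: "nat \<Rightarrow> 'a::euclidean_space"
  assumes u: "parseval_frame d u" and x: "norm x = 1"
    and v': "(\<Sum>i<d. (v' i)\<^sup>2) = 1" and parallel: "(\<Sum>i<d. v' i *\<^sub>R u i) = r *\<^sub>R x"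
  shows "parseval_frame d (\<lambda>i. u i + (v' i - u i \<bullet> x) *\<^sub>R x)"
  unfolding parseval_frame_def
proof
  fix z
  define c where "c i = v' i - u i \<bullet> x" for i
  have xx: "x \<bullet> x = 1" using x by (simp add: norm_eq_1)
  have cu: "(\<Sum>i<d. c i *\<^sub>R u i) = (r - 1) *\<^sub>R x"
    using parallel parseval_frameD[OF u, of x]
    by (simp add: c_def scaleR_diff_left sum_subtractf)
  have cz: "(\<Sum>i<d. c i * (u i \<bullet> z)) = (r - 1) * (x \<bullet> z)"
    using arg_cong[OF cu, of "\<lambda>y. y \<bullet> z"] by (simp add: inner_sum_left)
  have "(\<Sum>i<d. v' i * (u i \<bullet> x)) = r"
    using arg_cong[OF parallel, of "\<lambda>y. y \<bullet> x"] by (simp add: inner_sum_left xx)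
  moreover have "(\<Sum>i<d. (u i \<bullet> x)\<^sup>2) = 1"
    using parseval_frame_inner[OF u, of x x] by (simp add: power2_eq_square xx)
  moreover have "(\<Sum>i<d. (c i)\<^sup>2)
      = (\<Sum>i<d. (v' i)\<^sup>2) - 2 * (\<Sum>i<d. v' i * (u i \<bullet> x)) + (\<Sum>i<d. (u i \<bullet> x)\<^sup>2)"
    by (simp add: c_def power2_diff sum.distrib sum_subtractf sum_distrib_left mult_ac)
  ultimately have cc: "(\<Sum>i<d. (c i)\<^sup>2) = 2 - 2 * r"
    using v' by simp
  have "(\<Sum>i<d. ((u i + c i *\<^sub>R x) \<bullet> z) *\<^sub>R (u i + c i *\<^sub>R x))
      = (\<Sum>i<d. (u i \<bullet> z) *\<^sub>R u i) + (\<Sum>i<d. c i * (u i \<bullet> z)) *\<^sub>R x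
        + (x \<bullet> z) *\<^sub>R (\<Sum>i<d. c i *\<^sub>R u i) + ((x \<bullet> z) * (\<Sum>i<d. (c i)\<^sup>2)) *\<^sub>R x"
    by (simp add: scaleR_sum_left scaleR_sum_right sum_distrib_left sum.distrib[symmetric]
        inner_add_left scaleR_add_right scaleR_add_left distrib_left power2_eq_square mult_ac add_ac)
  also have "\<dots> = z + ((r - 1) * (x \<bullet> z) + (x \<bullet> z) * (r - 1) + (x \<bullet> z) * (2 - 2 * r)) *\<^sub>R x"
    by (simp only: parseval_frameD[OF u] cz cu cc scaleR_add_left scaleR_scaleR add.assoc)
  also have "(r - 1) * (x \<bullet> z) + (x \<bullet> z) * (r - 1) + (x \<bullet> z) * (2 - 2 * r) = 0"
    by (simp add: algebra_simps)
  finally have "(\<Sum>i<d. ((u i + c i *\<^sub>R x) \<bullet> z) *\<^sub>R (u i + c i *\<^sub>R x)) = z" by simp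
  then show "(\<Sum>i<d. ((u i + (v' i - u i \<bullet> x) *\<^sub>R x) \<bullet> z) *\<^sub>R (u i + (v' i - u i \<bullet> x) *\<^sub>R x)) = z"
    by (simp add: c_def)
qed

lemma rotate_frame_gram:
  fixes x :: "'a::real_inner"
  assumes "norm x = 1"
  shows "(a + (p - a \<bullet> x) *\<^sub>R x) \<bullet> (b + (q - b \<bullet> x) *\<^sub>R x) = a \<bullet> b - (a \<bullet> x) * (b \<bullet> x) + p * q"
  using assms by (simp add: norm_eq_1 inner_add_left inner_add_right inner_commute algebra_simps)

definition signed_gram :: "(nat \<Rightarrow> real) \<Rightarrow> (nat \<Rightarrow> 'a::euclidean_space) \<Rightarrow> nat \<Rightarrow> nat \<Rightarrow> real" where
  "signed_gram t u i j = t i * t j * sgn (u i \<bullet> u j)"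

text \<open>
  Let \<open>A = signed_gram t u\<close>. The linear functional \<open>\<Sum>i j. A i j * (u' i \<bullet> u' j)\<close> of the Gram matrix is at most the
  value of \<open>u'\<close>, with equality for \<open>u' = u\<close>; so the optimal frame also maximises this functional.
  Rotating the range vector \<open>v i = u i \<bullet> x\<close> towards a vector \<open>w\<close> of the kernel of the projection, the
  Rayleigh quotient of \<open>A\<close> must be stationary at \<open>v\<close>.
\<close>

lemma optimal_frame_stationary_direction:
  fixes u :: "nat \<Rightarrow> 'a::euclidean_space"
  assumes u: "parseval_frame d u" and t: "\<And>i. 0 \<le> t i"
    and max: "\<And>u'. parseval_frame d (u' :: nat \<Rightarrow> 'a) \<Longrightarrow> frame_value d t u' \<le> frame_value d t u"
    and x: "norm x = 1" and w: "(\<Sum>i<d. w i *\<^sub>R u i) = 0"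
  shows "bilinear_sum d (signed_gram t u) w (\<lambda>i. u i \<bullet> x) = 0"
proof -
  let ?A = "signed_gram t u" and ?v = "\<lambda>i. u i \<bullet> x"
  have vv: "(\<Sum>i<d. (?v i)\<^sup>2) = 1"
    using parseval_frame_inner[OF u, of x x] x by (simp add: power2_eq_square norm_eq_1)
  have vw: "(\<Sum>i<d. ?v i * w i) = 0"
    using arg_cong[OF w, of "\<lambda>y. y \<bullet> x"] by (simp add: inner_sum_left mult.commute)
  have "bilinear_sum d ?A w ?v = bilinear_sum d ?A ?v ?v * (\<Sum>i<d. ?v i * w i)"
  proof (rule rayleigh_quotient_stationary[OF _ _ vv])
    fix s
    define r where "r = (\<Sum>i<d. (?v i + s * w i)\<^sup>2)"
    have "r = (\<Sum>i<d. (?v i)\<^sup>2) + 2 * s * (\<Sum>i<d. ?v i * w i) + (\<Sum>i<d. (s * w i)\<^sup>2)"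
      by (simp add: r_def power2_sum sum.distrib sum_distrib_left mult_ac)
    then have "r = 1 + (\<Sum>i<d. (s * w i)\<^sup>2)" by (simp add: vv vw)
    then have "r \<ge> 1" by (simp add: sum_nonneg)
    define v' where "v' i = (?v i + s * w i) / sqrt r" for i
    define u' where "u' i = u i + (v' i - ?v i) *\<^sub>R x" for i
    have "(\<Sum>i<d. (v' i)\<^sup>2) = r / r"
      using \<open>r \<ge> 1\<close> by (simp add: v'_def power_divide sum_divide_distrib[symmetric] r_def)
    moreover have "(\<Sum>i<d. s *\<^sub>R (w i *\<^sub>R u i)) = 0"
      using w by (simp only: scaleR_sum_right[symmetric]) simp
    moreover have "(\<Sum>i<d. v' i *\<^sub>R u i) = (1 / sqrt r) *\<^sub>R (\<Sum>i<d. ?v i *\<^sub>R u i + s *\<^sub>R (w i *\<^sub>R u i))"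
      by (simp add: v'_def scaleR_sum_right scaleR_add_left add_divide_distrib scaleR_add_right)
    ultimately have "(\<Sum>i<d. (v' i)\<^sup>2) = r / r" "(\<Sum>i<d. v' i *\<^sub>R u i) = (1 / sqrt r) *\<^sub>R x"
      using parseval_frameD[OF u, of x] by (simp_all only: sum.distrib add_0_right)
    then have u': "parseval_frame d u'"
      unfolding u'_def using \<open>r \<ge> 1\<close> by (intro rotate_parseval_frame[OF u x]) auto
    have gram: "u' i \<bullet> u' j = u i \<bullet> u j - ?v i * ?v j + v' i * v' j" for i j
      unfolding u'_def by (rule rotate_frame_gram[OF x])
    have "(\<Sum>i<d. \<Sum>j<d. ?A i j * (u' i \<bullet> u' j)) \<le> frame_value d t u'"
      unfolding frame_value_def signed_gram_def
    proof (intro sum_mono)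
      fix i j
      have "sgn (u i \<bullet> u j) * (u' i \<bullet> u' j) \<le> \<bar>u' i \<bullet> u' j\<bar>"
        by (auto simp: sgn_if)
      then show "t i * t j * sgn (u i \<bullet> u j) * (u' i \<bullet> u' j) \<le> t i * t j * \<bar>u' i \<bullet> u' j\<bar>"
        using t by (simp add: mult.assoc mult_left_mono)
    qed
    also have "\<dots> \<le> frame_value d t u" by (rule max[OF u'])
    also have "\<dots> = (\<Sum>i<d. \<Sum>j<d. ?A i j * (u i \<bullet> u j))"
      by (simp add: frame_value_def signed_gram_def abs_sgn mult_ac)
    finally have "bilinear_sum d ?A v' v' \<le> bilinear_sum d ?A ?v ?v"
      by (simp add: gram bilinear_sum_def sum.distrib sum_subtractf distrib_left
          right_diff_distrib mult.assoc)
    moreover have "bilinear_sum d ?A v' v'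
        = bilinear_sum d ?A (\<lambda>i. ?v i + s * w i) (\<lambda>i. ?v i + s * w i) / r"
      using \<open>r \<ge> 1\<close> by (simp add: bilinear_sum_def v'_def sum_divide_distrib)
    ultimately show "bilinear_sum d ?A (\<lambda>i. ?v i + s * w i) (\<lambda>i. ?v i + s * w i)
        \<le> bilinear_sum d ?A ?v ?v * (\<Sum>i<d. (?v i + s * w i)\<^sup>2)"
      using \<open>r \<ge> 1\<close> by (simp add: r_def[symmetric] divide_le_eq)
  qed (simp add: signed_gram_def inner_commute)
  then show ?thesis by (simp add: vw)
qed

text \<open>
  The matrix \<open>A\<close> maps the range of the projection into itself, because \<open>A v\<close> is orthogonal to the whole
  kernel for \<open>v\<close> in the range: the component \<open>w\<close> of \<open>A v\<close> in the kernel is orthogonal to \<open>A v\<close> and to the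
  other component, so it is \<open>0\<close>.
\<close>

lemma optimal_frame_range_invariant:
  fixes u :: "nat \<Rightarrow> 'a::euclidean_space"
  assumes u: "parseval_frame d u" and t: "\<And>i. 0 \<le> t i"
    and max: "\<And>u'. parseval_frame d (u' :: nat \<Rightarrow> 'a) \<Longrightarrow> frame_value d t u' \<le> frame_value d t u"
    and i: "i < d"
  defines "h \<equiv> \<lambda>x i. \<Sum>j<d. signed_gram t u i j * (u j \<bullet> x)"
  shows "h x i = u i \<bullet> (\<Sum>k<d. h x k *\<^sub>R u k)"
proof -
  define q where "q = (\<Sum>k<d. h x k *\<^sub>R u k)"
  define w where "w k = h x k - u k \<bullet> q" for k
  have w0: "(\<Sum>k<d. w k *\<^sub>R u k) = 0"
    using parseval_frameD[OF u, of q]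
    by (simp add: w_def scaleR_diff_left sum_subtractf q_def[symmetric])
  have "bilinear_sum d (signed_gram t u) w (\<lambda>i. u i \<bullet> x) = 0"
  proof (cases "x = 0")
    case False
    have "(\<lambda>i. u i \<bullet> x) = (\<lambda>i. norm x * (u i \<bullet> sgn x))"
      using False by (simp add: sgn_div_norm fun_eq_iff)
    then have "bilinear_sum d (signed_gram t u) w (\<lambda>i. u i \<bullet> x)
        = norm x * bilinear_sum d (signed_gram t u) w (\<lambda>i. u i \<bullet> sgn x)"
      by (simp add: bilinear_sum_def sum_distrib_left mult_ac)
    then show ?thesis
      using optimal_frame_stationary_direction[OF u t max _ w0, of "sgn x"] False
      by (simp add: norm_sgn)
  qed (simp add: bilinear_sum_def)
  then have "(\<Sum>k<d. w k * h x k) = 0"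
    by (simp add: bilinear_sum_def h_def sum_distrib_left mult_ac)
  moreover have "(\<Sum>k<d. w k * (u k \<bullet> q)) = 0"
    using arg_cong[OF w0, of "\<lambda>y. y \<bullet> q"] by (simp add: inner_sum_left)
  moreover have "(\<Sum>k<d. (w k)\<^sup>2) = (\<Sum>k<d. w k * h x k) - (\<Sum>k<d. w k * (u k \<bullet> q))"
    unfolding sum_subtractf[symmetric]
    by (intro sum.cong refl) (simp add: power2_eq_square w_def right_diff_distrib)
  ultimately have "(\<Sum>k<d. (w k)\<^sup>2) = 0" by simp
  then have "w i = 0" using i by (subst (asm) sum_nonneg_eq_0_iff) auto
  then show ?thesis by (simp add: w_def q_def)
qed

section \<open>Near-extremal configurations\<close>

text \<open>
  The data that an almost optimal pair \<open>(t, u)\<close> leaves behind, with \<open>w = t\<^sup>2\<close> and \<open>y = v = u / t\<close>: the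
  \<open>w\<close>-orthogonal projection has the matrix \<open>w j * (y i \<bullet> v j)\<close>, its row sums are at most \<open>\<phi> + \<epsilon>\<close>, and the
  signs \<open>S\<close> certify that every left inverse \<open>z\<close> of \<open>x \<mapsto> (y j \<bullet> x)\<close> has a row sum of at least \<open>\<phi> - \<epsilon>\<close>.
  Vectors \<open>v\<close> separate from \<open>y\<close> make the notion invariant under linear changes of coordinates, under
  which \<open>y\<close> transforms like functionals and \<open>v\<close> like vectors. This is needed because some \<open>w i\<close> may be
  tiny, and then the coordinates with \<open>y = v\<close> give no bound for \<open>y\<close>.
\<close>

definition near_extremal ::
    "real \<Rightarrow> nat \<Rightarrow> (nat \<Rightarrow> real) \<Rightarrow> (nat \<Rightarrow> 'a::euclidean_space) \<Rightarrow> (nat \<Rightarrow> 'a) \<Rightarrow>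
      (nat \<Rightarrow> nat \<Rightarrow> real) \<Rightarrow> bool" where
  "near_extremal \<epsilon> d w y v S \<longleftrightarrow>
     (\<forall>i<d. 0 < w i) \<and> (\<Sum>i<d. w i) = 1 \<and>
     (\<forall>x. (\<Sum>i<d. (w i * (y i \<bullet> x)) *\<^sub>R v i) = x) \<and>
     (\<forall>i<d. \<forall>j<d. y i \<bullet> v j = y j \<bullet> v i) \<and>
     (\<forall>i<d. (\<Sum>j<d. w j * \<bar>y i \<bullet> v j\<bar>) \<le> max_frame_value TYPE('a) + \<epsilon>) \<and>
     (\<forall>i j. \<bar>S i j\<bar> \<le> 1) \<and>
     (\<forall>z. (\<forall>x. (\<Sum>j<d. (y j \<bullet> x) *\<^sub>R z j) = x) \<longrightarrow>
        max_frame_value TYPE('a) - \<epsilon> \<le> (\<Sum>i<d. \<Sum>j<d. w i * S i j * (y i \<bullet> z j)))"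

text \<open>
  Trace duality. The sum is the trace of the signed matrix composed with the projection given by \<open>z\<close>. The
  signed matrix maps the space into itself by \<open>optimal_frame_range_invariant\<close>, say as \<open>L\<close>, and the projection
  is the identity there, so the sum is the trace of \<open>L\<close>, for every \<open>z\<close>.
\<close>

lemma optimal_frame_trace:
  fixes u :: "nat \<Rightarrow> 'a::euclidean_space"
  assumes u: "parseval_frame d u" and t: "\<And>i. i < d \<Longrightarrow> 0 < t i" and t0: "\<And>i. 0 \<le> t i"
    and max: "\<And>u'. parseval_frame d (u' :: nat \<Rightarrow> 'a) \<Longrightarrow> frame_value d t u' \<le> frame_value d t u"
    and z: "\<And>x. (\<Sum>j<d. ((u j /\<^sub>R t j) \<bullet> x) *\<^sub>R z j) = x"
  shows "(\<Sum>i<d. \<Sum>j<d. (t i)\<^sup>2 * sgn (u i \<bullet> u j) * ((u i /\<^sub>R t i) \<bullet> z j)) = frame_value d t u"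
proof -
  let ?A = "signed_gram t u"
  define h where "h x i = (\<Sum>j<d. ?A i j * (u j \<bullet> x))" for x :: 'a and i
  define L where "L x = (\<Sum>k<d. h x k *\<^sub>R u k)" for x
  have inv: "h x i = u i \<bullet> L x" if "i < d" for x i
    using optimal_frame_range_invariant[OF u t0 max that] by (simp add: h_def L_def)
  have linL: "linear L"
    unfolding L_def h_def
    by (intro linearI) (simp_all add: inner_add_right distrib_left sum.distrib scaleR_add_left
        scaleR_sum_right sum_distrib_left scaleR_sum_left mult_ac)
  have "(\<Sum>i<d. \<Sum>j<d. (t i)\<^sup>2 * sgn (u i \<bullet> u j) * ((u i /\<^sub>R t i) \<bullet> z j))
      = (\<Sum>j<d. \<Sum>i<d. (t i)\<^sup>2 * sgn (u i \<bullet> u j) * ((u i /\<^sub>R t i) \<bullet> z j))"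
    by (rule sum.swap)
  also have "\<dots> = (\<Sum>j<d. (u j /\<^sub>R t j) \<bullet> L (z j))"
  proof (intro sum.cong refl)
    fix j assume "j \<in> {..<d}"
    then have j: "j < d" by simp
    have "(\<Sum>i<d. (t i)\<^sup>2 * sgn (u i \<bullet> u j) * ((u i /\<^sub>R t i) \<bullet> z j))
        = (\<Sum>i<d. ?A j i * (u i \<bullet> z j) / t j)"
    proof (intro sum.cong refl)
      fix i assume "i \<in> {..<d}"
      then have "t i \<noteq> 0" "t j \<noteq> 0" using t[of i] t[OF j] by auto
      then show "(t i)\<^sup>2 * sgn (u i \<bullet> u j) * ((u i /\<^sub>R t i) \<bullet> z j) = ?A j i * (u i \<bullet> z j) / t j"
        by (simp add: signed_gram_def power2_eq_square inner_commute[of "u j"] field_simps)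
    qed
    also have "\<dots> = h (z j) j / t j"
      by (simp add: h_def sum_divide_distrib)
    finally show "(\<Sum>i<d. (t i)\<^sup>2 * sgn (u i \<bullet> u j) * ((u i /\<^sub>R t i) \<bullet> z j)) = (u j /\<^sub>R t j) \<bullet> L (z j)"
      by (simp add: inv[OF j] divide_inverse_commute)
  qed
  also have "\<dots> = (\<Sum>j<d. \<Sum>b\<in>Basis. ((u j /\<^sub>R t j) \<bullet> b) * (L (z j) \<bullet> b))"
    by (simp only: euclidean_inner[symmetric])
  also have "\<dots> = (\<Sum>b\<in>Basis. \<Sum>j<d. ((u j /\<^sub>R t j) \<bullet> b) * (L (z j) \<bullet> b))"
    by (rule sum.swap)
  also have "\<dots> = (\<Sum>b\<in>Basis. L (\<Sum>j<d. ((u j /\<^sub>R t j) \<bullet> b) *\<^sub>R z j) \<bullet> b)"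
    by (simp only: linear_sum[OF linL] linear_scale[OF linL] inner_sum_left inner_scaleR_left)
  also have "\<dots> = (\<Sum>b\<in>Basis. L b \<bullet> b)"
    by (simp only: z)
  also have "\<dots> = (\<Sum>b\<in>Basis. \<Sum>i<d. \<Sum>j<d. ?A i j * ((u i \<bullet> b) * (u j \<bullet> b)))"
    by (simp add: L_def h_def inner_sum_left sum_distrib_right sum_distrib_left mult_ac)
  also have "\<dots> = (\<Sum>i<d. \<Sum>b\<in>Basis. \<Sum>j<d. ?A i j * ((u i \<bullet> b) * (u j \<bullet> b)))"
    by (rule sum.swap)
  also have "\<dots> = (\<Sum>i<d. \<Sum>j<d. ?A i j * (u i \<bullet> u j))"
    by (subst sum.swap) (simp only: sum_distrib_left[symmetric] euclidean_inner[symmetric])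
  also have "\<dots> = frame_value d t u"
    by (simp add: frame_value_def signed_gram_def abs_sgn mult_ac)
  finally show ?thesis .
qed

text \<open>
  Let \<open>\<mu>\<close> be the maximal regularised value. Then \<open>\<mu>\<close> lies between \<open>\<phi> - \<epsilon> / 2\<close> and \<open>\<phi> + \<epsilon> / 2\<close> if \<open>\<kappa> * d \<le> \<epsilon> / 2\<close>,
  since \<open>(\<Sum>i. t i)\<^sup>2 \<le> d\<close>. The eigenvector equation bounds the row sums by \<open>\<mu>\<close>. The regularising term does
  not depend on \<open>u\<close>, so \<open>u\<close> is optimal for the frame value with this \<open>t\<close>, and \<open>optimal_frame_trace\<close> applies.
\<close>

lemma exists_near_extremal:
  assumes \<epsilon>: "\<epsilon> > 0"
  shows "\<exists>d w (y :: nat \<Rightarrow> 'a::euclidean_space) v S. near_extremal \<epsilon> d w y v S"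
proof -
  let ?\<phi> = "max_frame_value TYPE('a)"
  obtain d and t0 :: "nat \<Rightarrow> real" and u0 :: "nat \<Rightarrow> 'a" where
    u0: "parseval_frame d u0" and t0: "(\<Sum>i<d. (t0 i)\<^sup>2) = 1"
    and near: "?\<phi> - \<epsilon> / 2 < frame_value d t0 u0"
    using max_frame_value_approx[of "\<epsilon> / 2", where 'a='a] \<epsilon> by auto
  define \<kappa> where "\<kappa> = \<epsilon> / (2 * (real d + 1))"
  have "\<kappa> > 0" using \<epsilon> by (simp add: \<kappa>_def)
  have \<kappa>d: "\<kappa> * real d \<le> \<epsilon> / 2"
    using \<epsilon> by (simp add: \<kappa>_def field_simps)
  obtain t and u :: "nat \<Rightarrow> 'a" where u: "parseval_frame d u" and t: "(\<Sum>i<d. (t i)\<^sup>2) = 1"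
    and tpos: "\<And>i. 0 \<le> t i"
    and max: "\<And>t' u'. parseval_frame d (u' :: nat \<Rightarrow> 'a) \<Longrightarrow> (\<Sum>i<d. (t' i)\<^sup>2) = 1 \<Longrightarrow>
        regularized_value \<kappa> d t' u' \<le> regularized_value \<kappa> d t u"
    using regularized_maximizer[OF u0 t0, of \<kappa>] \<open>\<kappa> > 0\<close> by (metis less_imp_le)
  define \<mu> where "\<mu> = regularized_value \<kappa> d t u"
  have "(\<Sum>i<d. t i)\<^sup>2 \<le> real d"
    using sum_squared_le_sum_of_squares[of t "{..<d}"] t by simp
  then have "\<kappa> * (\<Sum>i<d. t i)\<^sup>2 \<le> \<kappa> * real d"
    using \<open>\<kappa> > 0\<close> by simp
  then have \<mu>_le: "\<mu> \<le> frame_value d t u + \<epsilon> / 2"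
    using \<kappa>d by (simp add: \<mu>_def regularized_value_eq)
  have "frame_value d t0 u0 \<le> regularized_value \<kappa> d t0 u0"
    using \<open>\<kappa> > 0\<close> by (simp add: regularized_value_eq)
  also have "\<dots> \<le> \<mu>" unfolding \<mu>_def by (rule max[OF u0 t0])
  finally have value_ge: "?\<phi> - \<epsilon> \<le> frame_value d t u"
    using \<mu>_le near by simp
  have value_le: "frame_value d t u \<le> ?\<phi>" by (rule frame_value_le_max[OF u t])
  have eig: "(\<Sum>j<d. (\<bar>u i \<bullet> u j\<bar> + \<kappa>) * t j) = \<mu> * t i" if "i < d" for i
    unfolding \<mu>_def by (rule optimal_weights_eigenvector[OF t max[OF u] that])
  have "d > 0" using t by (cases d) auto
  have "(\<Sum>j<d. t j) > 0"
  proof (rule ccontr)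
    assume "\<not> (\<Sum>j<d. t j) > 0"
    moreover have "(\<Sum>j<d. t j) \<ge> 0" by (intro sum_nonneg tpos)
    ultimately have "(\<Sum>j<d. t j) = 0" by simp
    then have "\<forall>j\<in>{..<d}. t j = 0" by (subst (asm) sum_nonneg_eq_0_iff) (auto simp: tpos)
    with t show False by simp
  qed
  \<comment> \<open>Perron: the regularised matrix is entrywise positive, so its nonnegative eigenvector is positive\<close>
  have tgt: "0 < t i" if "i < d" for i
  proof -
    have "0 < \<kappa> * (\<Sum>j<d. t j)" using \<open>\<kappa> > 0\<close> \<open>(\<Sum>j<d. t j) > 0\<close> by simp
    also have "\<dots> \<le> (\<Sum>j<d. (\<bar>u i \<bullet> u j\<bar> + \<kappa>) * t j)"
      unfolding sum_distrib_left by (intro sum_mono mult_right_mono tpos) simp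
    finally have "0 < \<mu> * t i" by (simp add: eig[OF that])
    then show ?thesis using tpos[of i] by (cases "t i = 0") auto
  qed
  define w where "w i = (t i)\<^sup>2" for i
  define y where "y i = u i /\<^sub>R t i" for i
  define S where "S i j = sgn (u i \<bullet> u j)" for i j
  have "near_extremal \<epsilon> d w y y S"
    unfolding near_extremal_def
  proof (intro conjI allI impI)
    show "0 < w i" if "i < d" for i using tgt[OF that] by (simp add: w_def)
    show "(\<Sum>i<d. w i) = 1" using t by (simp add: w_def)
    show "(\<Sum>i<d. (w i * (y i \<bullet> x)) *\<^sub>R y i) = x" for x
    proof -
      have "(\<Sum>i<d. (w i * (y i \<bullet> x)) *\<^sub>R y i) = (\<Sum>i<d. (u i \<bullet> x) *\<^sub>R u i)"
        by (intro sum.cong refl) (use tgt in \<open>force simp: w_def y_def power2_eq_square field_simps\<close>)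
      then show ?thesis using parseval_frameD[OF u] by simp
    qed
    show "(\<Sum>j<d. w j * \<bar>y i \<bullet> y j\<bar>) \<le> ?\<phi> + \<epsilon>" if i: "i < d" for i
    proof -
      have "(\<Sum>j<d. w j * \<bar>y i \<bullet> y j\<bar>) = (\<Sum>j<d. \<bar>u i \<bullet> u j\<bar> * t j / t i)"
      proof (intro sum.cong refl)
        fix j assume "j \<in> {..<d}"
        then have "t j > 0" "t i > 0" using tgt i by auto
        then show "w j * \<bar>y i \<bullet> y j\<bar> = \<bar>u i \<bullet> u j\<bar> * t j / t i"
          by (simp add: w_def y_def power2_eq_square abs_mult field_simps)
      qed
      also have "\<dots> = (\<Sum>j<d. \<bar>u i \<bullet> u j\<bar> * t j) / t i" by (simp add: sum_divide_distrib)
      also have "\<dots> \<le> (\<Sum>j<d. (\<bar>u i \<bullet> u j\<bar> + \<kappa>) * t j) / t i"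
        using tgt[OF i] \<open>\<kappa> > 0\<close> tpos by (intro divide_right_mono sum_mono mult_right_mono) auto
      also have "\<dots> = \<mu>" using tgt[OF i] by (simp add: eig[OF i])
      also have "\<dots> \<le> ?\<phi> + \<epsilon>" using \<mu>_le value_le \<epsilon> by simp
      finally show ?thesis .
    qed
    show "y i \<bullet> y j = y j \<bullet> y i" for i j by (rule inner_commute)
    show "\<bar>S i j\<bar> \<le> 1" for i j by (simp add: S_def sgn_if)
    fix z assume z: "\<forall>x. (\<Sum>j<d. (y j \<bullet> x) *\<^sub>R z j) = x"
    have "frame_value d t u' \<le> frame_value d t u" if "parseval_frame d (u' :: nat \<Rightarrow> 'a)" for u'
      using max[OF that t] by (simp add: regularized_value_eq)
    from optimal_frame_trace[OF u tgt tpos this, of z]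
    have "(\<Sum>i<d. \<Sum>j<d. w i * S i j * (y i \<bullet> z j)) = frame_value d t u"
      using z by (simp add: w_def S_def y_def)
    then show "?\<phi> - \<epsilon> \<le> (\<Sum>i<d. \<Sum>j<d. w i * S i j * (y i \<bullet> z j))"
      using value_ge by simp
  qed
  then show ?thesis by blast
qed

section \<open>Left inverses with small row sums\<close>

text \<open>
  In the plane of the pairs \<open>(a v, b v)\<close> a line through the origin has to be found. Points with \<open>a v < 0\<close> bound
  the weight \<open>\<theta>\<close> from below, points with \<open>b v < 0\<close> from above. The bounds are compatible: otherwise a
  convex combination of two points would have both coordinates negative.
\<close>

lemma two_functional_minimax:
  fixes a b :: "'v \<Rightarrow> real"
  assumes conv: "\<And>v v' \<theta>. v \<in> V \<Longrightarrow> v' \<in> V \<Longrightarrow> 0 \<le> \<theta> \<Longrightarrow> \<theta> \<le> 1 \<Longrightarrow>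
      \<exists>v''\<in>V. a v'' \<le> (1 - \<theta>) * a v + \<theta> * a v' \<and> b v'' \<le> (1 - \<theta>) * b v + \<theta> * b v'"
    and big: "\<And>v. v \<in> V \<Longrightarrow> 0 \<le> a v \<or> 0 \<le> b v"
  shows "\<exists>\<theta>. 0 \<le> \<theta> \<and> \<theta> \<le> 1 \<and> (\<forall>v\<in>V. 0 \<le> (1 - \<theta>) * a v + \<theta> * b v)"
proof -
  have cross: "a v * b v' \<le> a v' * b v" if v: "v \<in> V" "a v < 0" and v': "v' \<in> V" "b v' < 0" for v v'
  proof (rule ccontr)
    assume less: "\<not> a v * b v' \<le> a v' * b v"
    have "0 \<le> b v" "0 \<le> a v'" using big[OF v(1)] big[OF v'(1)] v v' by auto
    \<comment> \<open>with these weights both coordinates of the combination become \<open>a v' * b v - a v * b v'\<close>, up to normalisation\<close>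
    define p q where "p = a v' - b v'" and "q = b v - a v"
    have "p > 0" "q > 0" using \<open>0 \<le> b v\<close> \<open>0 \<le> a v'\<close> v v' by (auto simp: p_def q_def)
    define \<theta> where "\<theta> = q / (p + q)"
    have \<theta>: "0 \<le> \<theta>" "\<theta> \<le> 1" "1 - \<theta> = p / (p + q)"
      using \<open>p > 0\<close> \<open>q > 0\<close> by (auto simp: \<theta>_def field_simps)
    obtain v'' where v'': "v'' \<in> V" "a v'' \<le> (1 - \<theta>) * a v + \<theta> * a v'"
        "b v'' \<le> (1 - \<theta>) * b v + \<theta> * b v'"
      using conv[OF v(1) v'(1) \<theta>(1,2)] by blast
    have "(1 - \<theta>) * a v + \<theta> * a v' = (p * a v + q * a v') / (p + q)"
      "(1 - \<theta>) * b v + \<theta> * b v' = (p * b v + q * b v') / (p + q)"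
      unfolding \<theta>(3) by (simp_all add: \<theta>_def add_divide_distrib)
    moreover have "p * a v + q * a v' < 0" "p * b v + q * b v' < 0"
      using less by (auto simp: p_def q_def algebra_simps)
    ultimately have "(1 - \<theta>) * a v + \<theta> * a v' < 0" "(1 - \<theta>) * b v + \<theta> * b v' < 0"
      using \<open>p > 0\<close> \<open>q > 0\<close> by (auto simp: divide_neg_pos)
    with v'' big[OF v''(1)] show False by linarith
  qed
  define M where "M = insert 0 {- a v / (b v - a v) | v. v \<in> V \<and> a v < 0}"
  have M1: "x \<le> 1" if "x \<in> M" for x
  proof -
    consider "x = 0" | v where "v \<in> V" "a v < 0" "x = - a v / (b v - a v)"
      using \<open>x \<in> M\<close> by (auto simp: M_def)
    then show ?thesis
    proof cases
      case (2 v)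
      then have "0 \<le> b v" using big by force
      then show ?thesis
        unfolding 2(3) using 2 by (subst divide_le_eq_1_pos) auto
    qed simp
  qed
  then have bdd: "bdd_above M" by (rule bdd_aboveI)
  define \<theta> where "\<theta> = Sup M"
  have "0 \<le> \<theta>" unfolding \<theta>_def by (rule cSup_upper[OF _ bdd]) (simp add: M_def)
  moreover have "\<theta> \<le> 1" unfolding \<theta>_def by (rule cSup_least) (auto simp: M1, simp add: M_def)
  moreover have "0 \<le> (1 - \<theta>) * a v + \<theta> * b v" if v: "v \<in> V" for v
  proof -
    consider "a v < 0" | "b v < 0" "0 \<le> a v" | "0 \<le> a v" "0 \<le> b v" by linarith
    then show ?thesis
    proof cases
      case 1
      then have "0 \<le> b v" using big[OF v] by simp
      have "- a v / (b v - a v) \<le> \<theta>" unfolding \<theta>_def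
        by (rule cSup_upper[OF _ bdd]) (use v 1 in \<open>auto simp: M_def\<close>)
      then have "- a v \<le> \<theta> * (b v - a v)"
        using 1 \<open>0 \<le> b v\<close> by (subst (asm) pos_divide_le_eq) auto
      then show ?thesis by (simp add: algebra_simps)
    next
      case 2
      have "\<theta> \<le> a v / (a v - b v)" unfolding \<theta>_def
      proof (rule cSup_least)
        fix x assume "x \<in> M"
        then consider "x = 0" | v' where "v' \<in> V" "a v' < 0" "x = - a v' / (b v' - a v')"
          by (auto simp: M_def)
        then show "x \<le> a v / (a v - b v)"
        proof cases
          case (2 v')
          then have "0 \<le> b v'" using big by force
          have "0 < b v' - a v'" "0 < a v - b v"
            using 2 \<open>0 \<le> b v'\<close> \<open>0 \<le> a v\<close> \<open>b v < 0\<close> by auto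
          moreover have "- a v' * (a v - b v) \<le> a v * (b v' - a v')"
            using cross[OF 2(1,2) v \<open>b v < 0\<close>] by (simp add: algebra_simps)
          ultimately show ?thesis
            unfolding 2(3)
            by (simp only: pos_divide_le_eq pos_le_divide_eq times_divide_eq_left)
        qed (use 2 in simp)
      qed (simp add: M_def)
      then show ?thesis using 2 by (simp add: le_divide_eq algebra_simps)
    next
      case 3
      then show ?thesis using \<open>0 \<le> \<theta>\<close> \<open>\<theta> \<le> 1\<close> by simp
    qed
  qed
  ultimately show ?thesis by blast
qed

text \<open>
  The hard half of the minimax theorem for finitely many functions which are convex in the weak sense
  that convex combinations of values are dominated by values. The induction applies the hypothesis to the set
  where the last function is small and combines the result with the last function.
\<close>

lemma finite_minimax:
  fixes f :: "nat \<Rightarrow> 'v \<Rightarrow> real"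
  assumes conv: "\<And>v v' \<theta>. v \<in> V \<Longrightarrow> v' \<in> V \<Longrightarrow> 0 \<le> \<theta> \<Longrightarrow> \<theta> \<le> 1 \<Longrightarrow>
      \<exists>v''\<in>V. \<forall>i\<le>m. f i v'' \<le> (1 - \<theta>) * f i v + \<theta> * f i v'"
    and big: "\<And>v. v \<in> V \<Longrightarrow> \<exists>i\<le>m. c \<le> f i v"
  shows "\<exists>w. (\<forall>i. 0 \<le> w i) \<and> (\<Sum>i\<le>m. w i) = 1 \<and> (\<forall>v\<in>V. c \<le> (\<Sum>i\<le>m. w i * f i v))"
  using conv big
proof (induction m arbitrary: V)
  case 0
  then show ?case by (intro exI[of _ "\<lambda>_. 1"]) auto
next
  case (Suc m)
  let ?V' = "{v \<in> V. f (Suc m) v < c}"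
  have "\<exists>w. (\<forall>i. 0 \<le> w i) \<and> (\<Sum>i\<le>m. w i) = 1 \<and> (\<forall>v\<in>?V'. c \<le> (\<Sum>i\<le>m. w i * f i v))"
  proof (rule Suc.IH)
    fix v v' and \<theta> :: real
    assume v: "v \<in> ?V'" "v' \<in> ?V'" and \<theta>: "0 \<le> \<theta>" "\<theta> \<le> 1"
    then obtain v'' where v'': "v'' \<in> V" "\<forall>i\<le>Suc m. f i v'' \<le> (1 - \<theta>) * f i v + \<theta> * f i v'"
      using Suc.prems(1)[of v v' \<theta>] by blast
    have "f (Suc m) v'' \<le> (1 - \<theta>) * f (Suc m) v + \<theta> * f (Suc m) v'" using v'' by simp
    also have "\<dots> < c" by (rule convex_bound_lt) (use v \<theta> in auto)
    finally show "\<exists>v''\<in>?V'. \<forall>i\<le>m. f i v'' \<le> (1 - \<theta>) * f i v + \<theta> * f i v'"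
      using v'' by auto
  next
    fix v assume "v \<in> ?V'"
    then show "\<exists>i\<le>m. c \<le> f i v"
      using Suc.prems(2)[of v] by (auto simp: le_Suc_eq)
  qed
  then obtain w where w: "\<And>i. 0 \<le> w i" "(\<Sum>i\<le>m. w i) = 1"
    and wV: "\<And>v. v \<in> ?V' \<Longrightarrow> c \<le> (\<Sum>i\<le>m. w i * f i v)" by blast
  let ?a = "\<lambda>v. (\<Sum>i\<le>m. w i * f i v) - c" and ?b = "\<lambda>v. f (Suc m) v - c"
  have "\<exists>\<theta>. 0 \<le> \<theta> \<and> \<theta> \<le> 1 \<and> (\<forall>v\<in>V. 0 \<le> (1 - \<theta>) * ?a v + \<theta> * ?b v)"
  proof (rule two_functional_minimax)
    fix v v' and \<theta> :: real
    assume v: "v \<in> V" "v' \<in> V" and \<theta>: "0 \<le> \<theta>" "\<theta> \<le> 1"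
    then obtain v'' where v'': "v'' \<in> V" "\<forall>i\<le>Suc m. f i v'' \<le> (1 - \<theta>) * f i v + \<theta> * f i v'"
      using Suc.prems(1)[of v v' \<theta>] by blast
    have "(\<Sum>i\<le>m. w i * f i v'') \<le> (\<Sum>i\<le>m. w i * ((1 - \<theta>) * f i v + \<theta> * f i v'))"
      using v'' w by (intro sum_mono mult_left_mono) auto
    also have "\<dots> = (1 - \<theta>) * (\<Sum>i\<le>m. w i * f i v) + \<theta> * (\<Sum>i\<le>m. w i * f i v')"
      by (simp add: sum_distrib_left sum.distrib[symmetric] distrib_left mult_ac)
    finally have "?a v'' \<le> (1 - \<theta>) * ?a v + \<theta> * ?a v'" by (simp add: algebra_simps)
    moreover have "?b v'' \<le> (1 - \<theta>) * ?b v + \<theta> * ?b v'" using v'' by (auto simp: algebra_simps)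
    ultimately show "\<exists>v''\<in>V. ?a v'' \<le> (1 - \<theta>) * ?a v + \<theta> * ?a v' \<and> ?b v'' \<le> (1 - \<theta>) * ?b v + \<theta> * ?b v'"
      using v'' by blast
  qed (use wV in force)
  then obtain \<theta> where \<theta>: "0 \<le> \<theta>" "\<theta> \<le> 1" and \<theta>V: "\<And>v. v \<in> V \<Longrightarrow> 0 \<le> (1 - \<theta>) * ?a v + \<theta> * ?b v"
    by blast
  define w' where "w' i = (if i = Suc m then \<theta> else (1 - \<theta>) * w i)" for i
  have sums: "(\<Sum>i\<le>Suc m. w' i * g i) = (1 - \<theta>) * (\<Sum>i\<le>m. w i * g i) + \<theta> * g (Suc m)" for g
    by (simp add: w'_def sum_distrib_left mult.assoc)
  show ?case
  proof (intro exI[of _ w'] conjI allI ballI)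
    show "0 \<le> w' i" for i using \<theta> w by (simp add: w'_def)
    show "(\<Sum>i\<le>Suc m. w' i) = 1" using sums[of "\<lambda>_. 1"] w by simp
    fix v assume "v \<in> V"
    then show "c \<le> (\<Sum>i\<le>Suc m. w' i * f i v)"
      using \<theta>V[of v] unfolding sums by (simp add: algebra_simps)
  qed
qed

text \<open>
  Gram-Schmidt orthonormalisation for the inner product \<open>B\<close>.
\<close>

lemma orthonormalizing_map:
  fixes B :: "'a::euclidean_space \<Rightarrow> 'a \<Rightarrow> real"
  assumes B: "bilinear B" and sym: "\<And>x y. B x y = B y x" and pos: "\<And>x. x \<noteq> 0 \<Longrightarrow> 0 < B x x"
  obtains R :: "'a \<Rightarrow> 'a" where "linear R" "\<And>x y. B (R x) (R y) = x \<bullet> y"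
proof -
  have "\<exists>e :: nat \<Rightarrow> 'a. \<forall>i<k. \<forall>j<k. B (e i) (e j) = (if i = j then 1 else 0)" if "k \<le> DIM('a)" for k
    using that
  proof (induction k)
    case (Suc k)
    then obtain e :: "nat \<Rightarrow> 'a" where e: "\<And>i j. i < k \<Longrightarrow> j < k \<Longrightarrow> B (e i) (e j) = (if i = j then 1 else 0)"
      by auto
    have "dim (e ` {..<k}) \<le> card (e ` {..<k})" by (intro dim_le_card') auto
    also have "\<dots> \<le> k" using card_image_le[of "{..<k}" e] by simp
    finally have "span (e ` {..<k}) \<noteq> UNIV"
      using Suc.prems by (metis dim_UNIV dim_span not_less_eq_eq order_trans)
    then obtain x where x: "x \<notin> span (e ` {..<k})" by auto
    define x' where "x' = x - (\<Sum>i<k. B x (e i) *\<^sub>R e i)"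
    have "(\<Sum>i<k. B x (e i) *\<^sub>R e i) \<in> span (e ` {..<k})"
      by (intro span_sum span_scale span_base) auto
    then have "x' \<noteq> 0" using x by (auto simp: x'_def)
    have orth: "B x' (e j) = 0" if "j < k" for j
    proof -
      have "B x' (e j) = B x (e j) - (\<Sum>i<k. B x (e i) * B (e i) (e j))"
        unfolding x'_def
        using bilinear_lsub[OF B] linear_sum[of "\<lambda>x. B x (e j)" "\<lambda>i. B x (e i) *\<^sub>R e i" "{..<k}"] B
        by (simp add: bilinear_lmul[OF B] bilinear_def)
      also have "(\<Sum>i<k. B x (e i) * B (e i) (e j)) = (\<Sum>i<k. if i = j then B x (e i) else 0)"
        using that by (intro sum.cong refl) (simp add: e)
      finally show ?thesis using that by simp
    qed
    define f where "f = x' /\<^sub>R sqrt (B x' x')"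
    have ff: "B f f = 1"
      using pos[OF \<open>x' \<noteq> 0\<close>] by (simp add: f_def bilinear_lmul[OF B] bilinear_rmul[OF B] field_simps)
    have fe: "B f (e j) = 0" "B (e j) f = 0" if "j < k" for j
      using orth[OF that] by (simp_all add: sym[of "e j"] f_def bilinear_lmul[OF B])
    show ?case
      by (intro exI[of _ "e(k := f)"]) (auto simp: less_Suc_eq e ff fe)
  qed simp
  then obtain e :: "nat \<Rightarrow> 'a" where
    e: "\<And>i j. i < DIM('a) \<Longrightarrow> j < DIM('a) \<Longrightarrow> B (e i) (e j) = (if i = j then 1 else 0)"
    by blast
  obtain \<beta> :: "nat \<Rightarrow> 'a" where \<beta>: "bij_betw \<beta> {..<DIM('a)} Basis"
    using ex_bij_betw_nat_finite[OF finite_Basis] by (metis atLeast0LessThan)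
  define R where "R x = (\<Sum>k<DIM('a). (x \<bullet> \<beta> k) *\<^sub>R e k)" for x :: 'a
  show thesis
  proof (rule that)
    show "linear R"
      by (intro linearI)
        (simp_all add: R_def inner_add_left scaleR_add_left sum.distrib scaleR_sum_right)
    fix x y
    have "B (R x) (R y) = (\<Sum>i<DIM('a). \<Sum>j<DIM('a). ((x \<bullet> \<beta> i) * (y \<bullet> \<beta> j)) * B (e i) (e j))"
    proof -
      have "B (R x) (R y) = (\<Sum>(i,j)\<in>{..<DIM('a)} \<times> {..<DIM('a)}. B ((x \<bullet> \<beta> i) *\<^sub>R e i) ((y \<bullet> \<beta> j) *\<^sub>R e j))"
        unfolding R_def by (intro bilinear_sum B)
      then show ?thesis
        by (simp add: sum.cartesian_product bilinear_lmul[OF B] bilinear_rmul[OF B] mult_ac)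
    qed
    also have "\<dots> = (\<Sum>i<DIM('a). \<Sum>j<DIM('a). if i = j then (x \<bullet> \<beta> i) * (y \<bullet> \<beta> j) else 0)"
      by (intro sum.cong refl) (simp add: e)
    also have "\<dots> = (\<Sum>i<DIM('a). (x \<bullet> \<beta> i) * (y \<bullet> \<beta> i))"
      by (intro sum.cong refl) simp
    also have "\<dots> = x \<bullet> y"
      using sum.reindex_bij_betw[OF \<beta>, of "\<lambda>b. (x \<bullet> b) * (y \<bullet> b)"] euclidean_inner[of x y] by simp
    finally show "B (R x) (R y) = x \<bullet> y" .
  qed
qed

lemma max_frame_value_nonneg: "0 \<le> max_frame_value TYPE('a::euclidean_space)"
proof -
  obtain d t and u :: "nat \<Rightarrow> 'a" where u: "parseval_frame d u" and t: "(\<Sum>i<d. (t i)\<^sup>2) = (1::real)"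
    using exists_parseval_frame by blast
  have "0 \<le> frame_value d (\<lambda>i. \<bar>t i\<bar>) u" by (simp add: frame_value_def sum_nonneg)
  also have "\<dots> \<le> max_frame_value TYPE('a)" by (rule frame_value_le_max[OF u]) (simp add: t)
  finally show ?thesis .
qed

text \<open>
  The left inverse which is orthogonal for the weights \<open>w\<close>. If \<open>R\<close> maps an orthonormal basis to a basis that is
  orthonormal for \<open>\<Sum>k. w k * (y k \<bullet> x) * (y k \<bullet> x')\<close>, then \<open>sqrt (w k)\<close> times the functionals \<open>y k\<close>, expressed in
  that basis, form a Parseval frame, and the average of the row sums is its value with \<open>t = sqrt w\<close>.
\<close>

lemma weighted_left_inverse:
  fixes y :: "nat \<Rightarrow> 'a::euclidean_space"
  assumes span: "\<And>x. (\<forall>k<m. y k \<bullet> x = 0) \<Longrightarrow> x = 0"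
    and w: "\<And>k. k < m \<Longrightarrow> 0 < w k" "(\<Sum>k<m. w k) = 1"
  shows "\<exists>z. (\<forall>x. (\<Sum>k<m. (y k \<bullet> x) *\<^sub>R z k) = x) \<and>
      (\<Sum>i<m. w i * (\<Sum>k<m. \<bar>y i \<bullet> z k\<bar>)) \<le> max_frame_value TYPE('a)"
proof -
  define B where "B x x' = (\<Sum>k<m. w k * (y k \<bullet> x) * (y k \<bullet> x'))" for x x'
  have B: "bilinear B"
    unfolding bilinear_def
    by (intro conjI allI linearI; simp add: B_def inner_add_right distrib_left distrib_right
        sum.distrib sum_distrib_left mult_ac)
  have pos: "0 < B x x" if "x \<noteq> 0" for x
  proof -
    have nn: "0 \<le> w k * (y k \<bullet> x) * (y k \<bullet> x)" if "k < m" for k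
      using w(1)[OF that] by (simp add: mult.assoc)
    have "B x x \<noteq> 0"
    proof
      assume "B x x = 0"
      then have "\<forall>k\<in>{..<m}. w k * (y k \<bullet> x) * (y k \<bullet> x) = 0"
        unfolding B_def by (subst (asm) sum_nonneg_eq_0_iff) (use nn in auto)
      then have "y k \<bullet> x = 0" if "k < m" for k using w(1)[OF that] that by force
      with span \<open>x \<noteq> 0\<close> show False by blast
    qed
    moreover have "0 \<le> B x x" unfolding B_def by (intro sum_nonneg) (use nn in auto)
    ultimately show ?thesis by simp
  qed
  obtain R :: "'a \<Rightarrow> 'a" where R: "linear R" and BR: "\<And>x x'. B (R x) (R x') = x \<bullet> x'"
    using orthonormalizing_map[OF B _ pos] by (auto simp: B_def mult_ac)
  have "inj R"
    unfolding linear_injective_0[OF R]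
  proof (intro allI impI)
    fix x assume "R x = 0"
    then have "x \<bullet> x = B 0 0" using BR[of x x] by simp
    then show "x = 0" by (simp add: B_def)
  qed
  then have "surj R" by (rule linear_inj_imp_surj[OF R])
  define t where "t k = sqrt (w k)" for k
  have tt: "t k * t k = w k" if "k < m" for k using w(1)[OF that] by (simp add: t_def)
  define u where "u k = t k *\<^sub>R adjoint R (y k)" for k
  have ux: "u k \<bullet> x = t k * (y k \<bullet> R x)" for k x
    using adjoint_works[OF R, of x "y k"] by (simp add: u_def inner_commute)
  have u_inner: "(\<Sum>k<m. (u k \<bullet> x) * (u k \<bullet> x')) = x \<bullet> x'" for x x'
  proof -
    have "(\<Sum>k<m. (u k \<bullet> x) * (u k \<bullet> x')) = B (R x) (R x')"
      unfolding B_def ux by (intro sum.cong refl) (simp add: tt[symmetric] mult_ac)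
    then show ?thesis by (simp add: BR)
  qed
  have u: "parseval_frame m u"
    unfolding parseval_frame_def
  proof
    fix x
    have "(\<Sum>k<m. (u k \<bullet> x) *\<^sub>R u k) \<bullet> x' = x \<bullet> x'" for x'
      using u_inner[of x x'] by (simp add: inner_sum_left)
    then show "(\<Sum>k<m. (u k \<bullet> x) *\<^sub>R u k) = x" by (metis vector_eq_ldot inner_commute)
  qed
  define z where "z k = t k *\<^sub>R R (u k)" for k
  show ?thesis
  proof (intro exI[of _ z] conjI allI)
    fix x
    obtain x' where x': "x = R x'" using \<open>surj R\<close> by (metis surjD)
    have "(\<Sum>k<m. (y k \<bullet> x) *\<^sub>R z k) = R (\<Sum>k<m. (u k \<bullet> x') *\<^sub>R u k)"
      by (simp add: linear_sum[OF R] linear_scale[OF R] z_def ux x' mult.commute)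
    then show "(\<Sum>k<m. (y k \<bullet> x) *\<^sub>R z k) = x" by (simp add: parseval_frameD[OF u] x')
  next
    have "(\<Sum>i<m. w i * (\<Sum>k<m. \<bar>y i \<bullet> z k\<bar>)) = frame_value m t u"
      unfolding frame_value_def sum_distrib_left
    proof (intro sum.cong refl)
      fix i k assume "i \<in> {..<m}" "k \<in> {..<m}"
      then have "0 < t i" "0 < t k" "w i = t i * t i" using w tt by (auto simp: t_def)
      then show "w i * \<bar>y i \<bullet> z k\<bar> = t i * t k * \<bar>u i \<bullet> u k\<bar>"
        by (simp add: z_def ux abs_mult)
    qed
    also have "\<dots> \<le> max_frame_value TYPE('a)"
      by (rule frame_value_le_max[OF u]) (use w tt in \<open>simp add: power2_eq_square\<close>)
    finally show "(\<Sum>i<m. w i * (\<Sum>k<m. \<bar>y i \<bullet> z k\<bar>)) \<le> max_frame_value TYPE('a)" .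
  qed
qed

text \<open>
  If every left inverse had a row sum above \<open>c\<close>, the minimax lemma would give weights for which all averages of
  row sums are at least \<open>c\<close>. Mixing a small multiple of the uniform weights in makes the weights positive and
  keeps the averages above \<open>\<phi>\<close>, against \<open>weighted_left_inverse\<close>.
\<close>

lemma small_left_inverse:
  fixes y :: "nat \<Rightarrow> 'a::euclidean_space"
  assumes span: "\<And>x. (\<forall>k<m. y k \<bullet> x = 0) \<Longrightarrow> x = 0"
    and c: "max_frame_value TYPE('a) < c"
  shows "\<exists>z. (\<forall>x. (\<Sum>k<m. (y k \<bullet> x) *\<^sub>R z k) = x) \<and> (\<forall>i<m. (\<Sum>k<m. \<bar>y i \<bullet> z k\<bar>) \<le> c)"
proof (rule ccontr)
  assume neg: "\<not> ?thesis"
  let ?\<phi> = "max_frame_value TYPE('a)"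
  have "m \<noteq> 0"
  proof
    assume "m = 0"
    then have "x = 0" for x :: 'a using span by simp
    then show False by (metis nonzero_Basis SOME_Basis)
  qed
  then obtain n where m: "m = Suc n" by (cases m) auto
  then have mset: "{..n} = {..<m}" by auto
  define Z where "Z = {z. \<forall>x. (\<Sum>k<m. (y k \<bullet> x) *\<^sub>R z k) = x}"
  define f where "f i z = (\<Sum>k<m. \<bar>y i \<bullet> z k\<bar>)" for i and z :: "nat \<Rightarrow> 'a"
  have "\<exists>w. (\<forall>i. 0 \<le> w i) \<and> (\<Sum>i\<le>n. w i) = 1 \<and> (\<forall>z\<in>Z. c \<le> (\<Sum>i\<le>n. w i * f i z))"
  proof (rule finite_minimax)
    fix z z' and \<theta> :: real
    assume z: "z \<in> Z" "z' \<in> Z" and \<theta>: "0 \<le> \<theta>" "\<theta> \<le> 1"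
    define z'' where "z'' k = (1 - \<theta>) *\<^sub>R z k + \<theta> *\<^sub>R z' k" for k
    have "(\<Sum>k<m. (y k \<bullet> x) *\<^sub>R z'' k) = x" for x
    proof -
      have "(\<Sum>k<m. (y k \<bullet> x) *\<^sub>R z'' k)
          = (1 - \<theta>) *\<^sub>R (\<Sum>k<m. (y k \<bullet> x) *\<^sub>R z k) + \<theta> *\<^sub>R (\<Sum>k<m. (y k \<bullet> x) *\<^sub>R z' k)"
        by (simp add: z''_def scaleR_sum_right sum.distrib[symmetric] scaleR_add_right mult.commute)
      then show ?thesis using z by (simp add: Z_def scaleR_add_left[symmetric])
    qed
    then have "z'' \<in> Z" by (simp add: Z_def)
    moreover have "f i z'' \<le> (1 - \<theta>) * f i z + \<theta> * f i z'" for i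
    proof -
      have "f i z'' \<le> (\<Sum>k<m. (1 - \<theta>) * \<bar>y i \<bullet> z k\<bar> + \<theta> * \<bar>y i \<bullet> z' k\<bar>)"
        unfolding f_def
      proof (intro sum_mono)
        fix k
        have "y i \<bullet> z'' k = (1 - \<theta>) * (y i \<bullet> z k) + \<theta> * (y i \<bullet> z' k)"
          by (simp add: z''_def inner_add_right)
        then show "\<bar>y i \<bullet> z'' k\<bar> \<le> (1 - \<theta>) * \<bar>y i \<bullet> z k\<bar> + \<theta> * \<bar>y i \<bullet> z' k\<bar>"
          using abs_triangle_ineq[of "(1 - \<theta>) * (y i \<bullet> z k)" "\<theta> * (y i \<bullet> z' k)"] \<theta>
          by (simp add: abs_mult)
      qed
      then show ?thesis by (simp add: f_def sum.distrib sum_distrib_left)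
    qed
    ultimately show "\<exists>z''\<in>Z. \<forall>i\<le>n. f i z'' \<le> (1 - \<theta>) * f i z + \<theta> * f i z'" by blast
  next
    fix z assume "z \<in> Z"
    then obtain i where "i < m" "\<not> f i z \<le> c"
      using neg unfolding Z_def f_def by blast
    then show "\<exists>i\<le>n. c \<le> f i z"
      by (intro exI[of _ i]) (simp add: m)
  qed
  then obtain w where w: "\<And>i. 0 \<le> w i" "(\<Sum>i<m. w i) = 1"
    and wZ: "\<And>z. z \<in> Z \<Longrightarrow> c \<le> (\<Sum>i<m. w i * f i z)"
    unfolding mset by blast
  have "0 < c" using c max_frame_value_nonneg[where 'a='a] by linarith
  \<comment> \<open>chosen so that \<open>(1 - \<delta>) * c\<close> is the midpoint of \<open>\<phi>\<close> and \<open>c\<close>\<close>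
  define \<delta> where "\<delta> = (c - ?\<phi>) / (2 * c)"
  have \<delta>: "0 < \<delta>" "\<delta> < 1" "(1 - \<delta>) * c > ?\<phi>"
    using c \<open>0 < c\<close> max_frame_value_nonneg[where 'a='a] by (auto simp: \<delta>_def field_simps)
  define w' where "w' i = (1 - \<delta>) * w i + \<delta> / m" for i
  have "0 < w' i" for i
    using w \<delta> m by (auto simp: w'_def intro!: add_nonneg_pos)
  moreover have "(\<Sum>i<m. w' i) = 1"
    using w m by (simp add: w'_def sum.distrib sum_distrib_left[symmetric])
  ultimately obtain z where z: "z \<in> Z" and le: "(\<Sum>i<m. w' i * f i z) \<le> ?\<phi>"
    using weighted_left_inverse[where m = m and y = y and w = w', OF span]
    unfolding Z_def f_def by blast
  have "(1 - \<delta>) * c \<le> (1 - \<delta>) * (\<Sum>i<m. w i * f i z)"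
    using wZ[OF z] \<delta> by (intro mult_left_mono) auto
  also have "\<dots> \<le> (\<Sum>i<m. w' i * f i z)"
    unfolding sum_distrib_left
  proof (intro sum_mono)
    fix i
    have "0 \<le> f i z" by (simp add: f_def sum_nonneg)
    then show "(1 - \<delta>) * (w i * f i z) \<le> w' i * f i z"
      using \<delta> by (simp add: w'_def distrib_right)
  qed
  finally show False using le \<delta> by simp
qed

section \<open>Norms on Euclidean space and embeddings into bounded sequences\<close>

lemma is_norm_nonneg: "is_norm N \<Longrightarrow> 0 \<le> N x"
  and is_norm_eq_0_iff: "is_norm N \<Longrightarrow> N x = 0 \<longleftrightarrow> x = 0"
  and is_norm_triangle: "is_norm N \<Longrightarrow> N (x + y) \<le> N x + N y"
  and is_norm_scale: "is_norm N \<Longrightarrow> N (c *\<^sub>R x) = \<bar>c\<bar> * N x"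
  by (auto simp: is_norm_def)

lemma is_norm_minus: "is_norm N \<Longrightarrow> N (- x) = N x"
  using is_norm_scale[of N "-1" x] by simp

lemma is_norm_pos: "is_norm N \<Longrightarrow> x \<noteq> 0 \<Longrightarrow> 0 < N x"
  using is_norm_nonneg[of N x] is_norm_eq_0_iff[of N x] by linarith

lemma is_norm_sum:
  assumes "is_norm N"
  shows "N (\<Sum>i\<in>A. f i) \<le> (\<Sum>i\<in>A. N (f i))"
proof (induction A rule: infinite_finite_induct)
  case (insert i A)
  then show ?case using is_norm_triangle[OF assms, of "f i" "sum f A"] by simp
qed (use is_norm_eq_0_iff[OF assms, of 0] in auto)

lemma is_norm_upper:
  fixes N :: "'a::euclidean_space \<Rightarrow> real"
  assumes N: "is_norm N"
  obtains C where "0 < C" "\<And>x. N x \<le> C * norm x"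
proof
  define C where "C = (\<Sum>b\<in>Basis. N b) + 1"
  show "0 < C" using is_norm_nonneg[OF N] by (simp add: C_def sum_nonneg add_nonneg_pos)
  fix x
  have "N x = N (\<Sum>b\<in>Basis. (x \<bullet> b) *\<^sub>R b)" by (simp add: euclidean_representation)
  also have "\<dots> \<le> (\<Sum>b\<in>Basis. N ((x \<bullet> b) *\<^sub>R b))" by (rule is_norm_sum[OF N])
  also have "\<dots> \<le> (\<Sum>b\<in>Basis. norm x * N b)"
    using is_norm_nonneg[OF N] Basis_le_norm
    by (intro sum_mono) (auto simp: is_norm_scale[OF N] intro!: mult_right_mono)
  also have "\<dots> \<le> C * norm x" unfolding sum_distrib_left[symmetric] by (simp add: C_def algebra_simps)
  finally show "N x \<le> C * norm x" .
qed

lemma is_norm_diff: "is_norm N \<Longrightarrow> \<bar>N x - N y\<bar> \<le> N (x - y)"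
  using is_norm_triangle[of N "x - y" y] is_norm_triangle[of N "y - x" x] is_norm_minus[of N "x - y"]
  by simp

lemma is_norm_continuous:
  fixes N :: "'a::euclidean_space \<Rightarrow> real"
  assumes N: "is_norm N"
  shows "continuous_on S N"
proof -
  obtain C where C: "0 < C" "\<And>x. N x \<le> C * norm x" using is_norm_upper[OF N] by blast
  have "C-lipschitz_on S N"
  proof (rule lipschitz_onI)
    show "dist (N x) (N y) \<le> C * dist x y" for x y
      using is_norm_diff[OF N, of x y] C(2)[of "x - y"] by (simp add: dist_norm)
  qed (use C in simp)
  then show ?thesis by (rule lipschitz_on_continuous_on)
qed

lemma is_norm_lower:
  fixes N :: "'a::euclidean_space \<Rightarrow> real"
  assumes N: "is_norm N"
  obtains c where "0 < c" "\<And>x. c * norm x \<le> N x"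
proof -
  have "sphere (0::'a) 1 \<noteq> {}" by simp
  then obtain x0 :: 'a where x0: "norm x0 = 1" and min: "\<And>x. norm x = 1 \<Longrightarrow> N x0 \<le> N x"
    using continuous_attains_inf[OF compact_sphere _ is_norm_continuous[OF N], of 0 1] by auto
  show thesis
  proof
    have "x0 \<noteq> 0" using x0 by auto
    then show "0 < N x0" by (rule is_norm_pos[OF N])
    fix x
    show "N x0 * norm x \<le> N x"
    proof (cases "x = 0")
      case False
      have "N x0 \<le> N (x /\<^sub>R norm x)" using False by (intro min) simp
      then show ?thesis using False by (simp add: is_norm_scale[OF N] field_simps)
    qed (use is_norm_nonneg[OF N, of 0] in simp)
  qed
qed

lemma apply_Bcontfun_seq:
  fixes f :: "nat \<Rightarrow> real"
  assumes "\<And>k. \<bar>f k\<bar> \<le> b"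
  shows "apply_bcontfun (Bcontfun f) = f"
  by (rule Bcontfun_inverse, rule bcontfun_normI[of _ b]) (use assms in auto)

lemma apply_bcontfun_sum:
  "apply_bcontfun (\<Sum>i\<in>A. f i) k = (\<Sum>i\<in>A. apply_bcontfun (f i) k)"
  by (induction A rule: infinite_finite_induct) auto

text \<open>
  Separate \<open>z\<close> from the closed unit ball.
\<close>

lemma norming_functional:
  fixes N :: "'a::euclidean_space \<Rightarrow> real"
  assumes N: "is_norm N" and z: "1 < N z"
  obtains f where "\<And>x. f \<bullet> x \<le> N x" "1 < f \<bullet> z"
proof -
  let ?K = "{x. N x \<le> 1}"
  have "convex ?K"
  proof (rule convexI)
    fix x y and a b :: real
    assume *: "x \<in> ?K" "y \<in> ?K" "0 \<le> a" "0 \<le> b" "a + b = 1"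
    have "N (a *\<^sub>R x + b *\<^sub>R y) \<le> a * N x + b * N y"
      using is_norm_triangle[OF N, of "a *\<^sub>R x" "b *\<^sub>R y"] * by (simp add: is_norm_scale[OF N])
    also have "\<dots> \<le> 1" by (rule convex_bound_le) (use * in auto)
    finally show "a *\<^sub>R x + b *\<^sub>R y \<in> ?K" by simp
  qed
  moreover have "closed ?K"
    by (intro closed_Collect_le is_norm_continuous[OF N] continuous_intros)
  ultimately obtain a b where ab: "a \<bullet> z < b" "\<And>x. x \<in> ?K \<Longrightarrow> b < a \<bullet> x"
    using separating_hyperplane_closed_point[of ?K z] z by auto
  have "N 0 = 0" using is_norm_eq_0_iff[OF N, of 0] by simp
  then have "b < 0" using ab(2)[of 0] by simp
  show thesis
  proof (rule that[of "a /\<^sub>R b"])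
    show "1 < (a /\<^sub>R b) \<bullet> z" using ab(1) \<open>b < 0\<close> by (simp add: field_simps)
    fix x
    show "(a /\<^sub>R b) \<bullet> x \<le> N x"
    proof (cases "x = 0")
      case False
      have "N x > 0" using is_norm_pos[OF N False] .
      then have "x /\<^sub>R N x \<in> ?K" by (simp add: is_norm_scale[OF N])
      from ab(2)[OF this] show ?thesis using \<open>b < 0\<close> \<open>N x > 0\<close> by (simp add: field_simps)
    qed (use \<open>N 0 = 0\<close> in simp)
  qed
qed

text \<open>
  The coordinates are a dense sequence in the dual unit ball; by \<open>norming_functional\<close> and density their
  supremum is the norm.
\<close>

lemma exists_isometric_embedding:
  fixes N :: "'a::euclidean_space \<Rightarrow> real"
  assumes N: "is_norm N"
  shows "\<exists>j. isometric_embedding N j"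
proof -
  define B where "B = {f. \<forall>x. f \<bullet> x \<le> N x}"
  obtain T where T: "countable T" "T \<subseteq> B" "B \<subseteq> closure T"
    using separable[of B] by blast
  have "0 \<in> B" using is_norm_nonneg[OF N] by (simp add: B_def)
  then have "T \<noteq> {}" using T by auto
  define g where "g = from_nat_into T"
  have rg: "range g = T" unfolding g_def by (rule range_from_nat_into[OF \<open>T \<noteq> {}\<close> T(1)])
  have le: "\<bar>g k \<bullet> x\<bar> \<le> N x" for k x
  proof -
    have "g k \<in> B" using rg T by auto
    then have "g k \<bullet> x \<le> N x" "g k \<bullet> (- x) \<le> N (- x)" unfolding B_def by blast+
    then show ?thesis by (simp add: is_norm_minus[OF N] abs_le_iff)
  qed
  define j where "j x = Bcontfun (\<lambda>k. g k \<bullet> x)" for x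
  have jk: "apply_bcontfun (j x) k = g k \<bullet> x" for x k
    unfolding j_def by (subst apply_Bcontfun_seq[of _ "N x"]) (auto simp: le)
  have "linear j"
    by (intro linearI bcontfun_eqI) (simp_all add: jk inner_add_right)
  moreover have "norm (j x) = N x" for x
  proof (rule antisym)
    show "norm (j x) \<le> N x" by (rule norm_bound) (simp add: jk le)
    show "N x \<le> norm (j x)"
    proof (rule dense_le)
      fix r assume r: "r < N x"
      show "r \<le> norm (j x)"
      proof (cases "r > 0")
        case True
        then have "1 < N (x /\<^sub>R r)" using r by (simp add: is_norm_scale[OF N] field_simps)
        from norming_functional[OF N this] obtain f where "\<And>x. f \<bullet> x \<le> N x" "1 < f \<bullet> (x /\<^sub>R r)" by blast
        then have f: "f \<in> B" "r < x \<bullet> f" using True by (auto simp: B_def field_simps inner_commute)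
        have "open {h. r < x \<bullet> h}" by (intro open_Collect_less continuous_intros)
        then have "{h. r < x \<bullet> h} \<inter> T \<noteq> {}"
          using f T open_Int_closure_eq_empty[of "{h. r < x \<bullet> h}" T] by blast
        then obtain k where "r < x \<bullet> g k" using rg by blast
        then show ?thesis using norm_bounded[of "j x" k] by (simp add: jk inner_commute)
      next
        case False
        then show ?thesis using norm_ge_zero[of "j x"] by linarith
      qed
    qed
  qed
  ultimately show ?thesis unfolding isometric_embedding_def by blast
qed

lemma proj_const_eq_rel_proj_const:
  fixes N :: "'a::euclidean_space \<Rightarrow> real"
  assumes "is_norm N"
  obtains j where "isometric_embedding N j" "proj_const N = rel_proj_const (range j)"
  using someI_ex[OF exists_isometric_embedding[OF assms]] by (simp add: proj_const_def)

text \<open>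
  Compactness of the unit sphere. This reduces every extension of functionals from the embedded space to all
  bounded sequences to a finite linear combination of coordinates.
\<close>

lemma finitely_many_coordinates_almost_norming:
  fixes N :: "'a::euclidean_space \<Rightarrow> real"
  assumes N: "is_norm N" and j: "isometric_embedding N j" and \<epsilon>: "0 < \<epsilon>"
  obtains m where "0 < m"
    "\<And>x \<mu>. (\<And>k. k < m \<Longrightarrow> \<bar>apply_bcontfun (j x) k\<bar> \<le> \<mu>) \<Longrightarrow> N x \<le> (1 + \<epsilon>) * \<mu>"
proof -
  have lin: "linear j" and nj: "\<And>x. norm (j x) = N x"
    using j by (auto simp: isometric_embedding_def)
  have lk: "linear (\<lambda>x. apply_bcontfun (j x) k)" for k
    by (intro linearI) (simp_all add: linear_add[OF lin] linear_scale[OF lin])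
  define U where "U k = {x. N x < (1 + \<epsilon>) * \<bar>apply_bcontfun (j x) k\<bar>}" for k
  have "open (U k)" for k
    unfolding U_def
    by (intro open_Collect_less is_norm_continuous[OF N] continuous_intros linear_continuous_on
        linear_conv_bounded_linear[THEN iffD1] lk)
  moreover have cover: "sphere 0 1 \<subseteq> (\<Union>k. U k)"
  proof
    fix x :: 'a assume "x \<in> sphere 0 1"
    then have "x \<noteq> 0" by auto
    show "x \<in> (\<Union>k. U k)"
    proof (rule ccontr)
      assume "x \<notin> (\<Union>k. U k)"
      then have "\<bar>apply_bcontfun (j x) k\<bar> \<le> N x / (1 + \<epsilon>)" for k
        using \<epsilon> by (auto simp: U_def not_less field_simps)
      then have "N x \<le> N x / (1 + \<epsilon>)" unfolding nj[symmetric] by (intro norm_bound) (simp add: nj)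
      moreover have "N x / (1 + \<epsilon>) < N x"
        using is_norm_pos[OF N \<open>x \<noteq> 0\<close>] \<epsilon> by (subst pos_divide_less_eq) (auto simp: distrib_left)
      ultimately show False by simp
    qed
  qed
  ultimately obtain K where K: "finite K" "sphere 0 1 \<subseteq> (\<Union>k\<in>K. U k)"
    using compactE_image[OF compact_sphere, of UNIV U] by (metis UNIV_I)
  \<comment> \<open>at least one coordinate is kept, so that \<open>\<mu>\<close> in the conclusion is nonnegative\<close>
  define m where "m = Suc (Max (insert 0 K))"
  show thesis
  proof (rule that[of m])
    show "0 < m" by (simp add: m_def)
    fix x \<mu>
    assume \<mu>: "\<And>k. k < m \<Longrightarrow> \<bar>apply_bcontfun (j x) k\<bar> \<le> \<mu>"
    have "0 \<le> \<mu>" using \<mu>[of 0] by (simp add: m_def)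
    show "N x \<le> (1 + \<epsilon>) * \<mu>"
    proof (cases "x = 0")
      case True
      then show ?thesis using is_norm_eq_0_iff[OF N, of 0] \<open>0 \<le> \<mu>\<close> \<epsilon> by simp
    next
      case False
      then have "sgn x \<in> sphere 0 1" by (simp add: norm_sgn)
      then obtain k where k: "k \<in> K" "sgn x \<in> U k" using K by blast
      have "k < m" using K(1) k(1) by (simp add: m_def less_Suc_eq_le)
      have "N x = norm x * N (sgn x)"
        using is_norm_scale[OF N, of "norm x" "sgn x"] False by (simp add: sgn_div_norm)
      also have "\<dots> \<le> norm x * ((1 + \<epsilon>) * \<bar>apply_bcontfun (j (sgn x)) k\<bar>)"
        using k(2) by (intro mult_left_mono) (auto simp: U_def)
      also have "\<dots> = (1 + \<epsilon>) * \<bar>apply_bcontfun (j x) k\<bar>"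
        using False by (simp add: sgn_div_norm linear_scale[OF lin] abs_mult field_simps)
      also have "\<dots> \<le> (1 + \<epsilon>) * \<mu>" using \<mu>[OF \<open>k < m\<close>] \<epsilon> by simp
      finally show ?thesis .
    qed
  qed
qed

text \<open>
  The dual ball of radius \<open>\<beta>\<close> for \<open>max \<bar>y i \<bullet> x\<bar>\<close> is the convex hull of the vectors \<open>\<beta> *\<^sub>R y i\<close> and their negatives:
  a functional outside the hull could be separated from it.
\<close>

lemma dual_representation:
  fixes y :: "nat \<Rightarrow> 'a::euclidean_space"
  assumes d: "0 < d" and \<beta>: "0 \<le> \<beta>"
    and dom: "\<And>x \<mu>. (\<And>i. i < d \<Longrightarrow> \<bar>y i \<bullet> x\<bar> \<le> \<mu>) \<Longrightarrow> g \<bullet> x \<le> \<beta> * \<mu>"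
  shows "\<exists>a. g = (\<Sum>i<d. a i *\<^sub>R y i) \<and> (\<Sum>i<d. \<bar>a i\<bar>) \<le> \<beta>"
proof -
  define V where "V = (\<lambda>i. \<beta> *\<^sub>R y i) ` {..<d} \<union> (\<lambda>i. - (\<beta> *\<^sub>R y i)) ` {..<d}"
  define H where "H = {h. \<exists>a. h = (\<Sum>i<d. a i *\<^sub>R y i) \<and> (\<Sum>i<d. \<bar>a i\<bar>) \<le> \<beta>}"
  have "finite V" by (simp add: V_def)
  have "V \<subseteq> H"
  proof
    fix v assume "v \<in> V"
    then obtain i s where vi: "i < d" "v = (s * \<beta>) *\<^sub>R y i" "\<bar>s\<bar> = 1"
      unfolding V_def by (elim UnE imageE) (force intro: that[of _ 1] that[of _ "-1"])+
    define a where "a k = (if k = i then s * \<beta> else 0)" for k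
    have "(\<Sum>k<d. a k *\<^sub>R y k) = (\<Sum>k<d. if k = i then (s * \<beta>) *\<^sub>R y i else 0)"
      unfolding a_def by (intro sum.cong refl) auto
    moreover have "(\<Sum>k<d. \<bar>a k\<bar>) = (\<Sum>k<d. if k = i then \<beta> else 0)"
      unfolding a_def by (intro sum.cong refl) (use vi \<beta> in \<open>auto simp: abs_mult\<close>)
    ultimately show "v \<in> H" using vi by (auto simp: H_def intro!: exI[of _ a])
  qed
  moreover have "convex H"
  proof (rule convexI)
    fix h h' and p q :: real
    assume *: "h \<in> H" "h' \<in> H" "0 \<le> p" "0 \<le> q" "p + q = 1"
    then obtain a a' where a: "h = (\<Sum>i<d. a i *\<^sub>R y i)" "(\<Sum>i<d. \<bar>a i\<bar>) \<le> \<beta>"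
      and a': "h' = (\<Sum>i<d. a' i *\<^sub>R y i)" "(\<Sum>i<d. \<bar>a' i\<bar>) \<le> \<beta>"
      unfolding H_def by blast
    have "p *\<^sub>R h + q *\<^sub>R h' = (\<Sum>i<d. (p * a i + q * a' i) *\<^sub>R y i)"
      by (simp add: a a' scaleR_sum_right sum.distrib scaleR_add_left)
    moreover have "(\<Sum>i<d. \<bar>p * a i + q * a' i\<bar>) \<le> (\<Sum>i<d. p * \<bar>a i\<bar> + q * \<bar>a' i\<bar>)"
    proof (intro sum_mono)
      show "\<bar>p * a i + q * a' i\<bar> \<le> p * \<bar>a i\<bar> + q * \<bar>a' i\<bar>" for i
        using abs_triangle_ineq[of "p * a i" "q * a' i"] * by (simp add: abs_mult)
    qed
    moreover have "\<dots> = p * (\<Sum>i<d. \<bar>a i\<bar>) + q * (\<Sum>i<d. \<bar>a' i\<bar>)"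
      by (simp add: sum.distrib sum_distrib_left)
    moreover have "\<dots> \<le> \<beta>" by (rule convex_bound_le) (use * a a' in auto)
    ultimately show "p *\<^sub>R h + q *\<^sub>R h' \<in> H" unfolding H_def by force
  qed
  ultimately have hull: "convex hull V \<subseteq> H" by (rule hull_minimal)
  have "g \<in> convex hull V"
  proof (rule ccontr)
    assume "g \<notin> convex hull V"
    moreover have "closed (convex hull V)"
      using \<open>finite V\<close> by (intro compact_imp_closed finite_imp_compact_convex_hull)
    ultimately obtain a b where ab: "a \<bullet> g < b" "\<And>x. x \<in> convex hull V \<Longrightarrow> b < a \<bullet> x"
      using separating_hyperplane_closed_point[OF convex_convex_hull] by metis
    define \<mu> where "\<mu> = Max ((\<lambda>i. \<bar>y i \<bullet> a\<bar>) ` {..<d})"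
    have \<mu>: "\<bar>y i \<bullet> a\<bar> \<le> \<mu>" if "i < d" for i using that by (auto simp: \<mu>_def)
    have "\<mu> \<in> (\<lambda>i. \<bar>y i \<bullet> a\<bar>) ` {..<d}"
      unfolding \<mu>_def by (rule Max_in) (use d in auto)
    then obtain i where i: "i < d" "\<mu> = \<bar>y i \<bullet> a\<bar>" by auto
    have "\<beta> *\<^sub>R y i \<in> convex hull V" "- (\<beta> *\<^sub>R y i) \<in> convex hull V"
      using i by (auto simp: V_def intro!: hull_inc)
    from ab(2)[OF this(1)] ab(2)[OF this(2)] have "\<beta> * \<mu> < - b"
      using \<beta> by (auto simp: i inner_commute abs_if)
    moreover have "g \<bullet> (- a) \<le> \<beta> * \<mu>" by (rule dom) (simp add: \<mu>)
    ultimately show False using ab(1) by (simp add: inner_commute)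
  qed
  then show ?thesis using hull by (auto simp: H_def)
qed

lemma coordinate_functional:
  fixes j :: "'a::euclidean_space \<Rightarrow> linf"
  assumes lin: "linear j"
  obtains g where "\<And>x. apply_bcontfun (j x) k = g \<bullet> x"
proof (rule that)
  fix x
  have "j x = (\<Sum>b\<in>Basis. (x \<bullet> b) *\<^sub>R j b)"
    using arg_cong[OF euclidean_representation[of x], of j]
    by (simp add: linear_sum[OF lin] linear_scale[OF lin])
  then show "apply_bcontfun (j x) k = (\<Sum>b\<in>Basis. apply_bcontfun (j b) k *\<^sub>R b) \<bullet> x"
    by (simp add: apply_bcontfun_sum inner_sum_left) (simp add: inner_commute mult.commute)
qed

definition projection_onto :: "'a::real_normed_vector set \<Rightarrow> ('a \<Rightarrow> 'a) \<Rightarrow> bool" where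
  "projection_onto E P \<longleftrightarrow> bounded_linear P \<and> range P = E \<and> (\<forall>x\<in>E. P x = x)"

lemma rel_proj_const_le:
  assumes "projection_onto E P"
  shows "rel_proj_const E \<le> onorm P"
  unfolding rel_proj_const_def
  by (rule cInf_lower) (use assms in \<open>auto simp: projection_onto_def intro!: bdd_belowI[of _ 0] onorm_pos_le\<close>)

lemma rel_proj_const_ge:
  assumes "projection_onto E P0" and "\<And>P. projection_onto E P \<Longrightarrow> c \<le> onorm P"
  shows "c \<le> rel_proj_const E"
  unfolding rel_proj_const_def
  by (rule cInf_greatest) (use assms in \<open>auto simp: projection_onto_def\<close>)

lemma projection_from_left_inverse:
  fixes N :: "'a::euclidean_space \<Rightarrow> real"
  assumes N: "is_norm N" and j: "isometric_embedding N j"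
    and inverse: "\<And>x. (\<Sum>k<m. apply_bcontfun (j x) k *\<^sub>R z k) = x"
    and bound: "\<And>v. (\<And>k. k < m \<Longrightarrow> \<bar>v k\<bar> \<le> 1) \<Longrightarrow> N (\<Sum>k<m. v k *\<^sub>R z k) \<le> C"
  shows "\<exists>P. projection_onto (range j) P \<and> onorm P \<le> C"
proof -
  have lin: "linear j" and nj: "\<And>x. norm (j x) = N x"
    using j by (auto simp: isometric_embedding_def)
  define L where "L v = (\<Sum>k<m. apply_bcontfun v k *\<^sub>R z k)" for v :: linf
  define P where "P v = j (L v)" for v
  have "C \<ge> 0" using order_trans[OF is_norm_nonneg[OF N] bound[of "\<lambda>_. 0"]] by simp
  have nP: "norm (P v) \<le> C * norm v" for v
  proof (cases "v = 0")
    case False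
    have "N (\<Sum>k<m. (apply_bcontfun v k / norm v) *\<^sub>R z k) \<le> C"
      by (rule bound) (use False norm_bounded[of v] in \<open>auto simp: divide_le_eq\<close>)
    also have "(\<Sum>k<m. (apply_bcontfun v k / norm v) *\<^sub>R z k) = (1 / norm v) *\<^sub>R L v"
      by (simp add: L_def scaleR_sum_right)
    finally show ?thesis using False by (simp add: P_def nj is_norm_scale[OF N] divide_le_eq)
  qed (simp add: P_def L_def linear_0[OF lin])
  have "linear L" by (intro linearI) (simp_all add: L_def scaleR_add_left sum.distrib scaleR_sum_right)
  then have "linear P"
    unfolding P_def using linear_compose[OF _ lin] by (simp add: o_def)
  then have "bounded_linear P"
    by (intro bounded_linear_intro[of P C]) (auto simp: linear_add linear_scale nP mult.commute)
  moreover have Lj: "L (j x) = x" for x by (simp add: L_def inverse)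
  then have "range P = range j"
    by (auto simp: P_def) (metis rangeI)
  moreover have "\<forall>v\<in>range j. P v = v" by (auto simp: P_def Lj)
  ultimately have "projection_onto (range j) P" by (simp add: projection_onto_def)
  moreover have "onorm P \<le> C" using \<open>C \<ge> 0\<close> nP by (rule onorm_bound)
  ultimately show ?thesis by blast
qed

section \<open>Bounds for the projection constant\<close>

text \<open>
  A left inverse of finitely many almost norming coordinates, with row sums at most \<open>\<phi> + \<epsilon>\<close>, defines the
  projection.
\<close>

lemma exists_small_projection:
  fixes N :: "'a::euclidean_space \<Rightarrow> real"
  assumes N: "is_norm N" and j: "isometric_embedding N j" and \<epsilon>: "0 < \<epsilon>"
  shows "\<exists>P. projection_onto (range j) P \<and> onorm P \<le> (1 + \<epsilon>) * (max_frame_value TYPE('a) + \<epsilon>)"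
proof -
  let ?\<phi> = "max_frame_value TYPE('a)"
  have lin: "linear j" and nj: "\<And>x. norm (j x) = N x"
    using j by (auto simp: isometric_embedding_def)
  obtain m where m: "0 < m" and
    coords: "\<And>x \<mu>. (\<And>k. k < m \<Longrightarrow> \<bar>apply_bcontfun (j x) k\<bar> \<le> \<mu>) \<Longrightarrow> N x \<le> (1 + \<epsilon>) * \<mu>"
    using finitely_many_coordinates_almost_norming[OF N j \<epsilon>] by blast
  have "\<exists>g. \<forall>x. apply_bcontfun (j x) k = g \<bullet> x" for k
    using coordinate_functional[OF lin] by metis
  then obtain y where jk: "\<And>x k. apply_bcontfun (j x) k = y k \<bullet> x" by metis
  have span: "x = 0" if "\<forall>k<m. y k \<bullet> x = 0" for x
  proof -
    have "N x \<le> (1 + \<epsilon>) * 0" by (rule coords) (use that in \<open>simp add: jk\<close>)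
    then show ?thesis using is_norm_pos[OF N, of x] by force
  qed
  obtain z where zinv: "\<And>x. (\<Sum>k<m. (y k \<bullet> x) *\<^sub>R z k) = x"
    and zle: "\<And>i. i < m \<Longrightarrow> (\<Sum>k<m. \<bar>y i \<bullet> z k\<bar>) \<le> ?\<phi> + \<epsilon>"
    using small_left_inverse[where m = m and y = y and c = "?\<phi> + \<epsilon>", OF span] \<epsilon> by auto
  show ?thesis
  proof (rule projection_from_left_inverse[OF N j])
    show "(\<Sum>k<m. apply_bcontfun (j x) k *\<^sub>R z k) = x" for x by (simp add: jk zinv)
    fix v :: "nat \<Rightarrow> real" assume v: "\<And>k. k < m \<Longrightarrow> \<bar>v k\<bar> \<le> 1"
    show "N (\<Sum>k<m. v k *\<^sub>R z k) \<le> (1 + \<epsilon>) * (?\<phi> + \<epsilon>)"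
    proof (rule coords)
      fix i assume i: "i < m"
      have "\<bar>apply_bcontfun (j (\<Sum>k<m. v k *\<^sub>R z k)) i\<bar> = \<bar>\<Sum>k<m. v k * (y i \<bullet> z k)\<bar>"
        by (simp add: jk inner_sum_right)
      also have "\<dots> \<le> (\<Sum>k<m. \<bar>v k * (y i \<bullet> z k)\<bar>)" by (rule sum_abs)
      also have "\<dots> \<le> (\<Sum>k<m. 1 * \<bar>y i \<bullet> z k\<bar>)"
        unfolding abs_mult by (intro sum_mono mult_right_mono) (use v in auto)
      also have "\<dots> \<le> ?\<phi> + \<epsilon>" using zle[OF i] by simp
      finally show "\<bar>apply_bcontfun (j (\<Sum>k<m. v k *\<^sub>R z k)) i\<bar> \<le> ?\<phi> + \<epsilon>" .
    qed
  qed
qed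

lemma proj_const_le_max_frame_value:
  fixes N :: "'a::euclidean_space \<Rightarrow> real"
  assumes N: "is_norm N"
  shows "proj_const N \<le> max_frame_value TYPE('a)"
proof (rule tendsto_lowerbound)
  let ?\<phi> = "max_frame_value TYPE('a)"
  obtain j where j: "isometric_embedding N j" and pc: "proj_const N = rel_proj_const (range j)"
    using proj_const_eq_rel_proj_const[OF N] .
  show "((\<lambda>\<epsilon>. (1 + \<epsilon>) * (?\<phi> + \<epsilon>)) \<longlongrightarrow> ?\<phi>) (at_right 0)"
    by (auto intro!: tendsto_eq_intros)
  show "\<forall>\<^sub>F \<epsilon> in at_right 0. proj_const N \<le> (1 + \<epsilon>) * (?\<phi> + \<epsilon>)"
    using eventually_at_right_less
  proof (rule eventually_mono)
    fix \<epsilon> :: real assume "0 < \<epsilon>"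
    from exists_small_projection[OF N j this]
    show "proj_const N \<le> (1 + \<epsilon>) * (?\<phi> + \<epsilon>)"
      unfolding pc using rel_proj_const_le order_trans by blast
  qed
qed simp

lemma abs_linear_combination_le:
  fixes a v :: "nat \<Rightarrow> real"
  assumes "(\<Sum>i<d. \<bar>a i\<bar>) \<le> b" "\<And>i. i < d \<Longrightarrow> \<bar>v i\<bar> \<le> c" "0 \<le> c"
  shows "\<bar>\<Sum>i<d. a i * v i\<bar> \<le> b * c"
proof -
  have "\<bar>\<Sum>i<d. a i * v i\<bar> \<le> (\<Sum>i<d. \<bar>a i * v i\<bar>)" by (rule sum_abs)
  also have "\<dots> \<le> (\<Sum>i<d. \<bar>a i\<bar> * c)"
    unfolding abs_mult by (intro sum_mono mult_left_mono) (use assms in auto)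
  also have "\<dots> \<le> b * c"
    unfolding sum_distrib_right[symmetric] by (intro mult_right_mono assms)
  finally show ?thesis .
qed

text \<open>
  The coordinates of an isometric embedding are combinations of the \<open>y i\<close> with absolute coefficient sum at most
  \<open>\<beta>\<close>, so the map sending the unit tuple \<open>i\<close> to \<open>E i\<close> extends the embedding to \<open>d\<close>-tuples with norm at most \<open>\<beta>\<close>. A projection then
  yields a left inverse \<open>z\<close>, and the certificate in \<open>near_extremal\<close> bounds its norm from below.
\<close>

lemma proj_const_ge:
  fixes N :: "'a::euclidean_space \<Rightarrow> real"
  assumes N: "is_norm N" and ext: "near_extremal \<epsilon> d w y v S" and \<alpha>: "0 < \<alpha>" and \<beta>: "0 < \<beta>"
    and lower: "\<And>i x. i < d \<Longrightarrow> \<alpha> * \<bar>y i \<bullet> x\<bar> \<le> N x"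
    and upper: "\<And>x \<mu>. (\<And>i. i < d \<Longrightarrow> \<bar>y i \<bullet> x\<bar> \<le> \<mu>) \<Longrightarrow> N x \<le> \<beta> * \<mu>"
  shows "max_frame_value TYPE('a) - \<epsilon> \<le> (\<beta> / \<alpha>) * proj_const N"
proof -
  let ?\<phi> = "max_frame_value TYPE('a)"
  have w: "\<And>i. i < d \<Longrightarrow> 0 < w i" "(\<Sum>i<d. w i) = 1" and S: "\<And>i j. \<bar>S i j\<bar> \<le> 1"
    and dual: "\<And>z. (\<And>x. (\<Sum>j<d. (y j \<bullet> x) *\<^sub>R z j) = x) \<Longrightarrow>
        ?\<phi> - \<epsilon> \<le> (\<Sum>i<d. \<Sum>j<d. w i * S i j * (y i \<bullet> z j))"
    using ext unfolding near_extremal_def by blast+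
  have "0 < d" using w(2) by (cases d) auto
  obtain j where j: "isometric_embedding N j" and pc: "proj_const N = rel_proj_const (range j)"
    using proj_const_eq_rel_proj_const[OF N] .
  have lin: "linear j" and nj: "\<And>x. norm (j x) = N x"
    using j by (auto simp: isometric_embedding_def)
  have "\<exists>a. (\<forall>x. apply_bcontfun (j x) k = (\<Sum>i<d. a i * (y i \<bullet> x))) \<and> (\<Sum>i<d. \<bar>a i\<bar>) \<le> \<beta>" for k
  proof -
    obtain g where g: "\<And>x. apply_bcontfun (j x) k = g \<bullet> x"
      using coordinate_functional[OF lin] by blast
    have "g \<bullet> x \<le> \<beta> * \<mu>" if "\<And>i. i < d \<Longrightarrow> \<bar>y i \<bullet> x\<bar> \<le> \<mu>" for x \<mu>
      using norm_bounded[of "j x" k] upper[OF that] by (simp add: g nj)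
    from dual_representation[OF \<open>0 < d\<close> less_imp_le[OF \<beta>] this]
    obtain a where "g = (\<Sum>i<d. a i *\<^sub>R y i)" "(\<Sum>i<d. \<bar>a i\<bar>) \<le> \<beta>" by blast
    then show ?thesis by (intro exI[of _ a]) (simp add: g inner_sum_left)
  qed
  then obtain a where a: "\<And>k x. apply_bcontfun (j x) k = (\<Sum>i<d. a k i * (y i \<bullet> x))"
    and a_le: "\<And>k. (\<Sum>i<d. \<bar>a k i\<bar>) \<le> \<beta>" by metis
  define E where "E i = Bcontfun (\<lambda>k. a k i)" for i
  have Ek: "apply_bcontfun (E i) k = a k i" if "i < d" for i k
    unfolding E_def
  proof (subst apply_Bcontfun_seq)
    show "\<bar>a k i\<bar> \<le> \<beta>" for k
      using member_le_sum[of i "{..<d}" "\<lambda>i. \<bar>a k i\<bar>"] a_le[of k] that by simp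
  qed simp
  have jE: "j x = (\<Sum>i<d. (y i \<bullet> x) *\<^sub>R E i)" for x
    by (rule bcontfun_eqI) (simp add: a apply_bcontfun_sum Ek mult.commute)
  have "(\<alpha> / \<beta>) * (?\<phi> - \<epsilon>) \<le> onorm P"
    if "projection_onto (range j) P" for P
  proof -
    have P: "bounded_linear P" "range P = range j" "\<forall>x\<in>range j. P x = x"
      using that by (auto simp: projection_onto_def)
    have linP: "linear P" using P(1) by (rule bounded_linear.linear)
    have "\<exists>z. P (E i) = j z" for i using P(2) by blast
    then obtain z where z: "\<And>i. P (E i) = j (z i)" by metis
    have "inj j"
      unfolding linear_injective_0[OF lin] using nj is_norm_eq_0_iff[OF N] by (metis norm_zero)
    have zinv: "(\<Sum>i<d. (y i \<bullet> x) *\<^sub>R z i) = x" for x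
    proof -
      have "j (\<Sum>i<d. (y i \<bullet> x) *\<^sub>R z i) = P (j x)"
        by (simp add: jE[of x] linear_sum[OF lin] linear_scale[OF lin] linear_sum[OF linP]
            linear_scale[OF linP] z)
      also have "\<dots> = j x" using P(3) by blast
      finally show ?thesis using \<open>inj j\<close> by (simp add: inj_eq)
    qed
    have row: "(\<Sum>k<d. S i k * (y i \<bullet> z k)) \<le> onorm P * \<beta> / \<alpha>" if i: "i < d" for i
    proof -
      let ?s = "\<Sum>k<d. S i k *\<^sub>R z k" and ?e = "\<Sum>k<d. S i k *\<^sub>R E k"
      have "norm ?e \<le> \<beta> * 1"
      proof (rule norm_bound)
        fix k
        have "apply_bcontfun ?e k = (\<Sum>l<d. a k l * S i l)"
          by (simp add: apply_bcontfun_sum Ek mult.commute)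
        then show "norm (apply_bcontfun ?e k) \<le> \<beta> * 1"
          using abs_linear_combination_le[where d = d and a = "a k" and b = \<beta> and v = "S i" and c = 1] a_le S by simp
      qed
      have "\<alpha> * (\<Sum>k<d. S i k * (y i \<bullet> z k)) \<le> \<alpha> * \<bar>y i \<bullet> ?s\<bar>"
        using \<alpha> by (intro mult_left_mono) (auto simp: inner_sum_right)
      also have "\<dots> \<le> N ?s" by (rule lower[OF i])
      also have "\<dots> = norm (P ?e)"
        by (simp add: nj[symmetric] linear_sum[OF lin] linear_scale[OF lin] linear_sum[OF linP]
            linear_scale[OF linP] z)
      also have "\<dots> \<le> onorm P * norm ?e" by (rule onorm[OF P(1)])
      also have "\<dots> \<le> onorm P * \<beta>"
        using \<open>norm ?e \<le> \<beta> * 1\<close> onorm_pos_le[OF P(1)] by (intro mult_left_mono) auto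
      finally show ?thesis using \<alpha> by (simp add: field_simps)
    qed
    have "?\<phi> - \<epsilon> \<le> (\<Sum>i<d. \<Sum>k<d. w i * S i k * (y i \<bullet> z k))" by (rule dual[OF zinv])
    also have "\<dots> = (\<Sum>i<d. w i * (\<Sum>k<d. S i k * (y i \<bullet> z k)))"
      by (simp add: sum_distrib_left mult.assoc)
    also have "\<dots> \<le> (\<Sum>i<d. w i * (onorm P * \<beta> / \<alpha>))"
      by (intro sum_mono mult_left_mono) (use row w(1) in \<open>auto intro: less_imp_le\<close>)
    also have "\<dots> = onorm P * \<beta> / \<alpha>" by (simp only: sum_distrib_right[symmetric] w(2))
    finally show ?thesis using \<alpha> \<beta> by (simp add: field_simps)
  qed
  then have "(\<alpha> / \<beta>) * (?\<phi> - \<epsilon>) \<le> rel_proj_const (range j)"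
    using rel_proj_const_ge exists_small_projection[OF N j zero_less_one] by blast
  then show ?thesis using \<alpha> \<beta> by (simp add: pc field_simps)
qed

section \<open>Factorizations through finite-dimensional sup-norm spaces\<close>

lemma is_norm_norm: "is_norm (norm :: 'a::real_normed_vector \<Rightarrow> real)"
  by (simp add: is_norm_def norm_triangle_ineq)

lemma
  assumes M: "is_norm M" and N: "is_norm N" and V: "subspace V" and f: "linear_on_subspace V f"
    and bdd: "\<And>x. x \<in> V \<Longrightarrow> N x \<le> 1 \<Longrightarrow> M (f x) \<le> K"
  shows op_norm_bound: "x \<in> V \<Longrightarrow> M (f x) \<le> op_norm V N M f * N x"
    and op_norm_nonneg: "0 \<le> op_norm V N M f"
proof -
  have up: "M (f x) \<le> op_norm V N M f" if "x \<in> V" "N x \<le> 1" for x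
    unfolding op_norm_def
    by (rule cSUP_upper) (use that bdd in \<open>auto intro!: bdd_aboveI[of _ K]\<close>)
  have scale: "f (c *\<^sub>R x) = c *\<^sub>R f x" if "x \<in> V" for c x
    using f that by (simp add: linear_on_subspace_def)
  have "f 0 = 0" using scale[of 0 0] subspace_0[OF V] by simp
  have z: "M 0 = 0" "N 0 = 0" using is_norm_eq_0_iff[OF M, of 0] is_norm_eq_0_iff[OF N, of 0] by auto
  show "0 \<le> op_norm V N M f"
    using up[of 0] subspace_0[OF V] \<open>f 0 = 0\<close> z by simp
  show "M (f x) \<le> op_norm V N M f * N x" if x: "x \<in> V"
  proof (cases "x = 0")
    case False
    then have "0 < N x" by (rule is_norm_pos[OF N])
    have "M (f ((1 / N x) *\<^sub>R x)) \<le> op_norm V N M f"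
      by (rule up) (use x \<open>0 < N x\<close> in \<open>simp_all add: subspace_scale[OF V] is_norm_scale[OF N]\<close>)
    then show ?thesis
      using \<open>0 < N x\<close> by (simp add: scale[OF x] is_norm_scale[OF M] divide_le_eq)
  qed (simp add: \<open>f 0 = 0\<close> z)
qed

lemma subspace_linf_d: "subspace (linf_d d)"
  by (simp add: subspace_def linf_d_def)

lemma linear_on_subspace_sum:
  assumes V: "subspace V" and f: "linear_on_subspace V f" and e: "\<And>i. i < (d::nat) \<Longrightarrow> e i \<in> V"
  shows "f (\<Sum>i<d. c i *\<^sub>R e i) = (\<Sum>i<d. c i *\<^sub>R f (e i))"
  using e
proof (induction d)
  case 0
  have "f (0 *\<^sub>R 0) = 0 *\<^sub>R f 0"
    using f subspace_0[OF V] unfolding linear_on_subspace_def by blast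
  then show ?case by simp
next
  case (Suc d)
  have "(\<Sum>i<d. c i *\<^sub>R e i) \<in> V" "c d *\<^sub>R e d \<in> V"
    using Suc.prems by (auto intro!: subspace_sum[OF V] subspace_scale[OF V])
  then show ?case
    using Suc f by (simp add: linear_on_subspace_def)
qed

definition unit_seq :: "nat \<Rightarrow> linf" where
  "unit_seq i = Bcontfun (\<lambda>k. if k = i then 1 else 0)"

lemma apply_unit_seq [simp]: "apply_bcontfun (unit_seq i) k = (if k = i then 1 else 0)"
  unfolding unit_seq_def by (subst apply_Bcontfun_seq[of _ 1]) auto

lemma unit_seq_in_linf_d: "i < d \<Longrightarrow> unit_seq i \<in> linf_d d"
  by (simp add: linf_d_def)

lemma apply_unit_seq_sum:
  "apply_bcontfun (\<Sum>i<d. c i *\<^sub>R unit_seq i) k = (if k < d then c k else 0)"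
  by (simp add: apply_bcontfun_sum if_distrib[of "\<lambda>x. _ * x"] cong: if_cong)

lemma linf_d_expansion: "v \<in> linf_d d \<Longrightarrow> v = (\<Sum>i<d. apply_bcontfun v i *\<^sub>R unit_seq i)"
  by (rule bcontfun_eqI) (auto simp: apply_unit_seq_sum linf_d_def)

text \<open>
  The form in which \<open>\<epsilon> \<rightarrow> 0\<close> is used: distortions contribute powers of \<open>1 + e\<close>, the other errors are linear in
  \<open>e\<close>.
\<close>

lemma le_if_le_near_one:
  fixes a b c :: real
  assumes "\<And>e. 0 < e \<Longrightarrow> a \<le> (1 + e) ^ k * (b + c * e)"
  shows "a \<le> b"
proof (rule tendsto_lowerbound)
  show "((\<lambda>e. (1 + e) ^ k * (b + c * e)) \<longlongrightarrow> b) (at_right 0)"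
    by (auto intro!: tendsto_eq_intros)
  show "\<forall>\<^sub>F e in at_right 0. a \<le> (1 + e) ^ k * (b + c * e)"
    using eventually_at_right_less by (rule eventually_mono) (rule assms)
qed simp

text \<open>
  Extend the coordinates of \<open>T1\<close> from the embedded space to bounded sequences, using finitely many almost
  norming coordinates and losing a factor \<open>1 + \<epsilon>\<close>; composed with \<open>T2\<close> and the embedding this is a projection.
\<close>

lemma proj_const_le_factorization:
  fixes N :: "'a::euclidean_space \<Rightarrow> real"
  assumes N: "is_norm N"
    and T1: "linear T1" "range T1 \<subseteq> linf_d d" and T2: "linear_on_subspace (linf_d d) T2"
    and inv: "\<And>x. T2 (T1 x) = x"
  shows "proj_const N \<le> op_norm (linf_d d) norm N T2 * op_norm UNIV N norm T1"
proof -
  define \<tau>1 where "\<tau>1 = op_norm UNIV N norm T1"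
  define \<tau>2 where "\<tau>2 = op_norm (linf_d d) norm N T2"
  obtain c where c: "0 < c" "\<And>x. c * norm x \<le> N x" using is_norm_lower[OF N] by blast
  obtain K where K: "0 < K" "\<And>x. norm (T1 x) \<le> norm x * K"
    using bounded_linear.pos_bounded[of T1] T1(1) by (auto simp: linear_conv_bounded_linear)
  have bdd1: "norm (T1 x) \<le> K / c" if "N x \<le> 1" for x
  proof -
    have "norm x \<le> 1 / c" using c(1) c(2)[of x] that by (simp add: field_simps)
    then have "norm x * K \<le> 1 / c * K" using K(1) by (intro mult_right_mono) auto
    with K(2)[of x] show ?thesis by simp
  qed
  have lin1: "linear_on_subspace UNIV T1"
    using T1(1) by (simp add: linear_on_subspace_def linear_add linear_scale)
  have \<tau>1: "norm (T1 x) \<le> \<tau>1 * N x" "0 \<le> \<tau>1" for x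
    unfolding \<tau>1_def
    using op_norm_bound[OF is_norm_norm N subspace_UNIV lin1 bdd1]
      op_norm_nonneg[OF is_norm_norm N subspace_UNIV lin1 bdd1] by auto
  have T2_sum: "T2 (\<Sum>i<d. b i *\<^sub>R unit_seq i) = (\<Sum>i<d. b i *\<^sub>R T2 (unit_seq i))" for b
    by (rule linear_on_subspace_sum[OF subspace_linf_d T2 unit_seq_in_linf_d])
  have bdd2: "N (T2 v) \<le> (\<Sum>i<d. N (T2 (unit_seq i)))" if v: "v \<in> linf_d d" "norm v \<le> 1" for v
  proof -
    have "N (T2 v) = N (\<Sum>i<d. apply_bcontfun v i *\<^sub>R T2 (unit_seq i))"
      using linf_d_expansion[OF v(1)] T2_sum by metis
    also have "\<dots> \<le> (\<Sum>i<d. N (apply_bcontfun v i *\<^sub>R T2 (unit_seq i)))"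
      by (rule is_norm_sum[OF N])
    also have "\<dots> \<le> (\<Sum>i<d. 1 * N (T2 (unit_seq i)))"
      unfolding is_norm_scale[OF N]
    proof (intro sum_mono mult_right_mono is_norm_nonneg[OF N])
      show "\<bar>apply_bcontfun v i\<bar> \<le> 1" for i using norm_bounded[of v i] v(2) by simp
    qed
    finally show ?thesis by simp
  qed
  have \<tau>2: "N (T2 v) \<le> \<tau>2 * norm v" if "v \<in> linf_d d" for v
    unfolding \<tau>2_def by (rule op_norm_bound[OF N is_norm_norm subspace_linf_d T2 bdd2 that])
  have \<tau>2_nonneg: "0 \<le> \<tau>2"
    unfolding \<tau>2_def by (rule op_norm_nonneg[OF N is_norm_norm subspace_linf_d T2 bdd2])
  obtain j where j: "isometric_embedding N j" and pc: "proj_const N = rel_proj_const (range j)"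
    using proj_const_eq_rel_proj_const[OF N] .
  have lin: "linear j" and nj: "\<And>x. norm (j x) = N x"
    using j by (auto simp: isometric_embedding_def)
  have "proj_const N \<le> (1 + \<epsilon>) ^ 1 * (\<tau>2 * \<tau>1 + 0 * \<epsilon>)" if \<epsilon>: "0 < \<epsilon>" for \<epsilon>
  proof -
    obtain m where m: "0 < m" and
      coords: "\<And>x \<mu>. (\<And>k. k < m \<Longrightarrow> \<bar>apply_bcontfun (j x) k\<bar> \<le> \<mu>) \<Longrightarrow> N x \<le> (1 + \<epsilon>) * \<mu>"
      using finitely_many_coordinates_almost_norming[OF N j \<epsilon>] by blast
    have "\<exists>g. \<forall>x. apply_bcontfun (j x) k = g \<bullet> x" for k
      using coordinate_functional[OF lin] by metis
    then obtain y where jk: "\<And>x k. apply_bcontfun (j x) k = y k \<bullet> x" by metis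
    have "\<exists>a. (\<forall>x. apply_bcontfun (T1 x) i = (\<Sum>k<m. a k * (y k \<bullet> x))) \<and>
        (\<Sum>k<m. \<bar>a k\<bar>) \<le> \<tau>1 * (1 + \<epsilon>)" for i
    proof -
      obtain g where g: "\<And>x. apply_bcontfun (T1 x) i = g \<bullet> x"
        using coordinate_functional[OF T1(1)] by blast
      have "g \<bullet> x \<le> \<tau>1 * (1 + \<epsilon>) * \<mu>" if "\<And>k. k < m \<Longrightarrow> \<bar>y k \<bullet> x\<bar> \<le> \<mu>" for x \<mu>
      proof -
        have "g \<bullet> x \<le> norm (T1 x)" using norm_bounded[of "T1 x" i] by (simp add: g)
        also have "\<dots> \<le> \<tau>1 * N x" by (rule \<tau>1)
        also have "\<dots> \<le> \<tau>1 * ((1 + \<epsilon>) * \<mu>)"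
          by (intro mult_left_mono \<tau>1 coords) (simp add: jk that)
        finally show ?thesis by (simp add: mult.assoc)
      qed
      from dual_representation[OF m _ this]
      obtain a where "g = (\<Sum>k<m. a k *\<^sub>R y k)" "(\<Sum>k<m. \<bar>a k\<bar>) \<le> \<tau>1 * (1 + \<epsilon>)"
        using \<tau>1 \<epsilon> by auto
      then show ?thesis by (intro exI[of _ a]) (simp add: g inner_sum_left)
    qed
    then obtain a where a: "\<And>i x. apply_bcontfun (T1 x) i = (\<Sum>k<m. a i k * (y k \<bullet> x))"
      and a_le: "\<And>i. (\<Sum>k<m. \<bar>a i k\<bar>) \<le> \<tau>1 * (1 + \<epsilon>)" by metis
    define z where "z k = (\<Sum>i<d. a i k *\<^sub>R T2 (unit_seq i))" for k
    have z_sum: "(\<Sum>k<m. v k *\<^sub>R z k) = T2 (\<Sum>i<d. (\<Sum>k<m. a i k * v k) *\<^sub>R unit_seq i)" for v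
    proof -
      have "(\<Sum>k<m. v k *\<^sub>R z k) = (\<Sum>k<m. \<Sum>i<d. (a i k * v k) *\<^sub>R T2 (unit_seq i))"
        by (simp add: z_def scaleR_sum_right mult.commute)
      also have "\<dots> = (\<Sum>i<d. \<Sum>k<m. (a i k * v k) *\<^sub>R T2 (unit_seq i))" by (rule sum.swap)
      finally show ?thesis unfolding T2_sum by (simp add: scaleR_sum_left)
    qed
    have "\<exists>P. projection_onto (range j) P \<and> onorm P \<le> \<tau>2 * (\<tau>1 * (1 + \<epsilon>))"
    proof (rule projection_from_left_inverse[OF N j])
      fix x
      have "T1 x \<in> linf_d d" using T1(2) by auto
      then show "(\<Sum>k<m. apply_bcontfun (j x) k *\<^sub>R z k) = x"
        unfolding jk z_sum a[symmetric] using linf_d_expansion inv by metis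
    next
      fix v :: "nat \<Rightarrow> real" assume v: "\<And>k. k < m \<Longrightarrow> \<bar>v k\<bar> \<le> 1"
      let ?s = "\<Sum>i<d. (\<Sum>k<m. a i k * v k) *\<^sub>R unit_seq i"
      have "?s \<in> linf_d d"
        by (intro subspace_sum[OF subspace_linf_d] subspace_scale[OF subspace_linf_d] unit_seq_in_linf_d) simp
      then have "N (T2 ?s) \<le> \<tau>2 * norm ?s" by (rule \<tau>2)
      also have "\<dots> \<le> \<tau>2 * (\<tau>1 * (1 + \<epsilon>))"
      proof (intro mult_left_mono norm_bound \<tau>2_nonneg)
        fix i
        show "norm (apply_bcontfun ?s i) \<le> \<tau>1 * (1 + \<epsilon>)"
          using abs_linear_combination_le[OF a_le[of i] v zero_le_one] \<tau>1(2) \<epsilon>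
          by (simp add: apply_unit_seq_sum)
      qed
      finally show "N (\<Sum>k<m. v k *\<^sub>R z k) \<le> \<tau>2 * (\<tau>1 * (1 + \<epsilon>))" by (simp only: z_sum)
    qed
    then obtain P where P: "projection_onto (range j) P" "onorm P \<le> \<tau>2 * (\<tau>1 * (1 + \<epsilon>))" by blast
    show ?thesis
      using rel_proj_const_le[OF P(1)] P(2) by (simp add: pc algebra_simps)
  qed
  then have "proj_const N \<le> \<tau>2 * \<tau>1" by (rule le_if_le_near_one)
  then show ?thesis by (simp add: \<tau>1_def \<tau>2_def)
qed

text \<open>
  Repeating coordinates along this list turns an inner product with integer weights \<open>k i\<close> into the standard
  one.
\<close>

definition repeat_indices :: "nat \<Rightarrow> (nat \<Rightarrow> nat) \<Rightarrow> nat list" where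
  "repeat_indices d k = concat (map (\<lambda>i. replicate (k i) i) [0..<d])"

lemma sum_repeat_indices:
  fixes f :: "nat \<Rightarrow> 'b::real_vector"
  shows "(\<Sum>r<length (repeat_indices d k). f (repeat_indices d k ! r)) = (\<Sum>i<d. real (k i) *\<^sub>R f i)"
proof -
  have "sum_list (map f (replicate n i)) = real n *\<^sub>R f i" for n i
    by (induction n) (simp_all add: scaleR_add_left)
  then have "sum_list (map f (repeat_indices d k)) = (\<Sum>i<d. real (k i) *\<^sub>R f i)"
    unfolding repeat_indices_def by (induction d) (simp_all add: add.commute)
  then show ?thesis by (simp add: sum_list_sum_nth atLeast0LessThan)
qed

lemma repeat_indices_nth_less:
  assumes "r < length (repeat_indices d k)"
  shows "repeat_indices d k ! r < d"
proof -
  have "repeat_indices d k ! r \<in> set (repeat_indices d k)" using assms by simp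
  then show ?thesis by (auto simp: repeat_indices_def)
qed

lemma near_identity_inverse:
  fixes M :: "'a::euclidean_space \<Rightarrow> 'a"
  assumes M: "linear M" and near: "\<And>x. norm (M x - x) \<le> q * norm x" and q: "q \<le> 1 / 2"
  obtains R where "linear R" "\<And>x. M (R x) = x" "\<And>x. R (M x) = x"
    "\<And>x. norm (R x - x) \<le> 2 * q * norm x"
proof -
  have "inj M"
    unfolding linear_injective_0[OF M]
  proof (intro allI impI)
    fix x assume "M x = 0"
    then have "norm x \<le> q * norm x" using near[of x] by simp
    also have "\<dots> \<le> 1 / 2 * norm x" using q by (intro mult_right_mono) auto
    finally show "x = 0" by simp
  qed
  then obtain R where R: "linear R" "\<And>x. R (M x) = x" "\<And>x. M (R x) = x"
    using linear_injective_isomorphism[OF M] by blast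
  have "norm (R x - x) \<le> 2 * q * norm x" for x
  proof -
    have *: "norm (x - R x) \<le> q * norm (R x)" using near[of "R x"] R(3) by simp
    have "q \<ge> 0"
    proof -
      obtain b :: 'a where "b \<in> Basis" using nonempty_Basis by blast
      then show ?thesis using order_trans[OF norm_ge_zero near[of b]] by simp
    qed
    have "norm (R x) \<le> norm x + norm (x - R x)"
      using norm_triangle_ineq4[of x "x - R x"] by simp
    also have "\<dots> \<le> norm x + 1 / 2 * norm (R x)"
      using * mult_right_mono[OF q norm_ge_zero[of "R x"]] by linarith
    finally have "norm (R x) \<le> 2 * norm x" by simp
    then have "q * norm (R x) \<le> q * (2 * norm x)" using \<open>q \<ge> 0\<close> by (rule mult_left_mono)
    with * show ?thesis by (simp add: norm_minus_commute)
  qed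
  with R show thesis using that by blast
qed

text \<open>
  Repeat the coordinate \<open>y i \<bullet> x\<close> about \<open>K * w i\<close> times. With \<open>M x = \<Sum>i. (k i / K) * (y i \<bullet> x) *\<^sub>R v i\<close>, which is close to the
  identity for large \<open>K\<close>, the map \<open>T2\<close> sends a tuple \<open>s\<close> to the inverse of \<open>M\<close> applied to
  \<open>\<Sum>r. (s r / K) *\<^sub>R v (xs ! r)\<close>. Then \<open>T1 \<circ> T2\<close> is an orthogonal projection because the matrix \<open>y i \<bullet> v j\<close> is
  symmetric, and its row sums are close to those of the given configuration.
\<close>

lemma near_extremal_factorization:
  fixes N :: "'a::euclidean_space \<Rightarrow> real"
  assumes N: "is_norm N" and ext: "near_extremal \<epsilon> d w y v S" and \<alpha>: "0 < \<alpha>" and \<beta>: "0 < \<beta>"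
    and lower: "\<And>i x. i < d \<Longrightarrow> \<alpha> * \<bar>y i \<bullet> x\<bar> \<le> N x"
    and upper: "\<And>x \<mu>. (\<And>i. i < d \<Longrightarrow> \<bar>y i \<bullet> x\<bar> \<le> \<mu>) \<Longrightarrow> N x \<le> \<beta> * \<mu>"
    and \<eta>: "0 < \<eta>"
  shows "\<exists>n T1 T2. n \<ge> 1 \<and> orthogonal_factorization n T1 T2 \<and>
      op_norm (linf_d n) norm N T2 * op_norm UNIV N norm T1
        \<le> (\<beta> / \<alpha>) * (max_frame_value TYPE('a) + \<epsilon> + \<eta>)"
proof -
  define \<rho> where "\<rho> = max_frame_value TYPE('a) + \<epsilon>"
  have w: "\<And>i. i < d \<Longrightarrow> 0 < w i" and sum_w: "(\<Sum>i<d. w i) = 1"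
    and frame: "\<And>x. (\<Sum>i<d. (w i * (y i \<bullet> x)) *\<^sub>R v i) = x"
    and sym: "\<And>i j. i < d \<Longrightarrow> j < d \<Longrightarrow> y i \<bullet> v j = y j \<bullet> v i"
    and row: "\<And>i. i < d \<Longrightarrow> (\<Sum>j<d. w j * \<bar>y i \<bullet> v j\<bar>) \<le> \<rho>"
    using ext unfolding near_extremal_def \<rho>_def by blast+
  have w_le: "w i \<le> 1" if "i < d" for i
    using member_le_sum[of i "{..<d}" w] that w sum_w by (force intro: less_imp_le)
  have "0 < d" using sum_w by (cases d) auto
  have "0 \<le> (\<Sum>j<d. w j * \<bar>y 0 \<bullet> v j\<bar>)" using w by (intro sum_nonneg) (simp add: less_imp_le)
  with row[OF \<open>0 < d\<close>] have "0 \<le> \<rho>" by simp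
  define Z where "Z = (\<Sum>i<d. norm (y i))"
  define V where "V = (\<Sum>i<d. norm (v i))"
  define Y where "Y = (\<Sum>i<d. norm (y i) * norm (v i))"
  have Z: "norm (y i) \<le> Z" if "i < d" for i
    unfolding Z_def using that by (intro member_le_sum) auto
  have "Z \<ge> 0" "V \<ge> 0" "Y \<ge> 0" by (simp_all add: Z_def V_def Y_def sum_nonneg)
  \<comment> \<open>large enough for \<open>M\<close> to be invertible and for the row sums to grow by at most \<open>\<eta>\<close>\<close>
  obtain K :: nat where K: "max 1 (max (2 * Y) (2 * Y * Z * V / \<eta>)) < real K"
    using reals_Archimedean2 by blast
  define q where "q = Y / K"
  have "0 < real K" using K by simp
  have q: "q \<le> 1 / 2" "2 * q * Z * V \<le> \<eta>" "0 \<le> q"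
    using K \<open>0 < real K\<close> \<eta> \<open>Y \<ge> 0\<close> by (auto simp: q_def field_simps)
  define k where "k i = nat \<lfloor>K * w i\<rfloor>" for i
  have k: "real (k i) / K \<le> w i" "\<bar>real (k i) / K - w i\<bar> \<le> 1 / K" if "i < d" for i
  proof -
    have "0 \<le> K * w i" using w[OF that] by simp
    then have "real (k i) \<le> K * w i" "K * w i < real (k i) + 1"
      by (auto simp: k_def)
    then show "real (k i) / K \<le> w i" "\<bar>real (k i) / K - w i\<bar> \<le> 1 / K"
      using \<open>0 < real K\<close>
      by (auto simp: pos_divide_le_eq pos_le_divide_eq mult.commute abs_le_iff diff_le_eq
          add_divide_distrib[symmetric] le_diff_eq intro: less_imp_le)
  qed
  define M where "M x = (\<Sum>i<d. (real (k i) / K * (y i \<bullet> x)) *\<^sub>R v i)" for x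
  have M: "linear M"
    unfolding M_def
    by (intro linearI) (simp_all add: inner_add_right distrib_left scaleR_add_left sum.distrib
        scaleR_sum_right mult_ac)
  have near: "norm (M x - x) \<le> q * norm x" for x
  proof -
    have "M x - x = (\<Sum>i<d. ((real (k i) / K - w i) * (y i \<bullet> x)) *\<^sub>R v i)"
      using frame[of x] by (simp add: M_def sum_subtractf left_diff_distrib scaleR_diff_left)
    also have "norm \<dots> \<le> (\<Sum>i<d. norm (((real (k i) / K - w i) * (y i \<bullet> x)) *\<^sub>R v i))"
      by (rule norm_sum)
    also have "\<dots> \<le> (\<Sum>i<d. 1 / K * (norm (y i) * norm (v i)) * norm x)"
    proof (intro sum_mono)
      fix i assume "i \<in> {..<d}"
      then have "\<bar>real (k i) / K - w i\<bar> * \<bar>y i \<bullet> x\<bar> \<le> 1 / K * (norm (y i) * norm x)"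
        using k(2)[of i] by (intro mult_mono Cauchy_Schwarz_ineq2) auto
      from mult_right_mono[OF this norm_ge_zero[of "v i"]]
      show "norm (((real (k i) / K - w i) * (y i \<bullet> x)) *\<^sub>R v i) \<le> 1 / K * (norm (y i) * norm (v i)) * norm x"
        by (simp add: abs_mult mult_ac)
    qed
    also have "\<dots> = q * norm x"
      by (simp add: q_def Y_def sum_divide_distrib sum_distrib_right)
    finally show ?thesis .
  qed
  obtain R where R: "linear R" and MR: "\<And>x. M (R x) = x" and RM: "\<And>x. R (M x) = x"
    and Rnear: "\<And>x. norm (R x - x) \<le> 2 * q * norm x"
    using near_identity_inverse[OF M near q(1)] by blast
  define xs where "xs = repeat_indices d k"
  define n where "n = length xs"
  have sum_xs: "(\<Sum>r<n. f (xs ! r)) = (\<Sum>i<d. real (k i) *\<^sub>R f i)" for f :: "nat \<Rightarrow> 'b::real_vector"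
    unfolding n_def xs_def by (rule sum_repeat_indices)
  have xs_less: "xs ! r < d" if "r < n" for r
    using that unfolding n_def xs_def by (rule repeat_indices_nth_less)
  define T1 where "T1 x = (\<Sum>r<n. (y (xs ! r) \<bullet> x) *\<^sub>R unit_seq r)" for x
  define T2 where "T2 s = (\<Sum>r<n. (apply_bcontfun s r / K) *\<^sub>R R (v (xs ! r)))" for s
  have T1_apply: "apply_bcontfun (T1 x) r = (if r < n then y (xs ! r) \<bullet> x else 0)" for x r
    by (simp add: T1_def apply_unit_seq_sum)
  have linT1: "linear T1"
    by (intro linearI bcontfun_eqI) (simp_all add: T1_apply inner_add_right)
  have T1_range: "range T1 \<subseteq> linf_d n"
    by (auto simp: linf_d_def T1_apply)
  have linT2: "linear_on_subspace (linf_d n) T2"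
    by (simp add: linear_on_subspace_def T2_def add_divide_distrib scaleR_add_left sum.distrib
        scaleR_sum_right)
  have T2T1: "T2 (T1 x) = x" for x
  proof -
    have "T2 (T1 x) = (\<Sum>r<n. ((y (xs ! r) \<bullet> x) / K) *\<^sub>R R (v (xs ! r)))"
      by (simp add: T2_def T1_apply)
    also have "\<dots> = (\<Sum>i<d. real (k i) *\<^sub>R ((y i \<bullet> x) / K) *\<^sub>R R (v i))"
      by (rule sum_xs)
    also have "\<dots> = R (M x)"
      by (simp add: M_def linear_sum[OF R] linear_scale[OF R])
    finally show ?thesis by (simp add: RM)
  qed
  have MT2: "M (T2 s) = (\<Sum>r<n. (apply_bcontfun s r / K) *\<^sub>R v (xs ! r))" for s
    by (simp add: T2_def linear_sum[OF M] linear_scale[OF M] MR)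
  have orth: "inner_d n (s - T1 (T2 s)) (T1 x) = 0" for s x
  proof -
    define c where "c r = apply_bcontfun s r - y (xs ! r) \<bullet> T2 s" for r
    have "(\<Sum>r<n. (y (xs ! r) \<bullet> T2 s) *\<^sub>R v (xs ! r)) = (\<Sum>i<d. real (k i) *\<^sub>R (y i \<bullet> T2 s) *\<^sub>R v i)"
      by (rule sum_xs)
    also have "\<dots> = K *\<^sub>R M (T2 s)"
      using \<open>0 < real K\<close> by (simp add: M_def scaleR_sum_right)
    also have "\<dots> = (\<Sum>r<n. apply_bcontfun s r *\<^sub>R v (xs ! r))"
      using \<open>0 < real K\<close> by (simp add: MT2 scaleR_sum_right)
    finally have cv: "(\<Sum>r<n. c r *\<^sub>R v (xs ! r)) = 0"
      by (simp add: c_def scaleR_diff_left sum_subtractf)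
    \<comment> \<open>the residual \<open>c\<close> is orthogonal to the tuples \<open>r \<mapsto> y (xs ! r) \<bullet> v j\<close>, and the vectors \<open>v j\<close> span the space\<close>
    have cy: "(\<Sum>r<n. c r * (y (xs ! r) \<bullet> v j)) = 0" if j: "j < d" for j
    proof -
      have "(\<Sum>r<n. c r * (y (xs ! r) \<bullet> v j)) = y j \<bullet> (\<Sum>r<n. c r *\<^sub>R v (xs ! r))"
        unfolding inner_sum_right inner_scaleR_right
        by (intro sum.cong refl) (use xs_less sym[OF _ j] in simp)
      then show ?thesis by (simp add: cv)
    qed
    have "inner_d n (s - T1 (T2 s)) (T1 x) = (\<Sum>r<n. c r * (y (xs ! r) \<bullet> x))"
      by (simp add: inner_d_def T1_apply c_def)
    also have "\<dots> = (\<Sum>r<n. c r * (y (xs ! r) \<bullet> (\<Sum>j<d. (w j * (y j \<bullet> x)) *\<^sub>R v j)))"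
      by (simp only: frame)
    also have "\<dots> = (\<Sum>r<n. \<Sum>j<d. (w j * (y j \<bullet> x)) * (c r * (y (xs ! r) \<bullet> v j)))"
      by (simp add: inner_sum_right sum_distrib_left mult_ac)
    also have "\<dots> = (\<Sum>j<d. \<Sum>r<n. (w j * (y j \<bullet> x)) * (c r * (y (xs ! r) \<bullet> v j)))"
      by (rule sum.swap)
    also have "\<dots> = 0"
      by (simp add: sum_distrib_left[symmetric] cy)
    finally show ?thesis .
  qed
  have fact: "orthogonal_factorization n T1 T2"
    unfolding orthogonal_factorization_def orthogonal_projection_onto_def
    using linT1 T1_range linT2 T2T1 orth by auto
  have "n \<ge> 1"
  proof (rule ccontr)
    assume "\<not> n \<ge> 1"
    then have "n = 0" by simp
    then have "x = 0" for x :: 'a using T2T1[of x] unfolding T2_def by simp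
    then show False by (metis nonzero_Basis SOME_Basis)
  qed
  have "N 0 = 0" using is_norm_eq_0_iff[OF N, of 0] by simp
  have norm_T1: "norm (T1 x) \<le> 1 / \<alpha>" if "N x \<le> 1" for x
  proof (rule norm_bound)
    fix r
    show "norm (apply_bcontfun (T1 x) r) \<le> 1 / \<alpha>"
    proof (cases "r < n")
      case True
      then have "\<alpha> * \<bar>y (xs ! r) \<bullet> x\<bar> \<le> 1" using lower[OF xs_less[OF True], of x] that by simp
      then show ?thesis using True \<alpha> by (simp add: T1_apply field_simps)
    qed (use \<alpha> in \<open>simp add: T1_apply\<close>)
  qed
  have op_T1: "op_norm UNIV N norm T1 \<le> 1 / \<alpha>" 
    unfolding op_norm_def
    by (rule cSUP_least) (use norm_T1 \<open>N 0 = 0\<close> in \<open>auto intro!: exI[of _ 0]\<close>)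
  have op_T1_nonneg: "0 \<le> op_norm UNIV N norm T1"
    by (rule op_norm_nonneg[OF is_norm_norm N subspace_UNIV _ norm_T1])
      (use linT1 in \<open>auto simp: linear_on_subspace_def linear_add linear_scale\<close>)
  have row_R: "(\<Sum>r<n. \<bar>y i \<bullet> R (v (xs ! r))\<bar> / K) \<le> \<rho> + \<eta>" if i: "i < d" for i
  proof -
    have "(\<Sum>r<n. \<bar>y i \<bullet> R (v (xs ! r))\<bar> / K) = (\<Sum>j<d. real (k j) *\<^sub>R (\<bar>y i \<bullet> R (v j)\<bar> / K))"
      by (rule sum_xs)
    also have "\<dots> \<le> (\<Sum>j<d. w j * \<bar>y i \<bullet> v j\<bar> + 2 * q * Z * norm (v j))"
    proof (intro sum_mono)
      fix j assume "j \<in> {..<d}"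
      then have j: "j < d" by simp
      have "\<bar>y i \<bullet> R (v j)\<bar> \<le> \<bar>y i \<bullet> v j\<bar> + \<bar>y i \<bullet> (R (v j) - v j)\<bar>"
        by (simp add: inner_diff_right)
      also have "\<bar>y i \<bullet> (R (v j) - v j)\<bar> \<le> norm (y i) * norm (R (v j) - v j)"
        by (rule Cauchy_Schwarz_ineq2)
      also have "\<dots> \<le> Z * (2 * q * norm (v j))"
        using Z[OF i] Rnear by (intro mult_mono) (use \<open>Z \<ge> 0\<close> in auto)
      finally have "\<bar>y i \<bullet> R (v j)\<bar> \<le> \<bar>y i \<bullet> v j\<bar> + 2 * q * Z * norm (v j)" by (simp add: mult_ac)
      then have "w j * \<bar>y i \<bullet> R (v j)\<bar> \<le> w j * (\<bar>y i \<bullet> v j\<bar> + 2 * q * Z * norm (v j))"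
        using w[OF j] by (intro mult_left_mono) auto
      also have "\<dots> \<le> w j * \<bar>y i \<bullet> v j\<bar> + 1 * (2 * q * Z * norm (v j))"
        unfolding distrib_left
        using w_le[OF j] q(3) \<open>Z \<ge> 0\<close> by (intro add_left_mono mult_right_mono) auto
      finally have "w j * \<bar>y i \<bullet> R (v j)\<bar> \<le> w j * \<bar>y i \<bullet> v j\<bar> + 2 * q * Z * norm (v j)" by simp
      moreover have "real (k j) / K * \<bar>y i \<bullet> R (v j)\<bar> \<le> w j * \<bar>y i \<bullet> R (v j)\<bar>"
        using k(1)[OF j] by (intro mult_right_mono) auto
      ultimately show "real (k j) *\<^sub>R (\<bar>y i \<bullet> R (v j)\<bar> / K)
          \<le> w j * \<bar>y i \<bullet> v j\<bar> + 2 * q * Z * norm (v j)" by simp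
    qed
    also have "\<dots> = (\<Sum>j<d. w j * \<bar>y i \<bullet> v j\<bar>) + 2 * q * Z * V"
      unfolding V_def by (simp add: sum.distrib sum_distrib_left)
    also have "\<dots> \<le> \<rho> + \<eta>" using row[OF i] q(2) by simp
    finally show ?thesis .
  qed
  have norm_T2: "N (T2 s) \<le> \<beta> * (\<rho> + \<eta>)" if s: "norm s \<le> 1" for s
  proof (rule upper)
    fix i assume i: "i < d"
    have "\<bar>y i \<bullet> T2 s\<bar> = \<bar>\<Sum>r<n. apply_bcontfun s r * ((y i \<bullet> R (v (xs ! r))) / K)\<bar>"
      by (simp add: T2_def inner_sum_right)
    also have "\<dots> \<le> (\<Sum>r<n. \<bar>apply_bcontfun s r * ((y i \<bullet> R (v (xs ! r))) / K)\<bar>)"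
      by (rule sum_abs)
    also have "\<dots> \<le> (\<Sum>r<n. 1 * (\<bar>y i \<bullet> R (v (xs ! r))\<bar> / K))"
    proof (intro sum_mono)
      fix r
      have "\<bar>apply_bcontfun s r\<bar> \<le> 1" using norm_bounded[of s r] s by simp
      then have "\<bar>apply_bcontfun s r\<bar> * (\<bar>y i \<bullet> R (v (xs ! r))\<bar> / K) \<le> 1 * (\<bar>y i \<bullet> R (v (xs ! r))\<bar> / K)"
        by (rule mult_right_mono) simp
      then show "\<bar>apply_bcontfun s r * ((y i \<bullet> R (v (xs ! r))) / K)\<bar> \<le> 1 * (\<bar>y i \<bullet> R (v (xs ! r))\<bar> / K)"
        by (simp add: abs_mult)
    qed
    also have "\<dots> \<le> \<rho> + \<eta>" using row_R[OF i] by simp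
    finally show "\<bar>y i \<bullet> T2 s\<bar> \<le> \<rho> + \<eta>" .
  qed
  have op_T2: "op_norm (linf_d n) norm N T2 \<le> \<beta> * (\<rho> + \<eta>)"
    unfolding op_norm_def
    by (rule cSUP_least) (use norm_T2 subspace_0[OF subspace_linf_d, of n] in \<open>auto intro!: exI[of _ 0]\<close>)
  have "op_norm (linf_d n) norm N T2 * op_norm UNIV N norm T1 \<le> \<beta> * (\<rho> + \<eta>) * (1 / \<alpha>)"
    using op_T1 op_T1_nonneg op_T2 \<beta> \<open>0 \<le> \<rho>\<close> \<eta> by (intro mult_mono) auto
  then show ?thesis
    using \<open>n \<ge> 1\<close> fact by (intro exI[of _ n] exI[of _ T1] exI[of _ T2]) (simp add: \<rho>_def)
qed

section \<open>Normalisation and compactness\<close>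

lemma near_extremal_mono:
  "near_extremal \<epsilon> d w y v S \<Longrightarrow> \<epsilon> \<le> \<delta> \<Longrightarrow> near_extremal \<delta> d w y v S"
  unfolding near_extremal_def by (meson add_left_mono diff_left_mono order_trans)

text \<open>
  Both the frame identity and the left inverses are transported by \<open>A\<close> and its inverse \<open>B\<close>, and the
  numbers \<open>y i \<bullet> v j\<close> and \<open>y i \<bullet> z j\<close> stay the same.
\<close>

lemma near_extremal_transform:
  fixes A B :: "'a::euclidean_space \<Rightarrow> 'a"
  assumes ext: "near_extremal \<epsilon> d w y v S" and A: "linear A" and B: "linear B"
    and AB: "\<And>x. A (B x) = x" and BA: "\<And>x. B (A x) = x"
  shows "near_extremal \<epsilon> d w (\<lambda>i. adjoint A (y i)) (\<lambda>i. B (v i)) S"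
proof -
  have adj: "adjoint A a \<bullet> x = a \<bullet> A x" for a x
    using adjoint_works[OF A, of x a] by (simp add: inner_commute)
  have frame: "\<And>x. (\<Sum>i<d. (w i * (y i \<bullet> x)) *\<^sub>R v i) = x"
    and dual: "\<And>z. (\<And>x. (\<Sum>j<d. (y j \<bullet> x) *\<^sub>R z j) = x) \<Longrightarrow>
        max_frame_value TYPE('a) - \<epsilon> \<le> (\<Sum>i<d. \<Sum>j<d. w i * S i j * (y i \<bullet> z j))"
    using ext unfolding near_extremal_def by blast+
  have frame': "(\<Sum>i<d. (w i * (y i \<bullet> A x)) *\<^sub>R B (v i)) = x" for x
    using arg_cong[OF frame[of "A x"], of B]
    by (simp add: linear_sum[OF B] linear_scale[OF B] BA)
  have dual': "max_frame_value TYPE('a) - \<epsilon> \<le> (\<Sum>i<d. \<Sum>j<d. w i * S i j * (y i \<bullet> A (z j)))"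
    if z: "\<And>x. (\<Sum>j<d. (y j \<bullet> A x) *\<^sub>R z j) = x" for z
  proof (rule dual)
    fix x
    show "(\<Sum>j<d. (y j \<bullet> x) *\<^sub>R A (z j)) = x"
      using arg_cong[OF z[of "B x"], of A] by (simp add: linear_sum[OF A] linear_scale[OF A] AB)
  qed
  show ?thesis
    using ext frame' dual' unfolding near_extremal_def adj AB by blast
qed

definition polyhedral_norm :: "nat \<Rightarrow> (nat \<Rightarrow> 'a::euclidean_space) \<Rightarrow> 'a \<Rightarrow> real" where
  "polyhedral_norm d y x = Max ((\<lambda>i. \<bar>y i \<bullet> x\<bar>) ` {..<d})"

lemma polyhedral_norm_ge: "i < d \<Longrightarrow> \<bar>y i \<bullet> x\<bar> \<le> polyhedral_norm d y x"
  unfolding polyhedral_norm_def by (intro Max_ge) auto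

lemma polyhedral_norm_le:
  "0 < d \<Longrightarrow> (\<And>i. i < d \<Longrightarrow> \<bar>y i \<bullet> x\<bar> \<le> \<mu>) \<Longrightarrow> polyhedral_norm d y x \<le> \<mu>"
  unfolding polyhedral_norm_def by (intro Max.boundedI) auto

lemma near_extremal_polyhedral_norm:
  fixes y :: "nat \<Rightarrow> 'a::euclidean_space"
  assumes ext: "near_extremal \<epsilon> d w y v S"
  shows "0 < d" "is_norm (polyhedral_norm d y)"
proof -
  let ?N = "polyhedral_norm d y"
  have sum_w: "(\<Sum>i<d. w i) = 1" and frame: "\<And>x. (\<Sum>i<d. (w i * (y i \<bullet> x)) *\<^sub>R v i) = x"
    using ext unfolding near_extremal_def by blast+
  show d: "0 < d" using sum_w by (cases d) auto
  have nonneg: "0 \<le> ?N x" for x using polyhedral_norm_ge[OF d, of y x] by linarith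
  show "is_norm ?N"
    unfolding is_norm_def
  proof (intro conjI allI)
    show "0 \<le> ?N x" for x by (rule nonneg)
    show "?N x = 0 \<longleftrightarrow> x = 0" for x
    proof
      assume 0: "?N x = 0"
      have "y i \<bullet> x = 0" if "i < d" for i using polyhedral_norm_ge[OF that, of y x] 0 by simp
      then show "x = 0" using frame[of x] by simp
    next
      assume "x = 0"
      then show "?N x = 0" using polyhedral_norm_le[OF d, of y 0 0] nonneg[of 0] by simp
    qed
    show "?N (x + x') \<le> ?N x + ?N x'" for x x'
    proof (rule polyhedral_norm_le[OF d])
      fix i assume "i < d"
      from polyhedral_norm_ge[OF this, of y x] polyhedral_norm_ge[OF this, of y x']
      show "\<bar>y i \<bullet> (x + x')\<bar> \<le> ?N x + ?N x'" by (simp add: inner_add_right)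
    qed
    show "?N (c *\<^sub>R x) = \<bar>c\<bar> * ?N x" for c x
    proof -
      have le: "?N (c *\<^sub>R x) \<le> \<bar>c\<bar> * ?N x" for c x
        by (rule polyhedral_norm_le[OF d])
          (simp add: abs_mult mult_left_mono polyhedral_norm_ge)
      show ?thesis
      proof (cases "c = 0")
        case False
        then have "?N x \<le> \<bar>1 / c\<bar> * ?N (c *\<^sub>R x)" using le[of "1 / c" "c *\<^sub>R x"] by simp
        then have "\<bar>c\<bar> * ?N x \<le> ?N (c *\<^sub>R x)" using False by (simp add: field_simps)
        with le[of c x] show ?thesis by simp
      next
        case True
        then show ?thesis using le[of 0 x] nonneg[of 0] by simp
      qed
    qed
  qed
qed

text \<open>
  A substitute for an Auerbach basis: choose \<open>e k\<close> in the common kernel of the earlier functionals and \<open>f k\<close> in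
  the dual unit ball norming at \<open>e k\<close> up to a factor \<open>2\<close>. The norm \<open>2\<close> of \<open>e k\<close> leaves room for the strict inequality in
  \<open>norming_functional\<close>.
\<close>

lemma triangular_system:
  fixes N :: "'a::euclidean_space \<Rightarrow> real"
  assumes N: "is_norm N"
  shows "k \<le> DIM('a) \<Longrightarrow> \<exists>e f :: nat \<Rightarrow> 'a. \<forall>i<k. N (e i) = 2 \<and> (\<forall>x. f i \<bullet> x \<le> N x) \<and>
      1 < f i \<bullet> e i \<and> (\<forall>l<k. i < l \<longrightarrow> f i \<bullet> e l = 0)"
proof (induction k)
  case (Suc k)
  then have "\<exists>e f :: nat \<Rightarrow> 'a. \<forall>i<k. N (e i) = 2 \<and> (\<forall>x. f i \<bullet> x \<le> N x) \<and>
      1 < f i \<bullet> e i \<and> (\<forall>l<k. i < l \<longrightarrow> f i \<bullet> e l = 0)"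
    by simp
  then obtain e f :: "nat \<Rightarrow> 'a" where ef: "\<And>i. i < k \<Longrightarrow> N (e i) = 2"
    "\<And>i x. i < k \<Longrightarrow> f i \<bullet> x \<le> N x" "\<And>i. i < k \<Longrightarrow> 1 < f i \<bullet> e i"
    "\<And>i l. i < k \<Longrightarrow> l < k \<Longrightarrow> i < l \<Longrightarrow> f i \<bullet> e l = 0"
    by blast
  have "dim (f ` {..<k}) \<le> card (f ` {..<k})" by (intro dim_le_card') auto
  also have "\<dots> \<le> k" using card_image_le[of "{..<k}" f] by simp
  finally have "dim (f ` {..<k}) < DIM('a)" using Suc.prems by simp
  then obtain x where x: "x \<noteq> 0" "\<And>h. h \<in> span (f ` {..<k}) \<Longrightarrow> orthogonal x h"
    using orthogonal_to_subspace_exists by blast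
  define z where "z = (2 / N x) *\<^sub>R x"
  have Nz: "N z = 2" using is_norm_pos[OF N x(1)] by (simp add: z_def is_norm_scale[OF N])
  obtain g where g: "\<And>x. g \<bullet> x \<le> N x" "1 < g \<bullet> z"
    using norming_functional[OF N, of z] Nz by auto
  have fz: "f i \<bullet> z = 0" if "i < k" for i
  proof -
    have "f i \<in> span (f ` {..<k})" using that by (intro span_base) auto
    from x(2)[OF this] show ?thesis by (simp add: z_def orthogonal_def inner_commute)
  qed
  show ?case
    by (intro exI[of _ "e(k := z)"] exI[of _ "f(k := g)"]) (auto simp: less_Suc_eq ef Nz g fz)
qed simp

text \<open>
  In the basis \<open>e\<close> of a triangular system, coefficients can be recovered one after the other:
  \<open>\<bar>a k\<bar> \<le> N x + 2 * (\<Sum>l<k. \<bar>a l\<bar>)\<close>, whence \<open>\<bar>a k\<bar> \<le> 3 ^ k * N x\<close>. So the distortion \<open>C\<close> depends only on the dimension.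
\<close>

lemma normalizing_map:
  fixes N :: "'a::euclidean_space \<Rightarrow> real"
  assumes N: "is_norm N"
  defines "C \<equiv> 2 * real DIM('a) * 3 ^ DIM('a)"
  obtains A B :: "'a \<Rightarrow> 'a" where "linear A" "linear B" "\<And>x. A (B x) = x" "\<And>x. B (A x) = x"
    "\<And>x. norm x \<le> C * N (A x)" "\<And>x. N (A x) \<le> C * norm x"
proof -
  let ?n = "DIM('a)"
  obtain e f :: "nat \<Rightarrow> 'a" where Ne: "\<And>i. i < ?n \<Longrightarrow> N (e i) = 2"
    and f: "\<And>i x. i < ?n \<Longrightarrow> f i \<bullet> x \<le> N x" and fe: "\<And>i. i < ?n \<Longrightarrow> 1 < f i \<bullet> e i"
    and fe0: "\<And>i l. i < ?n \<Longrightarrow> l < ?n \<Longrightarrow> i < l \<Longrightarrow> f i \<bullet> e l = 0"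
    using triangular_system[OF N order_refl] by blast
  have f_abs: "\<bar>f i \<bullet> x\<bar> \<le> N x" if "i < ?n" for i x
    using f[OF that, of x] f[OF that, of "- x"] by (simp add: is_norm_minus[OF N] abs_le_iff)
  obtain \<beta> :: "nat \<Rightarrow> 'a" where \<beta>: "bij_betw \<beta> {..<?n} Basis"
    using ex_bij_betw_nat_finite[OF finite_Basis] by (metis atLeast0LessThan)
  then have \<beta>_Basis: "\<beta> k \<in> Basis" if "k < ?n" for k
    using that by (auto dest: bij_betwE)
  define A where "A x = (\<Sum>k<?n. (x \<bullet> \<beta> k) *\<^sub>R e k)" for x
  have A: "linear A"
    by (intro linearI) (simp_all add: A_def inner_add_left scaleR_add_left sum.distrib scaleR_sum_right)
  have coeff: "\<bar>x \<bullet> \<beta> k\<bar> \<le> 3 ^ k * N (A x)" if "k < ?n" for k x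
    using that
  proof (induction k rule: less_induct)
    case (less k)
    have "f k \<bullet> A x = (\<Sum>l<?n. (x \<bullet> \<beta> l) * (f k \<bullet> e l))" by (simp add: A_def inner_sum_right)
    also have "\<dots> = (\<Sum>l<Suc k. (x \<bullet> \<beta> l) * (f k \<bullet> e l))"
      by (rule sum.mono_neutral_right) (use less.prems fe0[OF less.prems] in auto)
    finally have split: "(x \<bullet> \<beta> k) * (f k \<bullet> e k) = f k \<bullet> A x - (\<Sum>l<k. (x \<bullet> \<beta> l) * (f k \<bullet> e l))"
      by simp
    have "\<bar>x \<bullet> \<beta> k\<bar> \<le> \<bar>x \<bullet> \<beta> k\<bar> * \<bar>f k \<bullet> e k\<bar>"
      using fe[OF less.prems] by (simp add: mult_le_cancel_left1)
    also have "\<dots> \<le> \<bar>f k \<bullet> A x\<bar> + \<bar>\<Sum>l<k. (x \<bullet> \<beta> l) * (f k \<bullet> e l)\<bar>"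
      unfolding abs_mult[symmetric] split by (rule abs_triangle_ineq4)
    also have "\<bar>f k \<bullet> A x\<bar> \<le> N (A x)" by (rule f_abs[OF less.prems])
    also have "\<bar>\<Sum>l<k. (x \<bullet> \<beta> l) * (f k \<bullet> e l)\<bar> \<le> (\<Sum>l<k. \<bar>(x \<bullet> \<beta> l) * (f k \<bullet> e l)\<bar>)"
      by (rule sum_abs)
    also have "\<dots> \<le> (\<Sum>l<k. 3 ^ l * N (A x) * 2)"
      unfolding abs_mult
    proof (intro sum_mono mult_mono)
      fix l assume "l \<in> {..<k}"
      then have l: "l < k" "l < ?n" using less.prems by auto
      show "\<bar>x \<bullet> \<beta> l\<bar> \<le> 3 ^ l * N (A x)" by (rule less.IH[OF l])
      show "\<bar>f k \<bullet> e l\<bar> \<le> 2" using f_abs[OF less.prems, of "e l"] Ne[OF l(2)] by simp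
    qed (use is_norm_nonneg[OF N] in auto)
    also have "\<dots> = (\<Sum>l<k. 3 ^ l) * (N (A x) * 2)" by (simp only: sum_distrib_right mult.assoc)
    also have "(\<Sum>l<k. 3 ^ l) = ((3::real) ^ k - 1) / 2" by (subst geometric_sum) auto
    also have "N (A x) + (3 ^ k - 1) / 2 * (N (A x) * 2) = 3 ^ k * N (A x)"
      by (simp add: field_simps)
    finally show ?case by simp
  qed
  have lower: "norm x \<le> C * N (A x)" for x
  proof -
    have "norm x \<le> (\<Sum>b\<in>Basis. \<bar>x \<bullet> b\<bar>)" by (rule norm_le_l1)
    also have "\<dots> = (\<Sum>k<?n. \<bar>x \<bullet> \<beta> k\<bar>)"
      using sum.reindex_bij_betw[OF \<beta>, of "\<lambda>b. \<bar>x \<bullet> b\<bar>"] by simp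
    also have "\<dots> \<le> (\<Sum>k<?n. 3 ^ ?n * N (A x))"
    proof (intro sum_mono)
      fix k assume "k \<in> {..<?n}"
      then have "\<bar>x \<bullet> \<beta> k\<bar> \<le> 3 ^ k * N (A x)" by (intro coeff) simp
      also have "\<dots> \<le> 3 ^ ?n * N (A x)"
        using \<open>k \<in> {..<?n}\<close> is_norm_nonneg[OF N] by (intro mult_right_mono power_increasing) auto
      finally show "\<bar>x \<bullet> \<beta> k\<bar> \<le> 3 ^ ?n * N (A x)" .
    qed
    also have "\<dots> = real ?n * (3 ^ ?n * N (A x))" by simp
    also have "\<dots> \<le> 2 * (real ?n * (3 ^ ?n * N (A x)))" using is_norm_nonneg[OF N, of "A x"] by simp
    finally show ?thesis by (simp add: C_def mult_ac)
  qed
  have upper: "N (A x) \<le> C * norm x" for x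
  proof -
    have "N (A x) \<le> (\<Sum>k<?n. N ((x \<bullet> \<beta> k) *\<^sub>R e k))" unfolding A_def by (rule is_norm_sum[OF N])
    also have "\<dots> \<le> (\<Sum>k<?n. norm x * 2)"
      by (intro sum_mono) (use Ne Basis_le_norm[OF \<beta>_Basis, of _ x] in \<open>simp add: is_norm_scale[OF N]\<close>)
    also have "\<dots> = (2 * real ?n * norm x) * 1" by simp
    also have "\<dots> \<le> (2 * real ?n * norm x) * 3 ^ ?n" by (intro mult_left_mono) auto
    finally show ?thesis by (simp add: C_def mult_ac)
  qed
  have "inj A"
    unfolding linear_injective_0[OF A]
  proof (intro allI impI)
    fix x assume "A x = 0"
    then show "x = 0" using lower[of x] is_norm_eq_0_iff[OF N, of 0] by simp
  qed
  then obtain B where "linear B" "\<And>x. B (A x) = x" "\<And>x. A (B x) = x"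
    using linear_injective_isomorphism[OF A] by blast
  then show thesis using that A lower upper by blast
qed

lemma exists_normalized_near_extremal:
  assumes "0 < \<epsilon>"
  defines "C \<equiv> 2 * real DIM('a) * 3 ^ DIM('a)"
  shows "\<exists>d w (y :: nat \<Rightarrow> 'a::euclidean_space) v S. near_extremal \<epsilon> d w y v S \<and>
      (\<forall>x. norm x \<le> C * polyhedral_norm d y x \<and> polyhedral_norm d y x \<le> C * norm x)"
proof -
  obtain d w and y :: "nat \<Rightarrow> 'a" and v S where ext: "near_extremal \<epsilon> d w y v S"
    using exists_near_extremal[OF assms(1)] by blast
  obtain A B :: "'a \<Rightarrow> 'a" where AB: "linear A" "linear B" "\<And>x. A (B x) = x" "\<And>x. B (A x) = x"
    and bounds: "\<And>x. norm x \<le> C * polyhedral_norm d y (A x)"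
      "\<And>x. polyhedral_norm d y (A x) \<le> C * norm x"
    using normalizing_map[OF near_extremal_polyhedral_norm(2)[OF ext]] unfolding C_def by blast
  have "polyhedral_norm d (\<lambda>i. adjoint A (y i)) x = polyhedral_norm d y (A x)" for x
    using adjoint_works[OF AB(1), of x] by (simp add: polyhedral_norm_def inner_commute)
  then show ?thesis
    using near_extremal_transform[OF ext AB] bounds by metis
qed

text \<open>
  The norms are uniformly Lipschitz, so the Arzela-Ascoli theorem applies on the unit ball; homogeneity extends
  the limit to the whole space.
\<close>

lemma norms_subsequence_limit:
  fixes F :: "nat \<Rightarrow> 'a::euclidean_space \<Rightarrow> real"
  assumes F: "\<And>n. is_norm (F n)" and C: "0 < C"
    and lower: "\<And>n x. norm x \<le> C * F n x" and upper: "\<And>n x. F n x \<le> C * norm x"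
  shows "\<exists>N r. is_norm N \<and> strict_mono (r :: nat \<Rightarrow> nat) \<and> (\<forall>x. norm x \<le> C * N x) \<and>
    (\<forall>e>0. \<exists>m. \<forall>n\<ge>m. \<forall>x. \<bar>F (r n) x - N x\<bar> \<le> e * norm x)"
proof -
  obtain g r where r: "strict_mono (r :: nat \<Rightarrow> nat)"
    and g: "\<And>e. 0 < e \<Longrightarrow> \<exists>m. \<forall>n x. n \<ge> m \<and> x \<in> cball 0 1 \<longrightarrow> norm (F (r n) x - g x) < e"
  proof (rule Arzela_Ascoli[of "cball (0::'a) 1" F C])
    show "norm (F n x) \<le> C" if "x \<in> cball 0 1" for n x
    proof -
      have "C * norm x \<le> C * 1" using that C by (intro mult_left_mono) auto
      then show ?thesis using upper[of n x] is_norm_nonneg[OF F, of n x] by simp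
    qed
    show "\<exists>\<delta>>0. \<forall>n y. y \<in> cball 0 1 \<and> norm (x - y) < \<delta> \<longrightarrow> norm (F n x - F n y) < e"
      if "0 < e" for x e
    proof (intro exI[of _ "e / C"] conjI allI impI)
      show "0 < e / C" using that C by simp
      fix n y assume "y \<in> cball 0 1 \<and> norm (x - y) < e / C"
      then have "C * norm (x - y) < e" using C by (simp add: field_simps)
      then show "norm (F n x - F n y) < e"
        using is_norm_diff[OF F, of n x y] upper[of n "x - y"] by simp
    qed
  qed (auto intro: that)
  define N where "N x = norm x * g (sgn x)" for x
  have unif: "\<exists>m. \<forall>n\<ge>m. \<forall>x. \<bar>F (r n) x - N x\<bar> \<le> e * norm x" if e: "0 < e" for e
  proof -
    obtain m where m: "\<And>n x. n \<ge> m \<Longrightarrow> x \<in> cball 0 1 \<Longrightarrow> norm (F (r n) x - g x) < e"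
      using g[OF e] by blast
    have "\<bar>F (r n) x - N x\<bar> \<le> e * norm x" if "n \<ge> m" for n x
    proof -
      have "F (r n) x = norm x * F (r n) (sgn x)"
        using is_norm_scale[OF F, of "r n" "norm x" "sgn x"]
        by (cases "x = 0") (simp_all add: sgn_div_norm is_norm_eq_0_iff[OF F])
      then have "\<bar>F (r n) x - N x\<bar> = norm x * \<bar>F (r n) (sgn x) - g (sgn x)\<bar>"
        by (simp add: N_def abs_mult right_diff_distrib[symmetric])
      also have "\<dots> \<le> norm x * e"
        using m[OF that, of "sgn x"] by (intro mult_left_mono) (auto simp: norm_sgn less_imp_le)
      finally show ?thesis by (simp add: mult.commute)
    qed
    then show ?thesis by blast
  qed
  have lim: "(\<lambda>n. F (r n) x) \<longlonglongrightarrow> N x" for x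
  proof (rule LIMSEQ_I)
    fix e :: real assume e: "0 < e"
    then obtain m where m: "\<And>n. n \<ge> m \<Longrightarrow> \<bar>F (r n) x - N x\<bar> \<le> e / (norm x + 1) * norm x"
      using unif[of "e / (norm x + 1)"] by (auto simp: add_nonneg_pos)
    have "norm x / (norm x + 1) < 1" by (simp add: divide_less_eq add_nonneg_pos)
    then have "e * (norm x / (norm x + 1)) < e" using mult_strict_left_mono[OF _ e] by fastforce
    then show "\<exists>m. \<forall>n\<ge>m. norm (F (r n) x - N x) < e"
      using m by (intro exI[of _ m]) force
  qed
  have N_lower: "norm x \<le> C * N x" for x
    by (rule LIMSEQ_le_const[OF tendsto_mult_left[OF lim]]) (use lower in auto)
  have "is_norm N"
    unfolding is_norm_def
  proof (intro conjI allI)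
    show "0 \<le> N x" for x by (rule LIMSEQ_le_const[OF lim]) (use is_norm_nonneg[OF F] in auto)
    show "N x = 0 \<longleftrightarrow> x = 0" for x
    proof
      assume "N x = 0"
      then show "x = 0" using N_lower[of x] by simp
    qed (simp add: N_def)
    show "N (x + y) \<le> N x + N y" for x y
      by (rule LIMSEQ_le[OF lim tendsto_add[OF lim lim]]) (use is_norm_triangle[OF F] in auto)
    show "N (c *\<^sub>R x) = \<bar>c\<bar> * N x" for c x
      by (rule LIMSEQ_unique[OF lim]) (use tendsto_mult_left[OF lim] in \<open>simp add: is_norm_scale[OF F]\<close>)
  qed
  with r N_lower unif show ?thesis by (intro exI[of _ N] exI[of _ r]) simp
qed

text \<open>
  A uniform limit of normalised polyhedral norms of configurations with \<open>\<epsilon> \<rightarrow> 0\<close>. The limit is within a factor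
  \<open>1 + \<epsilon>\<close> of such a polyhedral norm for every \<open>\<epsilon>\<close>, and both estimates of the previous sections tolerate this
  factor.
\<close>

lemma exists_limit_norm:
  shows "\<exists>N :: 'a::euclidean_space \<Rightarrow> real. is_norm N \<and>
    (\<forall>\<epsilon>>0. \<exists>d w y v S. near_extremal \<epsilon> d w y v S \<and>
       (\<forall>i<d. \<forall>x. 1 / (1 + \<epsilon>) * \<bar>y i \<bullet> x\<bar> \<le> N x) \<and>
       (\<forall>x \<mu>. (\<forall>i<d. \<bar>y i \<bullet> x\<bar> \<le> \<mu>) \<longrightarrow> N x \<le> (1 + \<epsilon>) * \<mu>))"
proof -
  define C where "C = 2 * real DIM('a) * 3 ^ DIM('a)"
  have "0 < C" using DIM_positive[where 'a='a] by (simp add: C_def)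
  have "\<forall>n. \<exists>d w (y :: nat \<Rightarrow> 'a) v S. near_extremal (1 / real (Suc n)) d w y v S \<and>
      (\<forall>x. norm x \<le> C * polyhedral_norm d y x \<and> polyhedral_norm d y x \<le> C * norm x)"
    unfolding C_def by (intro allI exists_normalized_near_extremal) simp
  then obtain d w and y :: "nat \<Rightarrow> nat \<Rightarrow> 'a" and v S where
    ext: "\<And>n. near_extremal (1 / real (Suc n)) (d n) (w n) (y n) (v n) (S n)"
    and bounds: "\<And>n x. norm x \<le> C * polyhedral_norm (d n) (y n) x"
      "\<And>n x. polyhedral_norm (d n) (y n) x \<le> C * norm x"
    by metis
  define F where "F n = polyhedral_norm (d n) (y n)" for n
  have F: "is_norm (F n)" and d: "0 < d n" for n
    unfolding F_def using near_extremal_polyhedral_norm[OF ext] by blast+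
  obtain N and r :: "nat \<Rightarrow> nat" where N: "is_norm N" and r: "strict_mono r" and N_lower: "\<And>x. norm x \<le> C * N x"
    and unif: "\<And>e. 0 < e \<Longrightarrow> \<exists>m. \<forall>n\<ge>m. \<forall>x. \<bar>F (r n) x - N x\<bar> \<le> e * norm x"
    using norms_subsequence_limit[where F = F and C = C, OF F \<open>0 < C\<close> bounds[folded F_def]]
    by blast
  have "\<exists>d w y v S. near_extremal \<epsilon> d w y v S \<and>
       (\<forall>i<d. \<forall>x. 1 / (1 + \<epsilon>) * \<bar>y i \<bullet> x\<bar> \<le> N x) \<and>
       (\<forall>x \<mu>. (\<forall>i<d. \<bar>y i \<bullet> x\<bar> \<le> \<mu>) \<longrightarrow> N x \<le> (1 + \<epsilon>) * \<mu>)" if \<epsilon>: "0 < \<epsilon>" for \<epsilon>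
  proof -
    obtain m1 where m1: "\<And>n x. n \<ge> m1 \<Longrightarrow> \<bar>F (r n) x - N x\<bar> \<le> \<epsilon> / C * norm x"
      using unif[of "\<epsilon> / C"] \<epsilon> \<open>0 < C\<close> by auto
    obtain m2 where m2: "1 / real (Suc m2) < \<epsilon>" using nat_approx_posE[OF \<epsilon>] by blast
    define n where "n = max m1 m2"
    have "m2 \<le> r n" using seq_suble[OF r, of n] by (simp add: n_def)
    then have "1 / real (Suc (r n)) \<le> 1 / real (Suc m2)" by (intro divide_left_mono) auto
    then have ext': "near_extremal \<epsilon> (d (r n)) (w (r n)) (y (r n)) (v (r n)) (S (r n))"
      using near_extremal_mono[OF ext] m2 by simp
    have close: "\<bar>F (r n) x - N x\<bar> \<le> \<epsilon> / C * norm x" for x using m1[of n] by (simp add: n_def)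
    have FN: "F (r n) x \<le> (1 + \<epsilon>) * N x" and NF: "N x \<le> (1 + \<epsilon>) * F (r n) x" for x
    proof -
      have "\<epsilon> / C * norm x \<le> \<epsilon> / C * (C * N x)"
        using N_lower \<epsilon> \<open>0 < C\<close> by (intro mult_left_mono) auto
      moreover have "\<epsilon> / C * norm x \<le> \<epsilon> / C * (C * F (r n) x)"
        using bounds(1) \<epsilon> \<open>0 < C\<close> unfolding F_def by (intro mult_left_mono) auto
      ultimately have "\<epsilon> / C * norm x \<le> \<epsilon> * N x" "\<epsilon> / C * norm x \<le> \<epsilon> * F (r n) x"
        using \<open>0 < C\<close> by simp_all
      then show "F (r n) x \<le> (1 + \<epsilon>) * N x" "N x \<le> (1 + \<epsilon>) * F (r n) x"
        using close[of x] by (simp_all add: distrib_right abs_le_iff)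
    qed
    have "1 / (1 + \<epsilon>) * \<bar>y (r n) i \<bullet> x\<bar> \<le> N x" if "i < d (r n)" for i x
    proof -
      have "\<bar>y (r n) i \<bullet> x\<bar> \<le> (1 + \<epsilon>) * N x"
        using polyhedral_norm_ge[OF that, of "y (r n)" x] FN[of x] unfolding F_def by linarith
      then show ?thesis using \<epsilon> by (simp add: pos_divide_le_eq mult.commute)
    qed
    moreover have "N x \<le> (1 + \<epsilon>) * \<mu>" if "\<forall>i<d (r n). \<bar>y (r n) i \<bullet> x\<bar> \<le> \<mu>" for x \<mu>
    proof -
      have "F (r n) x \<le> \<mu>" unfolding F_def using that by (intro polyhedral_norm_le d) auto
      then have "(1 + \<epsilon>) * F (r n) x \<le> (1 + \<epsilon>) * \<mu>" using \<epsilon> by (intro mult_left_mono) auto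
      with NF[of x] show ?thesis by simp
    qed
    ultimately show ?thesis using ext' by blast
  qed
  with N show ?thesis by blast
qed

lemma extremal_norm:
  shows "\<exists>N :: 'a::euclidean_space \<Rightarrow> real. is_norm N \<and> proj_const N = max_frame_value TYPE('a) \<and>
     proj_const N = Inf {op_norm (linf_d d) norm N T2 * op_norm UNIV N norm T1 | d T1 T2.
                    d \<ge> 1 \<and> orthogonal_factorization d T1 T2}"
proof -
  let ?\<phi> = "max_frame_value TYPE('a)"
  obtain N :: "'a \<Rightarrow> real" where N: "is_norm N" and
    approx: "\<And>\<epsilon>. 0 < \<epsilon> \<Longrightarrow> \<exists>d w y v S. near_extremal \<epsilon> d w y v S \<and>
       (\<forall>i<d. \<forall>x. 1 / (1 + \<epsilon>) * \<bar>y i \<bullet> x\<bar> \<le> N x) \<and>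
       (\<forall>x \<mu>. (\<forall>i<d. \<bar>y i \<bullet> x\<bar> \<le> \<mu>) \<longrightarrow> N x \<le> (1 + \<epsilon>) * \<mu>)"
    using exists_limit_norm[where 'a='a] by blast
  let ?F = "{op_norm (linf_d d) norm N T2 * op_norm UNIV N norm T1 | d T1 T2.
                    d \<ge> 1 \<and> orthogonal_factorization d T1 T2}"
  have ge: "proj_const N \<le> c" if "c \<in> ?F" for c
    using that proj_const_le_factorization[OF N] unfolding orthogonal_factorization_def by blast
  have near: "?\<phi> \<le> (1 + \<epsilon>) ^ 2 * (proj_const N + 0 * \<epsilon>) + \<epsilon> \<and>
      (\<exists>c\<in>?F. c \<le> (1 + \<epsilon>) ^ 2 * (?\<phi> + 2 * \<epsilon>))" if \<epsilon>: "0 < \<epsilon>" for \<epsilon>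
  proof -
    obtain d w y v S where ext: "near_extremal \<epsilon> d w y v S"
      and lower: "\<And>i x. i < d \<Longrightarrow> 1 / (1 + \<epsilon>) * \<bar>y i \<bullet> x\<bar> \<le> N x"
      and upper: "\<And>x \<mu>. (\<And>i. i < d \<Longrightarrow> \<bar>y i \<bullet> x\<bar> \<le> \<mu>) \<Longrightarrow> N x \<le> (1 + \<epsilon>) * \<mu>"
      using approx[OF \<epsilon>] by blast
    have pos: "0 < 1 / (1 + \<epsilon>)" "0 < 1 + \<epsilon>" using \<epsilon> by auto
    have ratio: "(1 + \<epsilon>) / (1 / (1 + \<epsilon>)) = (1 + \<epsilon>) ^ 2" by (simp add: power2_eq_square)
    have "?\<phi> - \<epsilon> \<le> (1 + \<epsilon>) ^ 2 * proj_const N"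
      using proj_const_ge[OF N ext pos lower upper] unfolding ratio by blast
    moreover have "\<exists>n T1 T2. n \<ge> 1 \<and> orthogonal_factorization n T1 T2 \<and>
        op_norm (linf_d n) norm N T2 * op_norm UNIV N norm T1 \<le> (1 + \<epsilon>) ^ 2 * (?\<phi> + \<epsilon> + \<epsilon>)"
      using near_extremal_factorization[OF N ext pos lower upper \<epsilon>] unfolding ratio by blast
    ultimately show ?thesis by (simp add: algebra_simps) blast
  qed
  have "?\<phi> \<le> proj_const N"
  proof (rule tendsto_lowerbound)
    show "((\<lambda>\<epsilon>. (1 + \<epsilon>) ^ 2 * (proj_const N + 0 * \<epsilon>) + \<epsilon>) \<longlongrightarrow> proj_const N) (at_right 0)"
      by (auto intro!: tendsto_eq_intros)
    show "\<forall>\<^sub>F \<epsilon> in at_right 0. ?\<phi> \<le> (1 + \<epsilon>) ^ 2 * (proj_const N + 0 * \<epsilon>) + \<epsilon>"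
      using eventually_at_right_less by (rule eventually_mono) (use near in blast)
  qed simp
  then have eq: "proj_const N = ?\<phi>"
    using proj_const_le_max_frame_value[OF N] by simp
  have bdd: "bdd_below ?F" using ge by (rule bdd_belowI)
  have "Inf ?F \<le> ?\<phi>"
  proof (rule le_if_le_near_one)
    fix \<epsilon> :: real assume "0 < \<epsilon>"
    then obtain c where "c \<in> ?F" "c \<le> (1 + \<epsilon>) ^ 2 * (?\<phi> + 2 * \<epsilon>)" using near by blast
    then show "Inf ?F \<le> (1 + \<epsilon>) ^ 2 * (?\<phi> + 2 * \<epsilon>)"
      using cInf_lower[OF _ bdd] order_trans by blast
  qed
  moreover have "proj_const N \<le> Inf ?F"
  proof (rule cInf_greatest)
    show "?F \<noteq> {}" using near[OF zero_less_one] by blast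
  qed (rule ge)
  ultimately have "proj_const N = Inf ?F" using eq by simp
  with N eq show ?thesis by blast
qed

theorem corollary1p3:
  shows "\<exists>N :: real ^ 'n \<Rightarrow> real.
           is_norm N \<and>
           proj_const N = max_proj_const TYPE('n) \<and>
           proj_const N =
             Inf {op_norm (linf_d d) norm N T2 * op_norm UNIV N norm T1 | d T1 T2.
                    d \<ge> 1 \<and> orthogonal_factorization d T1 T2}"
proof -
  obtain N :: "real ^ 'n \<Rightarrow> real" where N: "is_norm N"
    and eq: "proj_const N = max_frame_value TYPE(real ^ 'n)"
    and Inf: "proj_const N = Inf {op_norm (linf_d d) norm N T2 * op_norm UNIV N norm T1 | d T1 T2.
                    d \<ge> 1 \<and> orthogonal_factorization d T1 T2}"
    using extremal_norm[where 'a = "real ^ 'n"] by blast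
  have "max_proj_const TYPE('n) = proj_const N"
    unfolding max_proj_const_def
    by (rule Greatest_equality) (use N eq proj_const_le_max_frame_value in auto)
  then show ?thesis using N Inf by (intro exI[of _ N]) simp
qed

end
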